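(* Let $(\eta,\beta)\in Z^1_c(Q;\hat V)\times Z^2(Q;V)$ be a compatible pair of cocycles with $\eta$ essentially bijective, let $G$ be the extension of $V$ by $Q$ defined by $\beta$, and let $b\colon Q\times Q\to\mathbb T$ be a Borel map with $\psi=\partial b$. Define a map $\pi\colon G\to U(L^2(Q))$ by $$(\pi(q,v)\varphi)(q_0):=e^{-i\langle\eta(q_0),v\rangle}\,b(q_0^{-1},q)\,\varphi(q^{-1}q_0),\qquad \varphi\in L^2(Q).$$ Then $\pi$ is a projective unitary representation of $G$ with cocycle $\omega$, that is, $\pi(g_1)\pi(g_2)=\omega(g_1,g_2)\,\pi(g_1g_2)$ for all $g_1,g_2\in G$. Furthermore, $\pi$ is irreducible and square-integrable, and its Duflo--Moore operator is the operator of multiplication by the function $\Delta^{-1}|_Q=|\cdot|\,\Delta_Q^{-1}$ on $L^2(Q)$.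
   Context: Groups. $Q$ and $V$ are second countable locally compact groups, $V$ is abelian (written additively), and $Q$ acts on $V$ through a continuous homomorphism $Q\to\mathrm{Aut}(V)$. $\hat V$ is the Pontryagin dual (written additively), the pairing of $\hat V$ and $V$ is written $e^{i\langle\xi,v\rangle}\in\mathbb T$ (notation only), and $Q$ acts on $\hat V$ by the dual action $e^{i\langle q^\flat\xi,v\rangle}=e^{i\langle\xi,q^{-1}v\rangle}$. Cohomology is Moore cohomology with Borel cochains. $\beta\in Z^2(Q;V)$ is a Borel map $Q\times Q\to V$ with $\beta(q_1,q_2)+\beta(q_1q_2,q_3)=q_1\beta(q_2,q_3)+\beta(q_1,q_2q_3)$; $G$ is $Q\times V$ as a Borel space, with product $(q_1,v_1)(q_2,v_2)=(q_1q_2,v_1+q_1v_2+\beta(q_1,q_2))$ and the corresponding second countable locally compact group topology (in general not the product topology). Write $g=(q,v)$, $g_j=(q_j,v_j)$. Cocycles. $Z^1_c(Q;\hat V)$ is the set of continuous maps $\eta\colon Q\to\hat V$ with $\eta(q_1q_2)=\eta(q_1)+q_1^\flat\eta(q_2)$. $\eta$ is essentially bijective if it is a measure class isomorphism $Q\to\hat V$ (with respect to Haar measures; i.e. after removing null sets it is a Borel isomorphism preserving null sets in both directions). Put $\psi(q_1,q_2,q_3):=e^{i\langle\eta(q_1^{-1}),\beta(q_2,q_3)\rangle}$, a $3$-cocycle in $Z^3(Q;\mathbb T)$. The pair $(\eta,\beta)$ is compatible if $[\psi]=[1]$ in $H^3(Q;\mathbb T)$. The coboundary convention is $(\partial b)(q_1,q_2,q_3)=\dfrac{b(q_2,q_3)\,b(q_1,q_2q_3)}{b(q_1,q_2)\,b(q_1q_2,q_3)}$.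 The $2$-cocycle $\omega\in Z^2(G;\mathbb T)$ is $\omega(g_1,g_2):=\overline{\omega_\eta(g_1,g_2)}\,b(q_1,q_2)$, where $\omega_\eta(g_1,g_2):=e^{i\langle\eta(q_1^{-1}),v_2\rangle}$. Measures. $|q|=|q|_V$ is defined by $\int_V f(qv)\,dv=|q|^{-1}\int_V f(v)\,dv$. $dq$ is a left Haar measure on $Q$ and $\Delta_Q$ the modular function; left Haar measure and modular function of $G$ are $d(q,v)=|q|^{-1}dq\,dv$ and $\Delta(q,v)=\Delta_Q(q)/|q|$; $\Delta|_Q(q):=\Delta_Q(q)/|q|$. Given a Haar measure $d\xi$ on $\hat V$, $dq$ is normalized by $\int_Q f(\eta(q))\,|q|^{-1}dq=\int_{\hat V}f(\xi)\,d\xi$ for positive Borel $f$, and $dv$ is normalized so that the Fourier transform $(\mathcal F_Vf)(\xi)=\int_V e^{-i\langle\xi,v\rangle}f(v)\,dv$ is unitary $L^2(V)\to L^2(\hat V)$. The Duflo--Moore operator of a square-integrable irreducible projective representation $\pi$ is the positive nonsingular (generally unbounded) operator $D$ such that $\int_G|\langle\varphi_1,\pi(g)\varphi_2\rangle|^2\,dg=\|\varphi_1\|^2\,\|D^{1/2}\varphi_2\|^2$. *)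

theory Defs
  imports "HOL-Analysis.Analysis" "HOL-Algebra.Coset" "HOL-Algebra.Bij"
begin

section \<open>Locally compact groups\<close>

text \<open>A group is a \<^theory>\<open>HOL-Algebra.Group\<close> record together with an abstract topology on its
  carrier; the abelian group \<open>V\<close> and its dual are written multiplicatively as well.
  Locally compact groups are Hausdorff.\<close>

definition lcsc_group :: "('a, 'm) monoid_scheme \<Rightarrow> 'a topology \<Rightarrow> bool" where
  "lcsc_group G T \<longleftrightarrow>
     group G \<and> topspace T = carrier G \<and>
     continuous_map (prod_topology T T) T (\<lambda>(x, y). x \<otimes>\<^bsub>G\<^esub> y) \<and>
     continuous_map T T (m_inv G) \<and>
     Hausdorff_space T \<and> locally_compact_space T \<and> second_countable T"

definition borel_of :: "'a topology \<Rightarrow> 'a measure" where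
  "borel_of T = sigma (topspace T) {U. openin T U}"

definition left_haar_measure :: "('a, 'm) monoid_scheme \<Rightarrow> 'a topology \<Rightarrow> 'a measure \<Rightarrow> bool" where
  "left_haar_measure G T \<mu> \<longleftrightarrow>
     sets \<mu> = sets (borel_of T) \<and>
     emeasure \<mu> (space \<mu>) \<noteq> 0 \<and>
     (\<forall>K. compactin T K \<longrightarrow> emeasure \<mu> K < \<infinity>) \<and>
     (\<forall>g\<in>carrier G. \<forall>A\<in>sets \<mu>. emeasure \<mu> (g <#\<^bsub>G\<^esub> A) = emeasure \<mu> A)"

text \<open>The normalisation is \<open>\<mu>(A g) = \<Delta>(g) \<mu>(A)\<close>, i.e. \<open>\<integral> f(x g) dx = \<Delta>(g)\<^sup>-\<^sup>1 \<integral> f(x) dx\<close>.  Of the two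
  conventions in use it is the one for which \<open>\<Delta>\<^sub>Q(q) / |q|\<close> is the modular function of an
  extension of \<open>V\<close> by \<open>Q\<close>, where \<open>|q|\<close> is \<open>modulus\<close> below.\<close>

definition modular_function ::
    "('a, 'm) monoid_scheme \<Rightarrow> 'a measure \<Rightarrow> 'a \<Rightarrow> real" where
  "modular_function G \<mu> g =
     (THE r. 0 < r \<and> (\<forall>A\<in>sets \<mu>. emeasure \<mu> (A #>\<^bsub>G\<^esub> g) = ennreal r * emeasure \<mu> A))"

definition modulus :: "'v measure \<Rightarrow> ('q \<Rightarrow> 'v \<Rightarrow> 'v) \<Rightarrow> 'q \<Rightarrow> real" where
  "modulus \<mu>V act q =
     (THE r. 0 < r \<and> (\<forall>f\<in>borel_measurable \<mu>V.
        (\<integral>\<^sup>+v. f (act q v) \<partial>\<mu>V) = ennreal (1 / r) * (\<integral>\<^sup>+v. f v \<partial>\<mu>V)))"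

section \<open>Continuous actions by automorphisms\<close>

definition top_automorphisms ::
    "('v, 'm) monoid_scheme \<Rightarrow> 'v topology \<Rightarrow> ('v \<Rightarrow> 'v) set" where
  "top_automorphisms V TV = {\<alpha> \<in> auto V. homeomorphic_map TV TV \<alpha>}"

definition top_AutoGroup ::
    "('v, 'm) monoid_scheme \<Rightarrow> 'v topology \<Rightarrow> ('v \<Rightarrow> 'v) monoid" where
  "top_AutoGroup V TV = AutoGroup V \<lparr>carrier := top_automorphisms V TV\<rparr>"

text \<open>The Braconnier topology: the coarsest one for which both \<open>\<alpha>\<close> and \<open>\<alpha>\<^sup>-\<^sup>1\<close> depend continuously
  on \<open>\<alpha>\<close> in the compact-open topology.\<close>

definition aut_topology ::
    "('v, 'm) monoid_scheme \<Rightarrow> 'v topology \<Rightarrow> ('v \<Rightarrow> 'v) topology" where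
  "aut_topology V TV = topology_generated_by
     ({{\<alpha> \<in> top_automorphisms V TV. \<alpha> ` K \<subseteq> U} | K U. compactin TV K \<and> openin TV U} \<union>
      {{\<alpha> \<in> top_automorphisms V TV. inv_into (carrier V) \<alpha> ` K \<subseteq> U} | K U.
         compactin TV K \<and> openin TV U})"

definition continuous_action ::
    "('q, 'm) monoid_scheme \<Rightarrow> 'q topology \<Rightarrow> ('v, 'n) monoid_scheme \<Rightarrow> 'v topology \<Rightarrow>
     ('q \<Rightarrow> 'v \<Rightarrow> 'v) \<Rightarrow> bool" where
  "continuous_action Q TQ V TV act \<longleftrightarrow>
     act \<in> hom Q (top_AutoGroup V TV) \<and> continuous_map TQ (aut_topology V TV) act"

section \<open>Pontryagin dual\<close>

text \<open>A character is a function, so the pairing \<open>e\<^bsup>i\<langle>\<xi>,v\<rangle>\<^esup>\<close> is the application \<open>\<xi> v\<close>.\<close>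

definition characters :: "('v, 'm) monoid_scheme \<Rightarrow> 'v topology \<Rightarrow> ('v \<Rightarrow> complex) set" where
  "characters V TV =
     {\<xi> \<in> extensional (carrier V). continuous_map TV euclidean \<xi> \<and>
        (\<forall>v\<in>carrier V. cmod (\<xi> v) = 1) \<and>
        (\<forall>v\<in>carrier V. \<forall>w\<in>carrier V. \<xi> (v \<otimes>\<^bsub>V\<^esub> w) = \<xi> v * \<xi> w)}"

definition dual_group :: "('v, 'm) monoid_scheme \<Rightarrow> 'v topology \<Rightarrow> ('v \<Rightarrow> complex) monoid" where
  "dual_group V TV =
     \<lparr>carrier = characters V TV,
      mult = \<lambda>\<xi> \<zeta>. \<lambda>v\<in>carrier V. \<xi> v * \<zeta> v,
      one = \<lambda>v\<in>carrier V. 1\<rparr>"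

text \<open>The compact-open topology.\<close>

definition dual_topology ::
    "('v, 'm) monoid_scheme \<Rightarrow> 'v topology \<Rightarrow> ('v \<Rightarrow> complex) topology" where
  "dual_topology V TV = topology_generated_by
     {{\<xi> \<in> characters V TV. \<xi> ` K \<subseteq> U} | K U. compactin TV K \<and> open U}"

definition dual_action ::
    "('q, 'm) monoid_scheme \<Rightarrow> ('v, 'n) monoid_scheme \<Rightarrow> ('q \<Rightarrow> 'v \<Rightarrow> 'v) \<Rightarrow>
     'q \<Rightarrow> ('v \<Rightarrow> complex) \<Rightarrow> ('v \<Rightarrow> complex)" where
  "dual_action Q V act q \<xi> = (\<lambda>v\<in>carrier V. \<xi> (act (inv\<^bsub>Q\<^esub> q) v))"

section \<open>Cocycles\<close>

definition circle_group :: "complex monoid" where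
  "circle_group = \<lparr>carrier = sphere 0 1, mult = (*), one = 1\<rparr>"

abbreviation circle_topology :: "complex topology" where
  "circle_topology \<equiv> top_of_set (sphere 0 1)"

text \<open>\<open>Q \<times> Q\<close> carries the product \<open>\<sigma>\<close>-algebra, which for second countable \<open>Q\<close> is the Borel
  \<open>\<sigma>\<close>-algebra of the product topology.\<close>

definition borel_2cochains :: "'q topology \<Rightarrow> 'a topology \<Rightarrow> ('q \<Rightarrow> 'q \<Rightarrow> 'a) set" where
  "borel_2cochains TQ TA =
     {c. (\<lambda>(q1, q2). c q1 q2) \<in> borel_of TQ \<Otimes>\<^sub>M borel_of TQ \<rightarrow>\<^sub>M borel_of TA}"

definition borel_2cocycles ::
    "('q, 'm) monoid_scheme \<Rightarrow> 'q topology \<Rightarrow> ('a, 'n) monoid_scheme \<Rightarrow> 'a topology \<Rightarrow>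
     ('q \<Rightarrow> 'a \<Rightarrow> 'a) \<Rightarrow> ('q \<Rightarrow> 'q \<Rightarrow> 'a) set" where
  "borel_2cocycles Q TQ A TA act =
     {c \<in> borel_2cochains TQ TA.
        \<forall>q1\<in>carrier Q. \<forall>q2\<in>carrier Q. \<forall>q3\<in>carrier Q.
          c q1 q2 \<otimes>\<^bsub>A\<^esub> c (q1 \<otimes>\<^bsub>Q\<^esub> q2) q3 = act q1 (c q2 q3) \<otimes>\<^bsub>A\<^esub> c q1 (q2 \<otimes>\<^bsub>Q\<^esub> q3)}"

text \<open>Coefficients in the circle, on which groups act trivially.\<close>

abbreviation circle_2cochains :: "'q topology \<Rightarrow> ('q \<Rightarrow> 'q \<Rightarrow> complex) set" where
  "circle_2cochains TQ \<equiv> borel_2cochains TQ circle_topology"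

abbreviation circle_2cocycles ::
    "('q, 'm) monoid_scheme \<Rightarrow> 'q topology \<Rightarrow> ('q \<Rightarrow> 'q \<Rightarrow> complex) set" where
  "circle_2cocycles Q TQ \<equiv> borel_2cocycles Q TQ circle_group circle_topology (\<lambda>_ z. z)"

definition coboundary2 ::
    "('q, 'm) monoid_scheme \<Rightarrow> ('q \<Rightarrow> 'q \<Rightarrow> complex) \<Rightarrow> 'q \<Rightarrow> 'q \<Rightarrow> 'q \<Rightarrow> complex" where
  "coboundary2 Q b q1 q2 q3 =
     (b q2 q3 * b q1 (q2 \<otimes>\<^bsub>Q\<^esub> q3)) / (b q1 q2 * b (q1 \<otimes>\<^bsub>Q\<^esub> q2) q3)"

definition cohomologous3 ::
    "('q, 'm) monoid_scheme \<Rightarrow> 'q topology \<Rightarrow>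
     ('q \<Rightarrow> 'q \<Rightarrow> 'q \<Rightarrow> complex) \<Rightarrow> ('q \<Rightarrow> 'q \<Rightarrow> 'q \<Rightarrow> complex) \<Rightarrow> bool" where
  "cohomologous3 Q TQ c c' \<longleftrightarrow>
     (\<exists>b\<in>circle_2cochains TQ. \<forall>q1\<in>carrier Q. \<forall>q2\<in>carrier Q. \<forall>q3\<in>carrier Q.
        c q1 q2 q3 = c' q1 q2 q3 * coboundary2 Q b q1 q2 q3)"

definition continuous_dual_1cocycles ::
    "('q, 'm) monoid_scheme \<Rightarrow> 'q topology \<Rightarrow> ('v, 'n) monoid_scheme \<Rightarrow> 'v topology \<Rightarrow>
     ('q \<Rightarrow> 'v \<Rightarrow> 'v) \<Rightarrow> ('q \<Rightarrow> 'v \<Rightarrow> complex) set" where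
  "continuous_dual_1cocycles Q TQ V TV act =
     {\<eta>. continuous_map TQ (dual_topology V TV) \<eta> \<and>
         (\<forall>q1\<in>carrier Q. \<forall>q2\<in>carrier Q.
            \<eta> (q1 \<otimes>\<^bsub>Q\<^esub> q2) = \<eta> q1 \<otimes>\<^bsub>dual_group V TV\<^esub> dual_action Q V act q1 (\<eta> q2))}"

definition essentially_bijective :: "'a measure \<Rightarrow> 'b measure \<Rightarrow> ('a \<Rightarrow> 'b) \<Rightarrow> bool" where
  "essentially_bijective M N \<eta> \<longleftrightarrow>
     (\<exists>A\<in>null_sets M. \<exists>B\<in>null_sets N.
        bij_betw \<eta> (space M - A) (space N - B) \<and>
        \<eta> \<in> restrict_space M (space M - A) \<rightarrow>\<^sub>M restrict_space N (space N - B) \<and>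
        inv_into (space M - A) \<eta> \<in> restrict_space N (space N - B) \<rightarrow>\<^sub>M restrict_space M (space M - A) \<and>
        (\<forall>E\<in>sets M. E \<subseteq> space M - A \<longrightarrow> (E \<in> null_sets M \<longleftrightarrow> \<eta> ` E \<in> null_sets N)))"

definition psi_cocycle ::
    "('q, 'm) monoid_scheme \<Rightarrow> ('q \<Rightarrow> 'v \<Rightarrow> complex) \<Rightarrow> ('q \<Rightarrow> 'q \<Rightarrow> 'v) \<Rightarrow>
     'q \<Rightarrow> 'q \<Rightarrow> 'q \<Rightarrow> complex" where
  "psi_cocycle Q \<eta> \<beta> q1 q2 q3 = \<eta> (inv\<^bsub>Q\<^esub> q1) (\<beta> q2 q3)"

definition compatible ::
    "('q, 'm) monoid_scheme \<Rightarrow> 'q topology \<Rightarrow> ('q \<Rightarrow> 'v \<Rightarrow> complex) \<Rightarrow> ('q \<Rightarrow> 'q \<Rightarrow> 'v) \<Rightarrow> bool"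
  where
  "compatible Q TQ \<eta> \<beta> \<longleftrightarrow> cohomologous3 Q TQ (psi_cocycle Q \<eta> \<beta>) (\<lambda>_ _ _. 1)"

definition omega_cocycle ::
    "('q, 'm) monoid_scheme \<Rightarrow> ('q \<Rightarrow> 'v \<Rightarrow> complex) \<Rightarrow> ('q \<Rightarrow> 'q \<Rightarrow> complex) \<Rightarrow>
     'q \<times> 'v \<Rightarrow> 'q \<times> 'v \<Rightarrow> complex" where
  "omega_cocycle Q \<eta> b = (\<lambda>(q1, v1) (q2, v2). cnj (\<eta> (inv\<^bsub>Q\<^esub> q1) v2) * b q1 q2)"

section \<open>The extension\<close>

text \<open>\<open>\<beta>\<close> is not assumed to be normalised, hence the shape of the identity element.\<close>

definition extension_group ::
    "('q, 'm) monoid_scheme \<Rightarrow> ('v, 'n) monoid_scheme \<Rightarrow> ('q \<Rightarrow> 'v \<Rightarrow> 'v) \<Rightarrow> ('q \<Rightarrow> 'q \<Rightarrow> 'v) \<Rightarrow>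
     ('q \<times> 'v) monoid" where
  "extension_group Q V act \<beta> =
     \<lparr>carrier = carrier Q \<times> carrier V,
      mult = \<lambda>(q1, v1) (q2, v2). (q1 \<otimes>\<^bsub>Q\<^esub> q2, v1 \<otimes>\<^bsub>V\<^esub> act q1 v2 \<otimes>\<^bsub>V\<^esub> \<beta> q1 q2),
      one = (\<one>\<^bsub>Q\<^esub>, inv\<^bsub>V\<^esub> (\<beta> \<one>\<^bsub>Q\<^esub> \<one>\<^bsub>Q\<^esub>))\<rparr>"

text \<open>The left Haar measure \<open>|q|\<^sup>-\<^sup>1 dq dv\<close>.\<close>

definition extension_haar ::
    "'q measure \<Rightarrow> 'v measure \<Rightarrow> ('q \<Rightarrow> 'v \<Rightarrow> 'v) \<Rightarrow> ('q \<times> 'v) measure" where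
  "extension_haar \<mu>Q \<mu>V act =
     density (\<mu>Q \<Otimes>\<^sub>M \<mu>V) (\<lambda>(q, v). ennreal (1 / modulus \<mu>V act q))"

section \<open>Operators on \<open>L\<^sup>2\<close>\<close>

text \<open>Vectors of the Hilbert space \<open>L\<^sup>2(M)\<close> are represented by square-integrable functions;
  two functions represent the same vector iff they agree almost everywhere.\<close>

definition L2 :: "'a measure \<Rightarrow> ('a \<Rightarrow> complex) set" where
  "L2 M = {f \<in> borel_measurable M. integrable M (\<lambda>x. (cmod (f x))\<^sup>2)}"

definition L2_eq :: "'a measure \<Rightarrow> ('a \<Rightarrow> complex) \<Rightarrow> ('a \<Rightarrow> complex) \<Rightarrow> bool" where
  "L2_eq M f g \<longleftrightarrow> (AE x in M. f x = g x)"

definition L2_inner :: "'a measure \<Rightarrow> ('a \<Rightarrow> complex) \<Rightarrow> ('a \<Rightarrow> complex) \<Rightarrow> complex" where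
  "L2_inner M f g = (\<integral>x. f x * cnj (g x) \<partial>M)"

definition L2_norm :: "'a measure \<Rightarrow> ('a \<Rightarrow> complex) \<Rightarrow> real" where
  "L2_norm M f = sqrt (\<integral>x. (cmod (f x))\<^sup>2 \<partial>M)"

definition L2_unitary ::
    "'a measure \<Rightarrow> 'b measure \<Rightarrow> (('a \<Rightarrow> complex) \<Rightarrow> ('b \<Rightarrow> complex)) \<Rightarrow> bool" where
  "L2_unitary M N U \<longleftrightarrow>
     (\<forall>f\<in>L2 M. U f \<in> L2 N) \<and>
     (\<forall>f\<in>L2 M. \<forall>g\<in>L2 M. L2_eq M f g \<longrightarrow> L2_eq N (U f) (U g)) \<and>
     (\<forall>f\<in>L2 M. \<forall>g\<in>L2 M. \<forall>a b. L2_eq N (U (\<lambda>x. a * f x + b * g x)) (\<lambda>y. a * U f y + b * U g y)) \<and>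
     (\<forall>f\<in>L2 M. \<forall>g\<in>L2 M. L2_inner N (U f) (U g) = L2_inner M f g) \<and>
     (\<forall>h\<in>L2 N. \<exists>f\<in>L2 M. L2_eq N (U f) h)"

text \<open>A closed subspace; closedness also makes it stable under changes on null sets.\<close>

definition L2_closed_subspace :: "'a measure \<Rightarrow> ('a \<Rightarrow> complex) set \<Rightarrow> bool" where
  "L2_closed_subspace M W \<longleftrightarrow>
     W \<subseteq> L2 M \<and> (\<lambda>_. 0) \<in> W \<and>
     (\<forall>f\<in>W. \<forall>g\<in>W. \<forall>a b. (\<lambda>x. a * f x + b * g x) \<in> W) \<and>
     (\<forall>f\<in>L2 M. (\<forall>\<epsilon>>0. \<exists>g\<in>W. L2_norm M (\<lambda>x. f x - g x) < \<epsilon>) \<longrightarrow> f \<in> W)"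

text \<open>Unbounded operators are given by their graphs.\<close>

definition L2_operator :: "'a measure \<Rightarrow> ('a \<Rightarrow> complex) rel \<Rightarrow> bool" where
  "L2_operator M D \<longleftrightarrow>
     D \<subseteq> L2 M \<times> L2 M \<and>
     (\<forall>(f, g)\<in>D. \<forall>f'\<in>L2 M. \<forall>g'\<in>L2 M. L2_eq M f f' \<longrightarrow> L2_eq M g g' \<longrightarrow> (f', g') \<in> D) \<and>
     (\<forall>f g g'. (f, g) \<in> D \<longrightarrow> (f, g') \<in> D \<longrightarrow> L2_eq M g g') \<and>
     (\<forall>(f, g)\<in>D. \<forall>(f', g')\<in>D. \<forall>a b.
        (\<lambda>x. a * f x + b * f' x, \<lambda>x. a * g x + b * g' x) \<in> D)"

definition L2_densely_defined :: "'a measure \<Rightarrow> ('a \<Rightarrow> complex) rel \<Rightarrow> bool" where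
  "L2_densely_defined M D \<longleftrightarrow>
     (\<forall>f\<in>L2 M. \<forall>\<epsilon>>0. \<exists>g\<in>Domain D. L2_norm M (\<lambda>x. f x - g x) < \<epsilon>)"

definition L2_adjoint :: "'a measure \<Rightarrow> ('a \<Rightarrow> complex) rel \<Rightarrow> ('a \<Rightarrow> complex) rel" where
  "L2_adjoint M D =
     {(g, h) \<in> L2 M \<times> L2 M. \<forall>(f, k)\<in>D. L2_inner M k g = L2_inner M f h}"

definition L2_positive_operator :: "'a measure \<Rightarrow> ('a \<Rightarrow> complex) rel \<Rightarrow> bool" where
  "L2_positive_operator M D \<longleftrightarrow>
     L2_operator M D \<and> L2_densely_defined M D \<and> L2_adjoint M D = D \<and>
     (\<forall>(f, g)\<in>D. Im (L2_inner M g f) = 0 \<and> 0 \<le> Re (L2_inner M g f))"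

definition L2_nonsingular :: "'a measure \<Rightarrow> ('a \<Rightarrow> complex) rel \<Rightarrow> bool" where
  "L2_nonsingular M D \<longleftrightarrow> (\<forall>(f, g)\<in>D. L2_eq M g (\<lambda>_. 0) \<longrightarrow> L2_eq M f (\<lambda>_. 0))"

text \<open>\<open>S = D\<^sup>1\<^sup>/\<^sup>2\<close>; here \<open>S O S\<close> is the graph of \<open>S\<^sup>2\<close> on its natural domain.\<close>

definition L2_positive_sqrt :: "'a measure \<Rightarrow> ('a \<Rightarrow> complex) rel \<Rightarrow> ('a \<Rightarrow> complex) rel \<Rightarrow> bool" where
  "L2_positive_sqrt M D S \<longleftrightarrow> L2_positive_operator M S \<and> S O S = D"

definition L2_mult_operator :: "'a measure \<Rightarrow> ('a \<Rightarrow> complex) \<Rightarrow> ('a \<Rightarrow> complex) rel" where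
  "L2_mult_operator M m = {(f, g) \<in> L2 M \<times> L2 M. L2_eq M g (\<lambda>x. m x * f x)}"

definition fourier :: "'v measure \<Rightarrow> ('v \<Rightarrow> complex) \<Rightarrow> ('v \<Rightarrow> complex) \<Rightarrow> complex" where
  "fourier \<mu>V f \<xi> = (\<integral>v. cnj (\<xi> v) * f v \<partial>\<mu>V)"

text \<open>The integral defines the transform on \<open>L\<^sup>1 \<inter> L\<^sup>2\<close>, from where it is extended to \<open>L\<^sup>2\<close>.\<close>

definition fourier_unitary :: "'v measure \<Rightarrow> ('v \<Rightarrow> complex) measure \<Rightarrow> bool" where
  "fourier_unitary \<mu>V \<mu>V' \<longleftrightarrow>
     (\<exists>F. L2_unitary \<mu>V \<mu>V' F \<and>
        (\<forall>f\<in>L2 \<mu>V. integrable \<mu>V f \<longrightarrow> L2_eq \<mu>V' (F f) (fourier \<mu>V f)))"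

section \<open>Projective representations on \<open>L\<^sup>2(M)\<close>\<close>

text \<open>As usual for second countable groups, the map \<open>G \<rightarrow> U(L\<^sup>2(M))\<close> is required to be Borel
  for the weak operator topology.\<close>

definition projective_unitary_rep ::
    "('g, 'm) monoid_scheme \<Rightarrow> 'g topology \<Rightarrow> ('g \<Rightarrow> 'g \<Rightarrow> complex) \<Rightarrow> 'a measure \<Rightarrow>
     ('g \<Rightarrow> ('a \<Rightarrow> complex) \<Rightarrow> ('a \<Rightarrow> complex)) \<Rightarrow> bool" where
  "projective_unitary_rep G TG \<omega> M \<pi> \<longleftrightarrow>
     \<omega> \<in> circle_2cocycles G TG \<and>
     (\<forall>g\<in>carrier G. L2_unitary M M (\<pi> g)) \<and>
     (\<forall>\<phi>1\<in>L2 M. \<forall>\<phi>2\<in>L2 M. (\<lambda>g. L2_inner M \<phi>1 (\<pi> g \<phi>2)) \<in> borel_measurable (borel_of TG)) \<and>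
     (\<forall>g1\<in>carrier G. \<forall>g2\<in>carrier G. \<forall>\<phi>\<in>L2 M.
        L2_eq M (\<pi> g1 (\<pi> g2 \<phi>)) (\<lambda>x. \<omega> g1 g2 * \<pi> (g1 \<otimes>\<^bsub>G\<^esub> g2) \<phi> x))"

definition irreducible_rep ::
    "('g, 'm) monoid_scheme \<Rightarrow> 'a measure \<Rightarrow> ('g \<Rightarrow> ('a \<Rightarrow> complex) \<Rightarrow> ('a \<Rightarrow> complex)) \<Rightarrow> bool" where
  "irreducible_rep G M \<pi> \<longleftrightarrow>
     (\<exists>\<phi>\<in>L2 M. \<not> L2_eq M \<phi> (\<lambda>_. 0)) \<and>
     (\<forall>W. L2_closed_subspace M W \<and> (\<forall>g\<in>carrier G. \<forall>\<phi>\<in>W. \<pi> g \<phi> \<in> W) \<longrightarrow>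
        W = {\<phi> \<in> L2 M. L2_eq M \<phi> (\<lambda>_. 0)} \<or> W = L2 M)"

definition square_integrable_rep ::
    "'g measure \<Rightarrow> 'a measure \<Rightarrow> ('g \<Rightarrow> ('a \<Rightarrow> complex) \<Rightarrow> ('a \<Rightarrow> complex)) \<Rightarrow> bool" where
  "square_integrable_rep \<mu>G M \<pi> \<longleftrightarrow>
     (\<exists>\<phi>1\<in>L2 M. \<exists>\<phi>2\<in>L2 M. \<not> L2_eq M \<phi>1 (\<lambda>_. 0) \<and> \<not> L2_eq M \<phi>2 (\<lambda>_. 0) \<and>
        (\<integral>\<^sup>+g. ennreal ((cmod (L2_inner M \<phi>1 (\<pi> g \<phi>2)))\<^sup>2) \<partial>\<mu>G) < \<infinity>)"

text \<open>In the defining identity \<open>\<parallel>D\<^sup>1\<^sup>/\<^sup>2 \<phi>\<^sub>2\<parallel> = \<infinity>\<close> for \<open>\<phi>\<^sub>2\<close> outside the domain of \<open>D\<^sup>1\<^sup>/\<^sup>2\<close>.\<close>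

definition duflo_moore_operator ::
    "'g measure \<Rightarrow> 'a measure \<Rightarrow> ('g \<Rightarrow> ('a \<Rightarrow> complex) \<Rightarrow> ('a \<Rightarrow> complex)) \<Rightarrow>
     ('a \<Rightarrow> complex) rel \<Rightarrow> bool" where
  "duflo_moore_operator \<mu>G M \<pi> D \<longleftrightarrow>
     L2_positive_operator M D \<and> L2_nonsingular M D \<and>
     (\<exists>S. L2_positive_sqrt M D S \<and>
        (\<forall>\<phi>1\<in>L2 M. \<forall>(\<phi>2, \<psi>)\<in>S.
           (\<integral>\<^sup>+g. ennreal ((cmod (L2_inner M \<phi>1 (\<pi> g \<phi>2)))\<^sup>2) \<partial>\<mu>G) =
             ennreal ((L2_norm M \<phi>1)\<^sup>2 * (L2_norm M \<psi>)\<^sup>2)) \<and>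
        (\<forall>\<phi>1\<in>L2 M. \<forall>\<phi>2\<in>L2 M - Domain S. \<not> L2_eq M \<phi>1 (\<lambda>_. 0) \<longrightarrow>
           (\<integral>\<^sup>+g. ennreal ((cmod (L2_inner M \<phi>1 (\<pi> g \<phi>2)))\<^sup>2) \<partial>\<mu>G) = \<infinity>))"

text \<open>The Duflo--Moore operator is unique, since the identity determines \<open>\<parallel>D\<^sup>1\<^sup>/\<^sup>2 \<phi>\<parallel>\<close> for all \<open>\<phi>\<close>.\<close>

lemma L2_integrable_prod:
  assumes "f \<in> L2 M" "g \<in> L2 M"
  shows "integrable M (\<lambda>x. f x * cnj (g x))"
proof (rule Bochner_Integration.integrable_bound)
  show "integrable M (\<lambda>x. (cmod (f x))\<^sup>2 + (cmod (g x))\<^sup>2)"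
    using assms by (auto simp: L2_def)
  have [measurable]: "f \<in> borel_measurable M" "g \<in> borel_measurable M"
    using assms by (auto simp: L2_def)
  have [measurable]: "cnj \<in> borel_measurable borel"
    by (intro borel_measurable_continuous_onI continuous_intros)
  show "(\<lambda>x. f x * cnj (g x)) \<in> borel_measurable M" by measurable
  have "cmod (f x) * cmod (g x) \<le> (cmod (f x))\<^sup>2 + (cmod (g x))\<^sup>2" for x
    using sum_squares_bound[of "cmod (f x)" "cmod (g x)"]
      mult_nonneg_nonneg[of "cmod (f x)" "cmod (g x)"]
    unfolding mult.assoc by (smt (verit) norm_ge_zero)
  then show "AE x in M. norm (f x * cnj (g x)) \<le> norm ((cmod (f x))\<^sup>2 + (cmod (g x))\<^sup>2)"
    by (auto simp: norm_mult)
qed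

lemma L2_norm_square: "(L2_norm M f)\<^sup>2 = (\<integral>x. (cmod (f x))\<^sup>2 \<partial>M)"
  by (simp add: L2_norm_def)

lemma L2_norm_combination:
  assumes "f \<in> L2 M" "g \<in> L2 M"
  shows "(L2_norm M (\<lambda>x. 1 * f x + c * g x))\<^sup>2 =
    (L2_norm M f)\<^sup>2 + (cmod c)\<^sup>2 * (L2_norm M g)\<^sup>2 + 2 * Re (cnj c * L2_inner M f g)"
proof -
  have eq: "(cmod (1 * f x + c * g x))\<^sup>2 =
    (cmod (f x))\<^sup>2 + (cmod c)\<^sup>2 * (cmod (g x))\<^sup>2 + 2 * Re (cnj c * (f x * cnj (g x)))" for x
    unfolding cmod_power2 by (simp add: power2_eq_square algebra_simps)
  have int: "integrable M (\<lambda>x. cnj c * (f x * cnj (g x)))"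
    using L2_integrable_prod[OF assms] by simp
  have 1: "integrable M (\<lambda>x. (cmod (f x))\<^sup>2)" and 2: "integrable M (\<lambda>x. (cmod c)\<^sup>2 * (cmod (g x))\<^sup>2)"
    using assms by (auto simp: L2_def)
  have 3: "integrable M (\<lambda>x. 2 * Re (cnj c * (f x * cnj (g x))))"
    using integrable_Re[OF int] by (intro integrable_mult_right)
  have "(\<integral>x. 2 * Re (cnj c * (f x * cnj (g x))) \<partial>M) = 2 * Re (cnj c * L2_inner M f g)"
    unfolding L2_inner_def integral_mult_right_zero[symmetric] integral_Re[OF int, symmetric] ..
  then show ?thesis
    unfolding L2_norm_square eq
      Bochner_Integration.integral_add[OF Bochner_Integration.integrable_add[OF 1 2] 3]
      Bochner_Integration.integral_add[OF 1 2] integral_mult_right_zero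
    by (rule arg_cong)
qed

lemma duflo_moore_operator_unique:
  assumes nz: "\<exists>\<phi>\<in>L2 M. \<not> L2_eq M \<phi> (\<lambda>_. 0)"
    and D: "duflo_moore_operator \<mu>G M \<pi> D" and D': "duflo_moore_operator \<mu>G M \<pi> D'"
  shows "D = D'"
proof -
  define I where "I \<phi>1 \<phi>2 = (\<integral>\<^sup>+g. ennreal ((cmod (L2_inner M \<phi>1 (\<pi> g \<phi>2)))\<^sup>2) \<partial>\<mu>G)" for \<phi>1 \<phi>2
  define R where "R S \<longleftrightarrow> L2_positive_operator M S \<and>
    (\<forall>\<phi>1\<in>L2 M. \<forall>(\<phi>2, \<psi>)\<in>S. I \<phi>1 \<phi>2 = ennreal ((L2_norm M \<phi>1)\<^sup>2 * (L2_norm M \<psi>)\<^sup>2)) \<and>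
    (\<forall>\<phi>1\<in>L2 M. \<forall>\<phi>2\<in>L2 M - Domain S. \<not> L2_eq M \<phi>1 (\<lambda>_. 0) \<longrightarrow> I \<phi>1 \<phi>2 = \<infinity>)" for S
  obtain S S' where S: "R S" "D = S O S" and S': "R S'" "D' = S' O S'"
    using D D' unfolding duflo_moore_operator_def L2_positive_sqrt_def R_def I_def by blast
  obtain \<phi> where \<phi>: "\<phi> \<in> L2 M" "\<not> L2_eq M \<phi> (\<lambda>_. 0)" using nz by blast
  have n: "0 < (L2_norm M \<phi>)\<^sup>2"
  proof -
    have "(\<integral>x. (cmod (\<phi> x))\<^sup>2 \<partial>M) \<noteq> 0"
      using \<phi> integral_nonneg_eq_0_iff_AE[of M "\<lambda>x. (cmod (\<phi> x))\<^sup>2"]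
      by (auto simp: L2_def L2_eq_def)
    moreover have "0 \<le> (\<integral>x. (cmod (\<phi> x))\<^sup>2 \<partial>M)" by (intro integral_nonneg_AE) simp
    ultimately show ?thesis unfolding L2_norm_square by linarith
  qed
  have sub: "S1 \<subseteq> L2 M \<times> L2 M" if "R S1" for S1
    using that by (auto simp: R_def L2_positive_operator_def L2_operator_def)
  have comb: "(\<lambda>x. a * f x + c * f' x, \<lambda>x. a * g x + c * g' x) \<in> S1"
    if "R S1" "(f, g) \<in> S1" "(f', g') \<in> S1" for S1 a c f f' g g'
  proof -
    have "\<forall>(f, g)\<in>S1. \<forall>(f', g')\<in>S1. \<forall>a b.
        (\<lambda>x. a * f x + b * f' x, \<lambda>x. a * g x + b * g' x) \<in> S1"
      using that(1) unfolding R_def L2_positive_operator_def L2_operator_def by (elim conjE) assumption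
    then show ?thesis using that(2,3) by blast
  qed
  have adj: "(g, h) \<in> S1 \<longleftrightarrow>
      g \<in> L2 M \<and> h \<in> L2 M \<and> (\<forall>(f, k)\<in>S1. L2_inner M k g = L2_inner M f h)"
    if "R S1" for S1 g h
  proof -
    have "L2_adjoint M S1 = S1" using that by (simp add: R_def L2_positive_operator_def)
    then have "(g, h) \<in> S1 \<longleftrightarrow> (g, h) \<in> L2_adjoint M S1" by simp
    then show ?thesis by (simp add: L2_adjoint_def)
  qed
  have dom: "Domain S1 \<subseteq> Domain S2" if "R S1" "R S2" for S1 S2
  proof
    fix f assume "f \<in> Domain S1"
    then obtain k where k: "(f, k) \<in> S1" by blast
    then have "I \<phi> f = ennreal ((L2_norm M \<phi>)\<^sup>2 * (L2_norm M k)\<^sup>2)"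
      using \<open>R S1\<close> \<phi>(1) unfolding R_def by blast
    moreover have "f \<in> L2 M" using k sub[OF \<open>R S1\<close>] by blast
    ultimately show "f \<in> Domain S2"
      using \<open>R S2\<close> \<phi> unfolding R_def by (metis DiffI ennreal_neq_top infinity_ennreal_def)
  qed
  have nrm: "(L2_norm M k)\<^sup>2 = (L2_norm M k')\<^sup>2"
    if "R S1" "R S2" "(f, k) \<in> S1" "(f, k') \<in> S2" for S1 S2 f k k'
  proof -
    have "I \<phi> f = ennreal ((L2_norm M \<phi>)\<^sup>2 * (L2_norm M k)\<^sup>2)"
      "I \<phi> f = ennreal ((L2_norm M \<phi>)\<^sup>2 * (L2_norm M k')\<^sup>2)"
      using that \<phi>(1) unfolding R_def by blast+
    then have "(L2_norm M \<phi>)\<^sup>2 * (L2_norm M k)\<^sup>2 = (L2_norm M \<phi>)\<^sup>2 * (L2_norm M k')\<^sup>2"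
      by (metis ennreal_inj mult_nonneg_nonneg zero_le_power2)
    then show ?thesis using n by simp
  qed
  have inn: "L2_inner M l k = L2_inner M l' k'"
    if R: "R S1" "R S2" and "(f, k) \<in> S1" "(f, k') \<in> S2" "(g, l) \<in> S1" "(g, l') \<in> S2"
    for S1 S2 f g k k' l l'
  proof -
    have L: "l \<in> L2 M" "k \<in> L2 M" "l' \<in> L2 M" "k' \<in> L2 M"
      using that sub by blast+
    have Re_eq: "Re (cnj c * L2_inner M l k) = Re (cnj c * L2_inner M l' k')" for c
    proof -
      have "(L2_norm M (\<lambda>x. 1 * l x + c * k x))\<^sup>2 = (L2_norm M (\<lambda>x. 1 * l' x + c * k' x))\<^sup>2"
        by (rule nrm[OF R comb[OF R(1)] comb[OF R(2)]]) (use that in auto)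
      then show ?thesis
        unfolding L2_norm_combination[OF L(1,2)] L2_norm_combination[OF L(3,4)]
        using nrm[OF R that(3,4)] nrm[OF R that(5,6)] by simp
    qed
    show ?thesis
      using Re_eq[of 1] Re_eq[of \<i>] by (simp add: complex_eq_iff)
  qed
  have le: "S1 O S1 \<subseteq> S2 O S2" if R: "R S1" "R S2" for S1 S2
  proof clarify
    fix f k h assume k: "(f, k) \<in> S1" and h: "(k, h) \<in> S1"
    obtain k' where k': "(f, k') \<in> S2" using k dom[OF R] by blast
    have "L2_inner M l' k' = L2_inner M g h" if gl: "(g, l') \<in> S2" for g l'
    proof -
      obtain l where l: "(g, l) \<in> S1" using gl dom[OF R(2,1)] by blast
      have "L2_inner M l' k' = L2_inner M l k" using inn[OF R k k' l gl] by simp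
      also have "\<dots> = L2_inner M g h" using h l adj[OF R(1)] by blast
      finally show ?thesis .
    qed
    then have "(k', h) \<in> S2"
      using adj[OF R(2), of k' h] k' h sub[OF R(1)] sub[OF R(2)] by blast
    then show "(f, h) \<in> S2 O S2" using k' by blast
  qed
  show ?thesis
    unfolding S(2) S'(2) using le S(1) S'(1) by blast
qed

definition L2_representation ::
    "('q, 'm) monoid_scheme \<Rightarrow> ('q \<Rightarrow> 'v \<Rightarrow> complex) \<Rightarrow> ('q \<Rightarrow> 'q \<Rightarrow> complex) \<Rightarrow>
     'q \<times> 'v \<Rightarrow> ('q \<Rightarrow> complex) \<Rightarrow> ('q \<Rightarrow> complex)" where
  "L2_representation Q \<eta> b = (\<lambda>(q, v) \<phi> q0.
     cnj (\<eta> q0 v) * b (inv\<^bsub>Q\<^esub> q0) q * \<phi> (inv\<^bsub>Q\<^esub> q \<otimes>\<^bsub>Q\<^esub> q0))"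

end

theory Submission
  imports Defs
begin

text \<open>Substituting \<open>\<xi> = \<eta>(x)\<close> shows that, for fixed \<open>q\<close>, the matrix coefficient
  \<open>v \<mapsto> \<langle>\<phi>\<^sub>1, \<pi>(q, v) \<phi>\<^sub>2\<rangle>\<close> is the inverse Fourier transform of the integrable function
  \<open>\<eta>(x) \<mapsto> |x| \<phi>\<^sub>1(x) \<phi>\<^sub>2(q\<^sup>-\<^sup>1 x)\<close>, up to conjugates and phases.  Plancherel's formula in \<open>v\<close>, the
  substitution \<open>q \<mapsto> x q\<close> and the inversion formula \<open>\<integral> f(q\<^sup>-\<^sup>1) dq = \<integral> f(q) \<Delta>\<^sub>Q(q)\<^sup>-\<^sup>1 dq\<close> then give
  \<open>\<integral> |\<langle>\<phi>\<^sub>1, \<pi>(g) \<phi>\<^sub>2\<rangle>|\<^sup>2 dg = \<parallel>\<phi>\<^sub>1\<parallel>\<^sup>2 \<integral> |\<phi>\<^sub>2(q)|\<^sup>2 |q| \<Delta>\<^sub>Q(q)\<^sup>-\<^sup>1 dq\<close>, both sides possibly infinite.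
  This determines the Duflo--Moore operator.  It also implies irreducibility: a vector orthogonal to
  a nonzero invariant subspace has vanishing matrix coefficients against that subspace, so it is zero.\<close>

section \<open>Borel structures of topological spaces\<close>

text \<open>The obstacle is that the Fourier data are weak and the function to be transformed is
  rough. What is given is a unitary map on L2, equal to the integral on functions in L1 and L2,
  while the transformed function is essentially a product of two L2 functions, hence merely
  integrable. Plancherel must therefore hold on all of L1, including the fact that a
  square-integrable inverse transform forces the function to be square-integrable; without it the
  value infinity outside the domain of D^(1/2) would be out of reach. This rests on injectivity of
  the inverse transform on L1, derived from unitarity and multiplicativity of characters, without
  approximate identities. The given transform is pulled back along \<open>\<eta>\<close>, so that
  this analysis runs on a weighted copy of \<open>Q\<close>; essential bijectivity keeps the
  pulled-back transform onto. The modular function and the modulus are definite descriptions, so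
  their very existence requires uniqueness of Haar measure, which comes out of an inversion formula.
  Vectors are functions up to null sets, so the projection argument behind irreducibility goes
  through almost everywhere limits.\<close>

lemma space_borel_of [simp]: "space (borel_of T) = topspace T"
  by (simp add: borel_of_def space_measure_of_conv)

lemma sets_borel_of: "sets (borel_of T) = sigma_sets (topspace T) {U. openin T U}"
  unfolding borel_of_def by (rule sets_measure_of) (auto dest: openin_subset)

lemma openin_borel_of: "openin T U \<Longrightarrow> U \<in> sets (borel_of T)"
  by (auto simp: sets_borel_of)

lemma closedin_borel_of:
  assumes "closedin T C"
  shows "C \<in> sets (borel_of T)"
proof -
  have "topspace T - (topspace T - C) \<in> sets (borel_of T)"
    using assms by (intro sets.Diff openin_borel_of openin_topspace) (auto simp: closedin_def)
  moreover have "topspace T - (topspace T - C) = C"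
    using closedin_subset[OF assms] by auto
  ultimately show ?thesis by simp
qed

lemma borel_of_euclidean: "borel_of (euclidean :: 'a :: topological_space topology) = borel"
  by (simp add: borel_of_def borel_def)

lemma measurable_borel_of:
  assumes "f \<in> space M \<rightarrow> topspace T" "\<And>U. openin T U \<Longrightarrow> f -` U \<inter> space M \<in> sets M"
  shows "f \<in> M \<rightarrow>\<^sub>M borel_of T"
  unfolding borel_of_def using assms by (intro measurable_measure_of) (auto dest: openin_subset)

lemma continuous_map_borel_of:
  assumes "continuous_map S T f" "sets M = sets (borel_of S)"
  shows "f \<in> M \<rightarrow>\<^sub>M borel_of T"
proof (rule measurable_borel_of)
  have sp: "space M = topspace S" using sets_eq_imp_space_eq[OF assms(2)] by simp
  show "f \<in> space M \<rightarrow> topspace T"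
    using continuous_map_funspace[OF assms(1)] sp by simp
  fix U assume "openin T U"
  then have "openin S {x \<in> topspace S. f x \<in> U}"
    using assms(1) by (simp add: continuous_map_def)
  moreover have "{x \<in> topspace S. f x \<in> U} = f -` U \<inter> space M" using sp by auto
  ultimately show "f -` U \<inter> space M \<in> sets M"
    using openin_borel_of assms(2) by metis
qed

lemma measurable_circle_topology:
  "f \<in> M \<rightarrow>\<^sub>M borel_of circle_topology \<longleftrightarrow> f \<in> borel_measurable M \<and> (\<forall>x\<in>space M. cmod (f x) = 1)"
proof (intro iffI conjI)
  assume f: "f \<in> M \<rightarrow>\<^sub>M borel_of circle_topology"
  then show "\<forall>x\<in>space M. cmod (f x) = 1"
    using measurable_space[OF f] by auto
  have "(\<lambda>x. x) \<in> borel_of circle_topology \<rightarrow>\<^sub>M borel_of (euclidean :: complex topology)"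
    by (intro continuous_map_borel_of[where S = circle_topology]) auto
  from measurable_compose[OF f this] show "f \<in> borel_measurable M"
    by (simp add: borel_of_euclidean)
next
  assume f: "f \<in> borel_measurable M \<and> (\<forall>x\<in>space M. cmod (f x) = 1)"
  show "f \<in> M \<rightarrow>\<^sub>M borel_of circle_topology"
  proof (rule measurable_borel_of)
    show "f \<in> space M \<rightarrow> topspace circle_topology" using f by auto
    fix U assume "openin circle_topology U"
    then obtain W where W: "open W" "U = W \<inter> sphere 0 1"
      by (auto simp: openin_subtopology)
    then have "f -` U \<inter> space M = f -` W \<inter> space M" using f by auto
    then show "f -` U \<inter> space M \<in> sets M"
      using f W(1) by (metis borel_open measurable_sets)
  qed
qed

text \<open>An open set is the union of the basic rectangles inside it, and second countability
  leaves only countably many of them. This makes continuous functions of two variables measurable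
  for product measures.\<close>

lemma openin_prod_topology_sets:
  assumes S: "second_countable S" and T: "second_countable T" and W: "openin (prod_topology S T) W"
  shows "W \<in> sets (borel_of S \<Otimes>\<^sub>M borel_of T)"
proof -
  obtain B where "countable B \<and> (\<forall>V\<in>B. openin S V) \<and>
      (\<forall>U x. openin S U \<and> x \<in> U \<longrightarrow> (\<exists>V\<in>B. x \<in> V \<and> V \<subseteq> U))"
    using S unfolding second_countable_def by (elim exE)
  then have B: "countable B" "\<And>V. V \<in> B \<Longrightarrow> openin S V"
    "\<And>U x. openin S U \<Longrightarrow> x \<in> U \<Longrightarrow> \<exists>V\<in>B. x \<in> V \<and> V \<subseteq> U"
    by simp_all
  obtain C where "countable C \<and> (\<forall>V\<in>C. openin T V) \<and>
      (\<forall>U x. openin T U \<and> x \<in> U \<longrightarrow> (\<exists>V\<in>C. x \<in> V \<and> V \<subseteq> U))"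
    using T unfolding second_countable_def by (elim exE)
  then have C: "countable C" "\<And>V. V \<in> C \<Longrightarrow> openin T V"
    "\<And>U x. openin T U \<Longrightarrow> x \<in> U \<Longrightarrow> \<exists>V\<in>C. x \<in> V \<and> V \<subseteq> U"
    by simp_all
  define I where "I = {(U, V) \<in> B \<times> C. U \<times> V \<subseteq> W}"
  have "W = (\<Union>(U, V)\<in>I. U \<times> V)"
  proof (intro equalityI subsetI)
    fix p assume p: "p \<in> W"
    obtain x y where xy: "p = (x, y)" by (cases p)
    have "\<exists>U V. openin S U \<and> openin T V \<and> x \<in> U \<and> y \<in> V \<and> U \<times> V \<subseteq> W"
      using W p unfolding openin_prod_topology_alt xy by simp
    then obtain U V where UV: "openin S U" "openin T V" "x \<in> U" "y \<in> V" "U \<times> V \<subseteq> W"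
      by (elim exE conjE)
    obtain U' V' where "U' \<in> B" "x \<in> U'" "U' \<subseteq> U" "V' \<in> C" "y \<in> V'" "V' \<subseteq> V"
      using B(3)[OF UV(1,3)] C(3)[OF UV(2,4)] by blast
    then show "p \<in> (\<Union>(U, V)\<in>I. U \<times> V)"
      using UV(5) unfolding I_def xy by (intro UN_I[of "(U', V')"]) auto
  qed (auto simp: I_def)
  moreover have "countable I"
    unfolding I_def by (rule countable_subset[of _ "B \<times> C"]) (auto simp: B(1) C(1))
  moreover have "(\<Union>(U, V)\<in>I. U \<times> V) \<in> sets (borel_of S \<Otimes>\<^sub>M borel_of T)" if "countable I"
    using B(2) C(2) that
    by (intro sets.countable_UN') (auto simp: I_def intro!: pair_measureI[OF openin_borel_of openin_borel_of])
  ultimately show ?thesis by simp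
qed

lemma continuous_map_prod_measurable:
  assumes S: "second_countable S" and T: "second_countable T"
    and f: "continuous_map (prod_topology S T) R f"
    and M: "sets M = sets (borel_of S)" and N: "sets N = sets (borel_of T)"
  shows "f \<in> M \<Otimes>\<^sub>M N \<rightarrow>\<^sub>M borel_of R"
proof (rule measurable_borel_of)
  have sp: "space (M \<Otimes>\<^sub>M N) = topspace (prod_topology S T)"
    using sets_eq_imp_space_eq[OF M] sets_eq_imp_space_eq[OF N] by (simp add: space_pair_measure)
  show "f \<in> space (M \<Otimes>\<^sub>M N) \<rightarrow> topspace R"
    unfolding sp by (rule continuous_map_funspace[OF f])
  fix U assume "openin R U"
  then have "openin (prod_topology S T) {x \<in> topspace (prod_topology S T). f x \<in> U}"
    using f unfolding continuous_map_def by blast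
  moreover have "{x \<in> topspace (prod_topology S T). f x \<in> U} = f -` U \<inter> space (M \<Otimes>\<^sub>M N)"
    using sp by auto
  ultimately show "f -` U \<inter> space (M \<Otimes>\<^sub>M N) \<in> sets (M \<Otimes>\<^sub>M N)"
    using openin_prod_topology_sets[OF S T] sets_pair_measure_cong[OF M N] by simp
qed

section \<open>Joint continuity of the action and of the pairing\<close>

text \<open>Local compactness puts a compact neighbourhood \<open>K\<close> of \<open>v\<close>
  inside the preimage of \<open>U\<close> under \<open>f q\<close>; the compact-open condition for
  \<open>K\<close> and \<open>U\<close> times the interior part \<open>N\<close> is then a
  neighbourhood of \<open>(q, v)\<close>. Stating \<open>co\<close> as an openness condition on
  \<open>S\<close> covers both the Braconnier topology and the dual topology.\<close>

lemma continuous_map_evaluation: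
  assumes T: "locally_compact_space T" "Hausdorff_space T"
    and cont: "\<And>q. q \<in> topspace S \<Longrightarrow> continuous_map T R (f q)"
    and co: "\<And>K U. compactin T K \<Longrightarrow> openin R U \<Longrightarrow> openin S {q \<in> topspace S. f q ` K \<subseteq> U}"
  shows "continuous_map (prod_topology S T) R (\<lambda>(q, v). f q v)"
  unfolding continuous_map_def
proof (intro conjI allI impI)
  show "(\<lambda>(q, v). f q v) \<in> topspace (prod_topology S T) \<rightarrow> topspace R"
    using continuous_map_funspace[OF cont] by auto
  fix U assume U: "openin R U"
  have nb: "neighbourhood_base_of (compactin T) T"
    using T(1) locally_compact_space_neighbourhood_base[OF disjI1[OF T(2)]] by simp
  show "openin (prod_topology S T) {x \<in> topspace (prod_topology S T). (case x of (q, v) \<Rightarrow> f q v) \<in> U}"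
    unfolding openin_prod_topology_alt
  proof (intro allI impI)
    fix q v assume "(q, v) \<in> {x \<in> topspace (prod_topology S T). (case x of (q, v) \<Rightarrow> f q v) \<in> U}"
    then have q: "q \<in> topspace S" and v: "v \<in> topspace T" and fU: "f q v \<in> U" by auto
    have "openin T {v \<in> topspace T. f q v \<in> U}"
      using cont[OF q] U by (simp add: continuous_map_def)
    then have "\<exists>N K. openin T N \<and> compactin T K \<and> v \<in> N \<and> N \<subseteq> K \<and>
        K \<subseteq> {v \<in> topspace T. f q v \<in> U}"
      using nb v fU unfolding neighbourhood_base_of by simp
    then obtain N K where N: "openin T N" "compactin T K" "v \<in> N" "N \<subseteq> K"
      "K \<subseteq> {v \<in> topspace T. f q v \<in> U}"
      by (elim exE conjE)
    have "openin S {q \<in> topspace S. f q ` K \<subseteq> U}" by (rule co[OF N(2) U])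
    moreover have "q \<in> {q \<in> topspace S. f q ` K \<subseteq> U}" using q N(5) by auto
    moreover have "{q \<in> topspace S. f q ` K \<subseteq> U} \<times> N
        \<subseteq> {x \<in> topspace (prod_topology S T). (case x of (q, v) \<Rightarrow> f q v) \<in> U}"
      using N(4) openin_subset[OF N(1)] by auto
    ultimately show "\<exists>U' V'. openin S U' \<and> openin T V' \<and> q \<in> U' \<and> v \<in> V' \<and>
        U' \<times> V' \<subseteq> {x \<in> topspace (prod_topology S T). (case x of (q, v) \<Rightarrow> f q v) \<in> U}"
      using N(1,3) by (intro exI conjI) simp_all
  qed
qed

lemma continuous_map_into_generated:
  assumes "continuous_map S (topology_generated_by \<B>) f" "B \<in> \<B>"
  shows "openin S {x \<in> topspace S. f x \<in> B}"
  using assms topology_generated_by_Basis[OF assms(2)] unfolding continuous_map_def by blast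

lemma continuous_action_joint:
  assumes act: "continuous_action Q TQ V TV act"
    and V: "locally_compact_space TV" "Hausdorff_space TV"
    and Q: "topspace TQ = carrier Q"
  shows "continuous_map (prod_topology TQ TV) TV (\<lambda>(q, v). act q v)"
proof (rule continuous_map_evaluation[OF V])
  have aut: "act q \<in> top_automorphisms V TV" if "q \<in> topspace TQ" for q
    using act that Q unfolding continuous_action_def hom_def top_AutoGroup_def by auto
  then show "continuous_map TV TV (act q)" if "q \<in> topspace TQ" for q
    using that homeomorphic_imp_continuous_map by (force simp: top_automorphisms_def)
  fix K U assume "compactin TV K" "openin TV U"
  then have "openin TQ {q \<in> topspace TQ. act q \<in> {\<alpha> \<in> top_automorphisms V TV. \<alpha> ` K \<subseteq> U}}"
    using act unfolding continuous_action_def aut_topology_def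
    by (elim conjE, intro continuous_map_into_generated) blast+
  moreover have "{q \<in> topspace TQ. act q \<in> {\<alpha> \<in> top_automorphisms V TV. \<alpha> ` K \<subseteq> U}} =
      {q \<in> topspace TQ. act q ` K \<subseteq> U}" using aut by auto
  ultimately show "openin TQ {q \<in> topspace TQ. act q ` K \<subseteq> U}" by simp
qed

lemma topspace_dual_topology: "topspace (dual_topology V TV) = characters V TV"
proof -
  \<comment> \<open>The empty compact set imposes no condition, so the set of all characters is
    itself a member of the subbase, whose union is the topological space.\<close>
  have "characters V TV \<in> {{\<xi> \<in> characters V TV. \<xi> ` K \<subseteq> U} | K U. compactin TV K \<and> open U}"
    by (rule CollectI, rule exI[of _ "{}"], rule exI[of _ UNIV]) auto
  then show ?thesis
    unfolding dual_topology_def topology_generated_by_topspace by blast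
qed

lemma continuous_dual_joint:
  assumes \<eta>: "continuous_map TQ (dual_topology V TV) \<eta>"
    and V: "locally_compact_space TV" "Hausdorff_space TV"
  shows "continuous_map (prod_topology TQ TV) euclidean (\<lambda>(q, v). \<eta> q v)"
proof (rule continuous_map_evaluation[OF V])
  have ch: "\<eta> q \<in> characters V TV" if "q \<in> topspace TQ" for q
    using \<eta> that topspace_dual_topology[of V TV] by (auto simp: continuous_map_def)
  then show "continuous_map TV euclidean (\<eta> q)" if "q \<in> topspace TQ" for q
    using that by (auto simp: characters_def)
  fix K and U :: "complex set" assume "compactin TV K" "openin euclidean U"
  then have "openin TQ {q \<in> topspace TQ. \<eta> q \<in> {\<xi> \<in> characters V TV. \<xi> ` K \<subseteq> U}}"
    using \<eta> unfolding dual_topology_def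
    by (intro continuous_map_into_generated) (use open_openin in blast)+
  moreover have "{q \<in> topspace TQ. \<eta> q \<in> {\<xi> \<in> characters V TV. \<xi> ` K \<subseteq> U}} =
      {q \<in> topspace TQ. \<eta> q ` K \<subseteq> U}" using ch by auto
  ultimately show "openin TQ {q \<in> topspace TQ. \<eta> q ` K \<subseteq> U}" by simp
qed

section \<open>Haar measure\<close>

locale haar_group = group G for G :: "('a, 'm) monoid_scheme" (structure) +
  fixes T :: "'a topology" and \<mu> :: "'a measure"
  assumes lcsc: "lcsc_group G T" and haar: "left_haar_measure G T \<mu>"
begin

lemma topspace_eq: "topspace T = carrier G"
  and continuous_mult: "continuous_map (prod_topology T T) T (\<lambda>(x, y). x \<otimes> y)"
  and continuous_inv: "continuous_map T T (m_inv G)"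
  and Hausdorff: "Hausdorff_space T"
  and locally_compact: "locally_compact_space T"
  and second_countable: "second_countable T"
  using lcsc by (auto simp: lcsc_group_def)

lemma sets_haar: "sets \<mu> = sets (borel_of T)"
  and emeasure_compact: "compactin T K \<Longrightarrow> emeasure \<mu> K < \<infinity>"
  and emeasure_translate: "g \<in> carrier G \<Longrightarrow> A \<in> sets \<mu> \<Longrightarrow> emeasure \<mu> (g <# A) = emeasure \<mu> A"
  using haar by (auto simp: left_haar_measure_def)

lemma space_haar: "space \<mu> = carrier G"
  using sets_eq_imp_space_eq[OF sets_haar] by (simp add: topspace_eq)

lemma emeasure_carrier: "emeasure \<mu> (carrier G) \<noteq> 0"
  using haar by (auto simp: left_haar_measure_def space_haar)

lemma measurable_mult [measurable]:
  assumes "f \<in> M \<rightarrow>\<^sub>M \<mu>" "g \<in> M \<rightarrow>\<^sub>M \<mu>"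
  shows "(\<lambda>x. f x \<otimes> g x) \<in> M \<rightarrow>\<^sub>M \<mu>"
proof -
  have "(\<lambda>(x, y). x \<otimes> y) \<in> \<mu> \<Otimes>\<^sub>M \<mu> \<rightarrow>\<^sub>M borel_of T"
    by (rule continuous_map_prod_measurable[OF second_countable second_countable continuous_mult])
      (simp_all add: sets_haar)
  then have "(\<lambda>(x, y). x \<otimes> y) \<in> \<mu> \<Otimes>\<^sub>M \<mu> \<rightarrow>\<^sub>M \<mu>"
    by (subst measurable_cong_sets[OF refl sets_haar])
  from measurable_compose[OF measurable_Pair[OF assms] this] show ?thesis by simp
qed

lemma measurable_m_inv [measurable]:
  assumes "f \<in> M \<rightarrow>\<^sub>M \<mu>"
  shows "(\<lambda>x. inv (f x)) \<in> M \<rightarrow>\<^sub>M \<mu>"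
proof -
  have "m_inv G \<in> \<mu> \<rightarrow>\<^sub>M borel_of T"
    by (rule continuous_map_borel_of[OF continuous_inv sets_haar])
  then have "m_inv G \<in> \<mu> \<rightarrow>\<^sub>M \<mu>"
    by (subst measurable_cong_sets[OF refl sets_haar])
  from measurable_compose[OF assms this] show ?thesis .
qed

lemma measurable_const_carrier: "g \<in> carrier G \<Longrightarrow> (\<lambda>_. g) \<in> M \<rightarrow>\<^sub>M \<mu>"
  by (simp add: space_haar)

lemma l_coset_eq:
  assumes "g \<in> carrier G" "A \<subseteq> carrier G"
  shows "g <# A = {x \<in> carrier G. inv g \<otimes> x \<in> A}"
proof (intro equalityI subsetI)
  fix x assume "x \<in> g <# A"
  then obtain a where "a \<in> A" "x = g \<otimes> a" by (auto simp: l_coset_def)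
  then show "x \<in> {x \<in> carrier G. inv g \<otimes> x \<in> A}"
    using assms by (auto simp: m_assoc[symmetric] subset_iff)
next
  fix x assume x: "x \<in> {x \<in> carrier G. inv g \<otimes> x \<in> A}"
  then have "x = g \<otimes> (inv g \<otimes> x)" using assms by (simp add: m_assoc[symmetric])
  then show "x \<in> g <# A" using x by (auto simp: l_coset_def)
qed

lemma r_coset_eq:
  assumes "g \<in> carrier G" "A \<subseteq> carrier G"
  shows "A #> g = {x \<in> carrier G. x \<otimes> inv g \<in> A}"
proof (intro equalityI subsetI)
  fix x assume "x \<in> A #> g"
  then obtain a where "a \<in> A" "x = a \<otimes> g" by (auto simp: r_coset_def)
  then show "x \<in> {x \<in> carrier G. x \<otimes> inv g \<in> A}"
    using assms by (auto simp: m_assoc subset_iff)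
next
  fix x assume x: "x \<in> {x \<in> carrier G. x \<otimes> inv g \<in> A}"
  then have "x = (x \<otimes> inv g) \<otimes> g" using assms by (simp add: m_assoc)
  then show "x \<in> A #> g" using x by (auto simp: r_coset_def)
qed

lemma continuous_lmult: "g \<in> carrier G \<Longrightarrow> continuous_map T T (\<lambda>x. g \<otimes> x)"
  using continuous_map_compose[OF continuous_map_pairedI[OF continuous_map_const[THEN iffD2] continuous_map_id] continuous_mult, of g]
  by (simp add: o_def topspace_eq id_def)

lemma continuous_rmult: "g \<in> carrier G \<Longrightarrow> continuous_map T T (\<lambda>x. x \<otimes> g)"
  using continuous_map_compose[OF continuous_map_pairedI[OF continuous_map_id continuous_map_const[THEN iffD2]] continuous_mult, of g]
  by (simp add: o_def topspace_eq id_def)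

lemma openin_l_coset:
  assumes "g \<in> carrier G" "openin T A"
  shows "openin T (g <# A)"
  using openin_continuous_map_preimage[OF continuous_lmult[of "inv g"] assms(2)] assms(1)
    openin_subset[OF assms(2)]
  by (simp add: l_coset_eq topspace_eq)

lemma openin_r_coset:
  assumes "g \<in> carrier G" "openin T A"
  shows "openin T (A #> g)"
  using openin_continuous_map_preimage[OF continuous_rmult[of "inv g"] assms(2)] assms(1)
    openin_subset[OF assms(2)]
  by (simp add: r_coset_eq topspace_eq)

lemma compactin_r_coset:
  assumes "g \<in> carrier G" "compactin T K"
  shows "compactin T (K #> g)"
proof -
  have "K #> g = (\<lambda>x. x \<otimes> g) ` K" by (auto simp: r_coset_def)
  then show ?thesis using image_compactin[OF assms(2) continuous_rmult[OF assms(1)]] by simp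
qed

text \<open>The left translates of \<open>U\<close> cover the group, and by the Lindelof property
  countably many suffice. If \<open>U\<close> were null, all of them and hence the group would be
  null.\<close>

lemma emeasure_open_pos:
  assumes "openin T U" "U \<noteq> {}"
  shows "emeasure \<mu> U \<noteq> 0"
proof
  assume 0: "emeasure \<mu> U = 0"
  have U: "U \<subseteq> carrier G" using openin_subset[OF assms(1)] by (simp add: topspace_eq)
  obtain u where u: "u \<in> U" using assms(2) by auto
  have "Lindelof_space T" by (rule second_countable_imp_Lindelof_space[OF second_countable])
  moreover have "\<Union>((\<lambda>g. g <# U) ` carrier G) = topspace T"
  proof (intro equalityI subsetI)
    fix x assume "x \<in> topspace T"
    then have x: "x \<in> carrier G" by (simp add: topspace_eq)
    have "x = (x \<otimes> inv u) \<otimes> u" using x u U by (auto simp: m_assoc)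
    then have "x \<in> (x \<otimes> inv u) <# U" using u by (auto simp: l_coset_def)
    then show "x \<in> \<Union>((\<lambda>g. g <# U) ` carrier G)" using x u U by (intro UnionI[OF imageI]) auto
  next
    fix x assume "x \<in> \<Union>((\<lambda>g. g <# U) ` carrier G)"
    then obtain g where "g \<in> carrier G" "x \<in> g <# U" by (elim UnionE imageE) simp
    then show "x \<in> topspace T" using l_coset_eq[OF _ U] by (simp add: topspace_eq)
  qed
  moreover have "\<forall>W\<in>(\<lambda>g. g <# U) ` carrier G. openin T W"
    using openin_l_coset[OF _ assms(1)] by simp
  ultimately have "\<exists>\<V>. countable \<V> \<and> \<V> \<subseteq> (\<lambda>g. g <# U) ` carrier G \<and> \<Union>\<V> = topspace T"
    by (intro Lindelof_spaceD) auto
  then obtain \<V> where \<V>: "countable \<V>" "\<V> \<subseteq> (\<lambda>g. g <# U) ` carrier G" "\<Union>\<V> = topspace T"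
    by (elim exE conjE)
  have "S \<in> null_sets \<mu>" if "S \<in> \<V>" for S
  proof -
    obtain g where g: "g \<in> carrier G" "S = g <# U" using \<V>(2) \<open>S \<in> \<V>\<close> by auto
    have "S \<in> sets \<mu>"
      using openin_borel_of[OF openin_l_coset[OF g(1) assms(1)]] g sets_haar by simp
    moreover have "emeasure \<mu> S = 0"
      using emeasure_translate[OF g(1), of U] openin_borel_of[OF assms(1)] g sets_haar 0 by simp
    ultimately show ?thesis by auto
  qed
  then have "(\<Union>S\<in>\<V>. S) \<in> null_sets \<mu>" by (intro null_sets_UN' \<V>(1))
  then show False using \<V>(3) emeasure_carrier by (auto simp: topspace_eq)
qed

lemma emeasure_subset_compact:
  assumes "A \<subseteq> K" "compactin T K"
  shows "emeasure \<mu> A < \<infinity>"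
proof -
  have "K \<in> sets \<mu>"
    using closedin_borel_of[OF compactin_imp_closedin[OF Hausdorff assms(2)]] sets_haar by simp
  then show ?thesis
    using emeasure_mono[OF assms(1)] emeasure_compact[OF assms(2)] by (metis le_less_trans)
qed

text \<open>Relatively compact open sets cover the group and have finite measure; the Lindelof
  property reduces them to countably many.\<close>

lemma sigma_finite: "sigma_finite_measure \<mu>"
proof -
  define \<U> where "\<U> = {U. openin T U \<and> (\<exists>K. compactin T K \<and> U \<subseteq> K)}"
  have "Lindelof_space T" by (rule second_countable_imp_Lindelof_space[OF second_countable])
  moreover have "\<Union>\<U> = topspace T"
  proof (intro equalityI subsetI)
    fix x assume "x \<in> topspace T"
    then have "\<exists>U K. openin T U \<and> compactin T K \<and> x \<in> U \<and> U \<subseteq> K"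
      using locally_compact unfolding locally_compact_space_def by simp
    then show "x \<in> \<Union>\<U>" unfolding \<U>_def by auto
  qed (auto simp: \<U>_def dest: openin_subset)
  moreover have "\<forall>U\<in>\<U>. openin T U" by (simp add: \<U>_def)
  ultimately have "\<exists>\<V>. countable \<V> \<and> \<V> \<subseteq> \<U> \<and> \<Union>\<V> = topspace T"
    by (intro Lindelof_spaceD) simp_all
  then obtain \<V> where \<V>: "countable \<V>" "\<V> \<subseteq> \<U>" "\<Union>\<V> = topspace T"
    by (elim exE conjE)
  show ?thesis
  proof (rule sigma_finite_measure.intro, intro exI conjI)
    show "countable \<V>" by (rule \<V>(1))
    show "\<V> \<subseteq> sets \<mu>" using \<V>(2) openin_borel_of sets_haar by (auto simp: \<U>_def)
    show "\<Union>\<V> = space \<mu>" by (simp add: \<V>(3) space_haar topspace_eq)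
    show "\<forall>a\<in>\<V>. emeasure \<mu> a \<noteq> \<infinity>"
    proof
      fix a assume "a \<in> \<V>"
      then obtain K where "compactin T K" "a \<subseteq> K" using \<V>(2) by (auto simp: \<U>_def)
      then show "emeasure \<mu> a \<noteq> \<infinity>" using emeasure_subset_compact[of a K] by simp
    qed
  qed
qed

lemma distr_translate:
  assumes g: "g \<in> carrier G"
  shows "distr \<mu> \<mu> (\<lambda>x. g \<otimes> x) = \<mu>"
proof (rule measure_eqI)
  note [measurable] = measurable_const_carrier[OF g]
  fix A assume A: "A \<in> sets (distr \<mu> \<mu> (\<lambda>x. g \<otimes> x))"
  then have A': "A \<in> sets \<mu>" "A \<subseteq> carrier G"
    using sets.sets_into_space[of A \<mu>] by (auto simp: space_haar)
  have "(\<lambda>x. g \<otimes> x) -` A \<inter> space \<mu> = inv g <# A"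
    using l_coset_eq[of "inv g" A] g A' by (auto simp: space_haar)
  then show "emeasure (distr \<mu> \<mu> (\<lambda>x. g \<otimes> x)) A = emeasure \<mu> A"
    using A' g emeasure_translate[of "inv g" A] by (subst emeasure_distr) auto
qed simp

lemma nn_integral_translate:
  assumes g: "g \<in> carrier G" and f: "f \<in> borel_measurable \<mu>"
  shows "(\<integral>\<^sup>+x. f (g \<otimes> x) \<partial>\<mu>) = (\<integral>\<^sup>+x. f x \<partial>\<mu>)"
proof -
  note [measurable] = measurable_const_carrier[OF g] f
  have "(\<integral>\<^sup>+x. f (g \<otimes> x) \<partial>\<mu>) = (\<integral>\<^sup>+x. f x \<partial>distr \<mu> \<mu> (\<lambda>x. g \<otimes> x))"
    by (rule nn_integral_distr[symmetric]) measurable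
  then show ?thesis by (simp add: distr_translate[OF g])
qed

lemma integrable_translate:
  fixes f :: "'a \<Rightarrow> 'b :: {banach, second_countable_topology}"
  assumes g: "g \<in> carrier G" and f: "f \<in> borel_measurable \<mu>"
  shows "integrable \<mu> (\<lambda>x. f (g \<otimes> x)) \<longleftrightarrow> integrable \<mu> f"
proof -
  note [measurable] = measurable_const_carrier[OF g]
  have "integrable (distr \<mu> \<mu> (\<lambda>x. g \<otimes> x)) f \<longleftrightarrow> integrable \<mu> (\<lambda>x. f (g \<otimes> x))"
    by (rule integrable_distr_eq[OF _ f]) measurable
  then show ?thesis by (simp add: distr_translate[OF g])
qed

lemma integral_translate:
  fixes f :: "'a \<Rightarrow> 'b :: {banach, second_countable_topology}"
  assumes g: "g \<in> carrier G" and f: "f \<in> borel_measurable \<mu>"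
  shows "(\<integral>x. f (g \<otimes> x) \<partial>\<mu>) = (\<integral>x. f x \<partial>\<mu>)"
proof -
  note [measurable] = measurable_const_carrier[OF g]
  have "integral\<^sup>L (distr \<mu> \<mu> (\<lambda>x. g \<otimes> x)) f = (\<integral>x. f (g \<otimes> x) \<partial>\<mu>)"
    by (rule integral_distr[OF _ f]) measurable
  then show ?thesis by (simp add: distr_translate[OF g])
qed

lemma AE_translate:
  assumes g: "g \<in> carrier G" and P: "AE x in \<mu>. P x"
  shows "AE x in \<mu>. P (g \<otimes> x)"
proof -
  have m: "(\<lambda>x. g \<otimes> x) \<in> \<mu> \<rightarrow>\<^sub>M \<mu>" using measurable_const_carrier[OF g] by measurable
  have "AE x in distr \<mu> \<mu> (\<lambda>x. g \<otimes> x). P x" using P unfolding distr_translate[OF g] .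
  then show ?thesis by (rule AE_distrD[OF m])
qed

text \<open>The hypothesis \<open>eq\<close> says that \<open>\<phi>\<close> intertwines left
  translation by \<open>g'\<close> with left translation by \<open>g\<close>, so preimages of left
  translates are left translates of preimages. It holds for right translations, with
  \<open>g' = g\<close>, and for automorphisms, with \<open>g'\<close> the preimage of
  \<open>g\<close>; these two cases give the modular function and the modulus.\<close>

lemma left_haar_measure_distr:
  assumes \<phi>: "homeomorphic_map T T \<phi>"
    and eq: "\<And>g. g \<in> carrier G \<Longrightarrow> \<exists>g'\<in>carrier G. \<forall>x\<in>carrier G. \<phi> (g' \<otimes> x) = g \<otimes> \<phi> x"
  shows "left_haar_measure G T (distr \<mu> \<mu> \<phi>)"
proof -
  obtain \<psi> where hom: "homeomorphic_maps T T \<phi> \<psi>" using \<phi> by (auto simp: homeomorphic_map_maps)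
  have \<phi>m: "\<phi> \<in> \<mu> \<rightarrow>\<^sub>M \<mu>"
    using continuous_map_borel_of[OF homeomorphic_imp_continuous_map[OF \<phi>] sets_haar]
    by (subst measurable_cong_sets[OF refl sets_haar])
  have \<phi>c: "\<phi> x \<in> carrier G" if "x \<in> carrier G" for x
    using measurable_space[OF \<phi>m] that by (simp add: space_haar)
  have inverse: "\<And>x. x \<in> carrier G \<Longrightarrow> \<psi> (\<phi> x) = x" "\<And>x. x \<in> carrier G \<Longrightarrow> \<phi> (\<psi> x) = x"
    using hom by (simp_all add: homeomorphic_maps_def topspace_eq)
  have inverse: "\<And>x. x \<in> carrier G \<Longrightarrow> \<psi> (\<phi> x) = x" "\<And>x. x \<in> carrier G \<Longrightarrow> \<phi> (\<psi> x) = x"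
    "\<And>x. x \<in> carrier G \<Longrightarrow> \<psi> x \<in> carrier G"
    using inverse continuous_map_funspace[of T T \<psi>] hom
    by (auto simp: homeomorphic_maps_def topspace_eq)
  have "compactin T (\<phi> -` K \<inter> space \<mu>)" if K: "compactin T K" for K
  proof -
    have "\<phi> -` K \<inter> space \<mu> = \<psi> ` K"
    proof (intro equalityI subsetI)
      fix x assume "x \<in> \<phi> -` K \<inter> space \<mu>"
      then have "x \<in> carrier G" "\<phi> x \<in> K" by (simp_all add: space_haar)
      then have "x = \<psi> (\<phi> x)" "\<phi> x \<in> K" using inverse(1) by simp_all
      then show "x \<in> \<psi> ` K" by (rule image_eqI)
    next
      fix x assume "x \<in> \<psi> ` K"
      then obtain k where k: "k \<in> K" "x = \<psi> k" by (rule imageE)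
      then have "k \<in> carrier G" using compactin_subset_topspace[OF K] topspace_eq by auto
      then show "x \<in> \<phi> -` K \<inter> space \<mu>"
        using inverse(2,3) k by (simp add: space_haar)
    qed
    moreover have "compactin T (\<psi> ` K)"
      using hom by (intro image_compactin[OF K]) (simp add: homeomorphic_maps_def)
    ultimately show ?thesis by simp
  qed
  then have 1: "emeasure (distr \<mu> \<mu> \<phi>) K < \<infinity>" if K: "compactin T K" for K
    using that emeasure_compact closedin_borel_of[OF compactin_imp_closedin[OF Hausdorff K]] sets_haar
    by (subst emeasure_distr[OF \<phi>m]) auto
  have 2: "emeasure (distr \<mu> \<mu> \<phi>) (g <# A) = emeasure (distr \<mu> \<mu> \<phi>) A"
    if g: "g \<in> carrier G" and A: "A \<in> sets \<mu>" for g A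
  proof -
    have AG: "A \<subseteq> carrier G" using sets.sets_into_space[OF A] by (simp add: space_haar)
    note [measurable] = measurable_const_carrier[of "inv g"] A
    have "g <# A = (\<lambda>x. inv g \<otimes> x) -` A \<inter> space \<mu>"
      using l_coset_eq[OF g AG] by (auto simp: space_haar)
    also have "\<dots> \<in> sets \<mu>" using g by (intro measurable_sets[of _ \<mu> \<mu>]) (auto simp: measurable_const_carrier)
    finally have gA: "g <# A \<in> sets \<mu>" .
    obtain g' where g': "g' \<in> carrier G" "\<And>x. x \<in> carrier G \<Longrightarrow> \<phi> (g' \<otimes> x) = g \<otimes> \<phi> x"
      using eq[OF g] by (elim bexE) simp
    have *: "inv g \<otimes> \<phi> x = \<phi> (inv g' \<otimes> x)" if x: "x \<in> carrier G" for x
    proof -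
      have "\<phi> x = g \<otimes> \<phi> (inv g' \<otimes> x)"
        using g'(2)[of "inv g' \<otimes> x"] g'(1) x by (simp add: m_assoc[symmetric])
      then have "inv g \<otimes> \<phi> x = inv g \<otimes> (g \<otimes> \<phi> (inv g' \<otimes> x))" by (rule arg_cong)
      also have "\<dots> = \<phi> (inv g' \<otimes> x)"
        using g g'(1) x \<phi>c[of "inv g' \<otimes> x"] by (simp add: m_assoc[symmetric])
      finally show ?thesis .
    qed
    have "\<phi> -` (g <# A) \<inter> space \<mu> = {x \<in> carrier G. inv g \<otimes> \<phi> x \<in> A}"
      using \<phi>c unfolding l_coset_eq[OF g AG] space_haar by auto
    also have "\<dots> = {x \<in> carrier G. inv g' \<otimes> x \<in> \<phi> -` A \<inter> space \<mu>}"
      using * g'(1) by (intro Collect_cong conj_cong refl) (simp add: space_haar)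
    also have "\<dots> = g' <# (\<phi> -` A \<inter> space \<mu>)"
      by (rule l_coset_eq[OF g'(1), symmetric]) (simp add: space_haar)
    finally have "\<phi> -` (g <# A) \<inter> space \<mu> = g' <# (\<phi> -` A \<inter> space \<mu>)" .
    then show ?thesis
      using gA A measurable_sets[OF \<phi>m A] emeasure_translate[OF g'(1)] \<phi>m
      by (simp add: emeasure_distr)
  qed
  have "\<phi> -` carrier G \<inter> carrier G = carrier G" using \<phi>c by auto
  then have 3: "emeasure (distr \<mu> \<mu> \<phi>) (space \<mu>) \<noteq> 0"
    using emeasure_carrier sets.top[of \<mu>] by (subst emeasure_distr[OF \<phi>m]) (simp_all add: space_haar)
  show ?thesis unfolding left_haar_measure_def using 1 2 3 by (simp add: sets_haar)
qed

end

section \<open>Measures of right translates\<close>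

context haar_group
begin

lemma measurable_lmult: "g \<in> carrier G \<Longrightarrow> (\<lambda>x. g \<otimes> x) \<in> \<mu> \<rightarrow>\<^sub>M \<mu>"
  and measurable_rmult: "g \<in> carrier G \<Longrightarrow> (\<lambda>x. x \<otimes> g) \<in> \<mu> \<rightarrow>\<^sub>M \<mu>"
  by (intro measurable_mult measurable_const_carrier measurable_ident_sets refl, assumption)+

lemma sets_r_coset:
  assumes "g \<in> carrier G" "A \<in> sets \<mu>"
  shows "A #> g \<in> sets \<mu>"
proof -
  have AG: "A \<subseteq> carrier G" using sets.sets_into_space[OF assms(2)] by (simp add: space_haar)
  have "(\<lambda>x. x \<otimes> inv g) \<in> \<mu> \<rightarrow>\<^sub>M \<mu>"
    using assms(1) by (intro measurable_rmult) simp
  from measurable_sets[OF this assms(2)] show ?thesis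
    using r_coset_eq[OF assms(1) AG] by (simp add: space_haar vimage_def Int_def conj_commute)
qed

lemma emeasure_r_coset:
  assumes "g \<in> carrier G" "A \<in> sets \<mu>"
  shows "emeasure \<mu> (A #> g) = (\<integral>\<^sup>+y. indicator A (y \<otimes> inv g) \<partial>\<mu>)"
proof -
  have AG: "A \<subseteq> carrier G" using sets.sets_into_space[OF assms(2)] by (simp add: space_haar)
  have "emeasure \<mu> (A #> g) = (\<integral>\<^sup>+y. indicator (A #> g) y \<partial>\<mu>)"
    using sets_r_coset[OF assms] by simp
  also have "\<dots> = (\<integral>\<^sup>+y. indicator A (y \<otimes> inv g) \<partial>\<mu>)"
    using r_coset_eq[OF assms(1) AG] by (intro nn_integral_cong) (simp add: space_haar indicator_def)
  finally show ?thesis .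
qed

lemma measurable_emeasure_r_coset:
  assumes A [measurable]: "A \<in> sets \<mu>"
  shows "(\<lambda>g. emeasure \<mu> (A #> g)) \<in> borel_measurable \<mu>"
proof -
  interpret sigma_finite_measure \<mu> by (rule sigma_finite)
  have "(\<lambda>g. \<integral>\<^sup>+y. indicator A (y \<otimes> inv g) \<partial>\<mu>) \<in> borel_measurable \<mu>"
    by measurable
  then show ?thesis
    by (subst measurable_cong[OF emeasure_r_coset]) (simp_all add: space_haar A)
qed

lemma exists_open_relatively_compact:
  obtains A K where "openin T A" "A \<noteq> {}" "A \<subseteq> K" "compactin T K"
proof -
  have "\<one> \<in> topspace T" by (simp add: topspace_eq)
  then have "\<exists>U K. openin T U \<and> compactin T K \<and> \<one> \<in> U \<and> U \<subseteq> K"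
    using locally_compact unfolding locally_compact_space_def by simp
  then show thesis by (elim exE conjE) (rule that, auto)
qed

end

text \<open>Left invariance in the two variables separately makes \<open>(x, y) \<mapsto> (y x, x\<^sup>-\<^sup>1)\<close> preserve the
  product measure.\<close>

lemma haar_double_integral:
  assumes "haar_group G T \<mu>" "haar_group G T \<nu>" and A: "A \<in> sets \<mu>" and g: "g \<in> borel_measurable \<nu>"
  shows "emeasure \<mu> A * (\<integral>\<^sup>+y. g y \<partial>\<nu>) =
    (\<integral>\<^sup>+x. g (m_inv G x) * emeasure \<nu> (A #>\<^bsub>G\<^esub> m_inv G x) \<partial>\<mu>)"
proof -
  interpret M: haar_group G T \<mu> by fact
  interpret N: haar_group G T \<nu> by fact
  interpret pair_sigma_finite \<mu> \<nu>
    by (intro pair_sigma_finite.intro M.sigma_finite N.sigma_finite)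
  have eq: "sets \<mu> = sets \<nu>" by (simp add: M.sets_haar N.sets_haar)
  have A': "A \<in> sets \<nu>" using A eq by simp
  have ind: "(\<lambda>x. indicator A (h x) :: ennreal) \<in> borel_measurable M" if "h \<in> M \<rightarrow>\<^sub>M \<nu>" for h and M :: "'z measure"
    using that A' by (intro measurable_compose[OF that borel_measurable_indicator])
  have fst: "fst \<in> \<mu> \<Otimes>\<^sub>M \<nu> \<rightarrow>\<^sub>M \<nu>"
    using measurable_fst[of \<mu> \<nu>] measurable_cong_sets[OF refl eq] by auto
  have id: "(\<lambda>x. x) \<in> \<mu> \<rightarrow>\<^sub>M \<nu>" by (rule measurable_ident_sets[OF eq])
  have "(\<lambda>p. indicator A (fst p) * g (m_inv G (fst p) \<otimes>\<^bsub>G\<^esub> snd p)) \<in> borel_measurable (\<mu> \<Otimes>\<^sub>M \<nu>)"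
    by (intro borel_measurable_times_ennreal ind fst measurable_compose[OF _ g] N.measurable_mult
        N.measurable_m_inv measurable_snd)
  then have 1: "case_prod (\<lambda>x y. indicator A x * g (m_inv G x \<otimes>\<^bsub>G\<^esub> y)) \<in> borel_measurable (\<mu> \<Otimes>\<^sub>M \<nu>)"
    by (simp only: case_prod_beta')
  have "(\<lambda>p. indicator A (snd p \<otimes>\<^bsub>G\<^esub> fst p) * g (m_inv G (fst p))) \<in> borel_measurable (\<mu> \<Otimes>\<^sub>M \<nu>)"
    by (intro borel_measurable_times_ennreal ind fst measurable_compose[OF _ g] N.measurable_mult
        N.measurable_m_inv measurable_snd)
  then have 2: "case_prod (\<lambda>x y. indicator A (y \<otimes>\<^bsub>G\<^esub> x) * g (m_inv G x)) \<in> borel_measurable (\<mu> \<Otimes>\<^sub>M \<nu>)"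
    by (simp only: case_prod_beta')
  have "emeasure \<mu> A * (\<integral>\<^sup>+y. g y \<partial>\<nu>) = (\<integral>\<^sup>+x. indicator A x * (\<integral>\<^sup>+y. g y \<partial>\<nu>) \<partial>\<mu>)"
    using A by (simp add: nn_integral_multc)
  also have "\<dots> = (\<integral>\<^sup>+x. (\<integral>\<^sup>+y. indicator A x * g (m_inv G x \<otimes>\<^bsub>G\<^esub> y) \<partial>\<nu>) \<partial>\<mu>)"
  proof (rule nn_integral_cong)
    fix x assume "x \<in> space \<mu>"
    then have x: "m_inv G x \<in> carrier G" by (simp add: M.space_haar)
    have "(\<integral>\<^sup>+y. g y \<partial>\<nu>) = (\<integral>\<^sup>+y. g (m_inv G x \<otimes>\<^bsub>G\<^esub> y) \<partial>\<nu>)"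
      by (rule N.nn_integral_translate[OF x g, symmetric])
    moreover have "(\<integral>\<^sup>+y. indicator A x * g (m_inv G x \<otimes>\<^bsub>G\<^esub> y) \<partial>\<nu>) =
        indicator A x * (\<integral>\<^sup>+y. g (m_inv G x \<otimes>\<^bsub>G\<^esub> y) \<partial>\<nu>)"
      by (rule nn_integral_cmult, rule measurable_compose[OF N.measurable_lmult[OF x] g])
    ultimately show "indicator A x * (\<integral>\<^sup>+y. g y \<partial>\<nu>) =
        (\<integral>\<^sup>+y. indicator A x * g (m_inv G x \<otimes>\<^bsub>G\<^esub> y) \<partial>\<nu>)"
      by simp
  qed
  also have "\<dots> = (\<integral>\<^sup>+y. (\<integral>\<^sup>+x. indicator A x * g (m_inv G x \<otimes>\<^bsub>G\<^esub> y) \<partial>\<mu>) \<partial>\<nu>)"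
    by (rule Fubini'[OF 1, symmetric])
  \<comment> \<open>Left translation of \<open>x\<close> by \<open>y\<close> replaces the argument
    \<open>x^-1 y\<close> of \<open>g\<close> by \<open>(y x)^-1 y = x^-1\<close>, after which the
    inner integral over \<open>y\<close> is the measure of a right translate of
    \<open>A\<close>.\<close>
  also have "\<dots> = (\<integral>\<^sup>+y. (\<integral>\<^sup>+x. indicator A (y \<otimes>\<^bsub>G\<^esub> x) * g (m_inv G x) \<partial>\<mu>) \<partial>\<nu>)"
  proof (rule nn_integral_cong)
    fix y assume "y \<in> space \<nu>"
    then have y: "y \<in> carrier G" by (simp add: N.space_haar)
    have "(\<integral>\<^sup>+x. indicator A x * g (m_inv G x \<otimes>\<^bsub>G\<^esub> y) \<partial>\<mu>) =
        (\<integral>\<^sup>+x. indicator A (y \<otimes>\<^bsub>G\<^esub> x) * g (m_inv G (y \<otimes>\<^bsub>G\<^esub> x) \<otimes>\<^bsub>G\<^esub> y) \<partial>\<mu>)"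
    proof (rule M.nn_integral_translate[OF y, symmetric])
      show "(\<lambda>x. indicator A x * g (m_inv G x \<otimes>\<^bsub>G\<^esub> y)) \<in> borel_measurable \<mu>"
        by (intro borel_measurable_times_ennreal ind id measurable_compose[OF _ g] N.measurable_mult
            N.measurable_m_inv N.measurable_const_carrier y)
    qed
    also have "\<dots> = (\<integral>\<^sup>+x. indicator A (y \<otimes>\<^bsub>G\<^esub> x) * g (m_inv G x) \<partial>\<mu>)"
    proof (rule nn_integral_cong)
      fix x assume "x \<in> space \<mu>"
      then have x: "x \<in> carrier G" by (simp add: M.space_haar)
      have "m_inv G (y \<otimes>\<^bsub>G\<^esub> x) \<otimes>\<^bsub>G\<^esub> y = m_inv G x"
        using x y by (simp add: M.inv_mult_group M.m_assoc)
      then show "indicator A (y \<otimes>\<^bsub>G\<^esub> x) * g (m_inv G (y \<otimes>\<^bsub>G\<^esub> x) \<otimes>\<^bsub>G\<^esub> y) =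
          indicator A (y \<otimes>\<^bsub>G\<^esub> x) * g (m_inv G x)" by (simp only:)
    qed
    finally show "(\<integral>\<^sup>+x. indicator A x * g (m_inv G x \<otimes>\<^bsub>G\<^esub> y) \<partial>\<mu>) =
        (\<integral>\<^sup>+x. indicator A (y \<otimes>\<^bsub>G\<^esub> x) * g (m_inv G x) \<partial>\<mu>)" .
  qed
  also have "\<dots> = (\<integral>\<^sup>+x. (\<integral>\<^sup>+y. indicator A (y \<otimes>\<^bsub>G\<^esub> x) * g (m_inv G x) \<partial>\<nu>) \<partial>\<mu>)"
    by (rule Fubini'[OF 2])
  also have "\<dots> = (\<integral>\<^sup>+x. g (m_inv G x) * emeasure \<nu> (A #>\<^bsub>G\<^esub> m_inv G x) \<partial>\<mu>)"
  proof (rule nn_integral_cong)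
    fix x assume "x \<in> space \<mu>"
    then have x: "x \<in> carrier G" by (simp add: M.space_haar)
    have "emeasure \<nu> (A #>\<^bsub>G\<^esub> m_inv G x) = (\<integral>\<^sup>+y. indicator A (y \<otimes>\<^bsub>G\<^esub> x) \<partial>\<nu>)"
      using N.emeasure_r_coset[OF _ A', of "m_inv G x"] x by simp
    moreover have "(\<integral>\<^sup>+y. indicator A (y \<otimes>\<^bsub>G\<^esub> x) * g (m_inv G x) \<partial>\<nu>) =
        (\<integral>\<^sup>+y. indicator A (y \<otimes>\<^bsub>G\<^esub> x) \<partial>\<nu>) * g (m_inv G x)"
      by (rule nn_integral_multc, rule ind, rule N.measurable_rmult[OF x])
    ultimately show "(\<integral>\<^sup>+y. indicator A (y \<otimes>\<^bsub>G\<^esub> x) * g (m_inv G x) \<partial>\<nu>) =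
        g (m_inv G x) * emeasure \<nu> (A #>\<^bsub>G\<^esub> m_inv G x)"
      by (simp add: mult.commute)
  qed
  finally show ?thesis .
qed

section \<open>Inversion formula and uniqueness of Haar measure\<close>

text \<open>Take \<open>g y = f y / \<nu>(A y)\<close> in \<open>haar_double_integral\<close>: the
  weight cancels on the right-hand side. The choice of \<open>A\<close> as nonempty, open and
  relatively compact makes every \<open>\<nu>(A y)\<close> positive and finite, so the division is
  harmless. The point of the formula is that \<open>\<mu>\<close> survives on the right only through
  the number \<open>\<mu>(A)\<close>.\<close>

lemma haar_inversion_integral:
  assumes M: "haar_group G T \<mu>" and N: "haar_group G T \<nu>" and f: "f \<in> borel_measurable \<nu>"
    and A: "openin T A" "A \<noteq> {}" "A \<subseteq> K" "compactin T K"
  shows "(\<integral>\<^sup>+x. f (m_inv G x) \<partial>\<mu>) =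
    emeasure \<mu> A * (\<integral>\<^sup>+y. f y / emeasure \<nu> (A #>\<^bsub>G\<^esub> y) \<partial>\<nu>)"
proof -
  interpret M: haar_group G T \<mu> by fact
  interpret N: haar_group G T \<nu> by fact
  have As: "A \<in> sets \<mu>" "A \<in> sets \<nu>"
    using openin_borel_of[OF A(1)] by (simp_all add: M.sets_haar N.sets_haar)
  have pos: "emeasure \<nu> (A #>\<^bsub>G\<^esub> y) \<noteq> 0" and fin: "emeasure \<nu> (A #>\<^bsub>G\<^esub> y) < \<infinity>"
    if y: "y \<in> carrier G" for y
  proof -
    show "emeasure \<nu> (A #>\<^bsub>G\<^esub> y) \<noteq> 0"
      using A(2) by (intro N.emeasure_open_pos N.openin_r_coset A(1) y) (auto simp: r_coset_def)
    show "emeasure \<nu> (A #>\<^bsub>G\<^esub> y) < \<infinity>"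
      using A(3) by (intro N.emeasure_subset_compact[OF _ N.compactin_r_coset[OF y A(4)]])
        (auto simp: r_coset_def)
  qed
  have "(\<lambda>y. f y / emeasure \<nu> (A #>\<^bsub>G\<^esub> y)) \<in> borel_measurable \<nu>"
    using N.measurable_emeasure_r_coset[OF As(2)] f by measurable
  from haar_double_integral[OF M N As(1) this]
  have "emeasure \<mu> A * (\<integral>\<^sup>+y. f y / emeasure \<nu> (A #>\<^bsub>G\<^esub> y) \<partial>\<nu>) =
      (\<integral>\<^sup>+x. f (m_inv G x) / emeasure \<nu> (A #>\<^bsub>G\<^esub> m_inv G x) * emeasure \<nu> (A #>\<^bsub>G\<^esub> m_inv G x) \<partial>\<mu>)" .
  also have "\<dots> = (\<integral>\<^sup>+x. f (m_inv G x) \<partial>\<mu>)"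
    using pos fin by (intro nn_integral_cong)
      (simp add: M.space_haar ennreal_divide_times ennreal_divide_self del: times_divide_eq_left)
  finally show ?thesis by simp
qed

lemma ennreal_pos_real:
  assumes "e \<noteq> 0" "e < \<infinity>"
  shows "\<exists>r>0. e = ennreal r"
  using assms by (cases e) (auto simp: less_le)

text \<open>The inversion formulas for the pairs \<open>\<mu>, \<nu>\<close> and
  \<open>\<nu>, \<nu>\<close> contain the same integral, so the two measures differ by the factor
  \<open>\<mu>(A) / \<nu>(A)\<close>. Stating the result for nonnegative integrals keeps the
  infinite values.\<close>

lemma haar_unique:
  assumes M: "haar_group G T \<mu>" and N: "haar_group G T \<nu>"
  shows "\<exists>c>0. \<forall>f\<in>borel_measurable \<nu>. (\<integral>\<^sup>+x. f x \<partial>\<mu>) = ennreal c * (\<integral>\<^sup>+x. f x \<partial>\<nu>)"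
proof -
  interpret M: haar_group G T \<mu> by fact
  interpret N: haar_group G T \<nu> by fact
  obtain A K where A: "openin T A" "A \<noteq> {}" "A \<subseteq> K" "compactin T K"
    by (rule M.exists_open_relatively_compact)
  obtain a where a: "0 < a" "emeasure \<mu> A = ennreal a"
    using ennreal_pos_real[OF M.emeasure_open_pos[OF A(1,2)] M.emeasure_subset_compact[OF A(3,4)]]
    by (elim exE conjE)
  obtain b where b: "0 < b" "emeasure \<nu> A = ennreal b"
    using ennreal_pos_real[OF N.emeasure_open_pos[OF A(1,2)] N.emeasure_subset_compact[OF A(3,4)]]
    by (elim exE conjE)
  show ?thesis
  proof (intro exI[of _ "a / b"] conjI ballI)
    show "0 < a / b" using a b by simp
    fix f :: "'a \<Rightarrow> ennreal" assume f: "f \<in> borel_measurable \<nu>"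
    \<comment> \<open>The inversion formula integrates \<open>h\<close> at the inverse, so
      \<open>h\<close> is \<open>f\<close> composed with inversion, and the double inverse gives
      back \<open>f\<close>.\<close>
    define h where "h x = f (m_inv G x)" for x
    have h: "h \<in> borel_measurable \<nu>" unfolding h_def using f by measurable
    define I where "I = (\<integral>\<^sup>+y. h y / emeasure \<nu> (A #>\<^bsub>G\<^esub> y) \<partial>\<nu>)"
    have "(\<integral>\<^sup>+x. f x \<partial>\<mu>) = (\<integral>\<^sup>+x. h (m_inv G x) \<partial>\<mu>)"
      by (intro nn_integral_cong) (simp add: h_def M.space_haar)
    also have "\<dots> = ennreal a * I"
      unfolding I_def a(2)[symmetric] by (rule haar_inversion_integral[OF M N h A])
    finally have 1: "(\<integral>\<^sup>+x. f x \<partial>\<mu>) = ennreal a * I" .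
    have "(\<integral>\<^sup>+x. f x \<partial>\<nu>) = (\<integral>\<^sup>+x. h (m_inv G x) \<partial>\<nu>)"
      by (intro nn_integral_cong) (simp add: h_def N.space_haar)
    also have "\<dots> = ennreal b * I"
      unfolding I_def b(2)[symmetric] by (rule haar_inversion_integral[OF N N h A])
    finally have 2: "(\<integral>\<^sup>+x. f x \<partial>\<nu>) = ennreal b * I" .
    have "ennreal a = ennreal (a / b) * ennreal b"
      using a b by (simp add: ennreal_mult[symmetric])
    then show "(\<integral>\<^sup>+x. f x \<partial>\<mu>) = ennreal (a / b) * (\<integral>\<^sup>+x. f x \<partial>\<nu>)"
      unfolding 1 2 by (simp add: mult.assoc)
  qed
qed

text \<open>A test set against which proportionality constants are compared: a measure strictly
  between 0 and infinity can be cancelled.\<close>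

lemma (in haar_group) finite_positive_set:
  obtains A a where "A \<in> sets \<mu>" "0 < a" "emeasure \<mu> A = ennreal a"
proof -
  obtain A K where A: "openin T A" "A \<noteq> {}" "A \<subseteq> K" "compactin T K"
    by (rule exists_open_relatively_compact)
  obtain a where a: "0 < a" "emeasure \<mu> A = ennreal a"
    using ennreal_pos_real[OF emeasure_open_pos[OF A(1,2)] emeasure_subset_compact[OF A(3,4)]]
    by (elim exE conjE)
  show thesis
    using that[of A a] a openin_borel_of[OF A(1)] by (simp add: sets_haar)
qed

section \<open>The modular function\<close>

lemma (in haar_group) haar_group_distr:
  assumes "homeomorphic_map T T \<phi>"
    and "\<And>g. g \<in> carrier G \<Longrightarrow> \<exists>g'\<in>carrier G. \<forall>x\<in>carrier G. \<phi> (g' \<otimes> x) = g \<otimes> \<phi> x"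
  shows "haar_group G T (distr \<mu> \<mu> \<phi>)"
  by (intro haar_group.intro haar_group_axioms.intro is_group lcsc left_haar_measure_distr assms)

lemma ennreal_real_mult_right_cancel:
  assumes "ennreal r * ennreal a = ennreal s * ennreal a" "0 < r" "0 < s" "0 < a"
  shows "r = s"
  using assms by (simp add: ennreal_mult[symmetric])

text \<open>Right multiplication commutes with left translations, so the image of
  \<open>\<mu>\<close> under \<open>x \<mapsto> x g^-1\<close> is again a Haar measure; it assigns
  to \<open>A\<close> the measure of \<open>A g\<close>. Uniqueness of Haar measure gives the
  constant, and a set of finite positive measure shows that there is only one. This justifies the
  definite description in \<open>modular_function\<close>.\<close>

lemma (in haar_group) modular_function_ex1:
  assumes g: "g \<in> carrier G"
  shows "\<exists>!r. 0 < r \<and> (\<forall>A\<in>sets \<mu>. emeasure \<mu> (A #> g) = ennreal r * emeasure \<mu> A)"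
proof -
  have hom: "homeomorphic_map T T (\<lambda>x. x \<otimes> inv g)"
    unfolding homeomorphic_map_maps
    by (rule exI[of _ "\<lambda>x. x \<otimes> g"])
      (use g in \<open>simp add: homeomorphic_maps_def continuous_rmult topspace_eq m_assoc\<close>)
  have D: "haar_group G T (distr \<mu> \<mu> (\<lambda>x. x \<otimes> inv g))"
    by (rule haar_group_distr[OF hom]) (use g in \<open>auto simp: m_assoc\<close>)
  have m: "(\<lambda>x. x \<otimes> inv g) \<in> \<mu> \<rightarrow>\<^sub>M \<mu>"
    using g by (intro measurable_rmult) simp
  obtain c where c: "0 < c" "\<And>f. f \<in> borel_measurable \<mu> \<Longrightarrow>
      (\<integral>\<^sup>+x. f x \<partial>distr \<mu> \<mu> (\<lambda>x. x \<otimes> inv g)) = ennreal c * (\<integral>\<^sup>+x. f x \<partial>\<mu>)"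
    using haar_unique[OF D haar_group_axioms] by (elim exE conjE) simp
  have "emeasure \<mu> (A #> g) = ennreal c * emeasure \<mu> A" if A [measurable]: "A \<in> sets \<mu>" for A
  proof -
    have "emeasure \<mu> (A #> g) = (\<integral>\<^sup>+x. indicator A x \<partial>distr \<mu> \<mu> (\<lambda>x. x \<otimes> inv g))"
      unfolding emeasure_r_coset[OF g A] by (rule nn_integral_distr[symmetric, OF m]) measurable
    also have "\<dots> = ennreal c * emeasure \<mu> A" using c(2)[of "indicator A"] A by simp
    finally show ?thesis .
  qed
  moreover obtain A a where A: "A \<in> sets \<mu>" "0 < a" "emeasure \<mu> A = ennreal a"
    by (rule finite_positive_set)
  ultimately have *: "0 < c \<and> (\<forall>A\<in>sets \<mu>. emeasure \<mu> (A #> g) = ennreal c * emeasure \<mu> A)"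
    using c(1) by simp
  show ?thesis
  proof (rule ex1I, rule *)
    fix r assume r: "0 < r \<and> (\<forall>A\<in>sets \<mu>. emeasure \<mu> (A #> g) = ennreal r * emeasure \<mu> A)"
    then have "ennreal r * ennreal a = ennreal c * ennreal a" using * A by auto
    then show "r = c" using r c(1) A(2) ennreal_real_mult_right_cancel by simp
  qed
qed

lemma (in haar_group)
  assumes g: "g \<in> carrier G"
  shows modular_function_pos: "0 < modular_function G \<mu> g"
    and emeasure_r_coset_modular:
      "A \<in> sets \<mu> \<Longrightarrow> emeasure \<mu> (A #> g) = ennreal (modular_function G \<mu> g) * emeasure \<mu> A"
  using theI'[OF modular_function_ex1[OF g]] unfolding modular_function_def[symmetric] by auto

text \<open>One fixed test set \<open>A\<close> suffices: the modular function is the quotient of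
  the measures of \<open>A g\<close> and \<open>A\<close>, and the numerator is measurable in
  \<open>g\<close> by Tonelli.\<close>

lemma (in haar_group) measurable_modular_function:
  "modular_function G \<mu> \<in> borel_measurable \<mu>"
proof -
  obtain A a where A: "A \<in> sets \<mu>" "0 < a" "emeasure \<mu> A = ennreal a"
    by (rule finite_positive_set)
  have "modular_function G \<mu> g = enn2real (emeasure \<mu> (A #> g)) / a" if "g \<in> space \<mu>" for g
    using that emeasure_r_coset_modular[of g A] modular_function_pos[of g] A
    by (simp add: space_haar enn2real_mult)
  moreover have "(\<lambda>g. enn2real (emeasure \<mu> (A #> g)) / a) \<in> borel_measurable \<mu>"
    using measurable_emeasure_r_coset[OF A(1)] by measurable
  ultimately show ?thesis using measurable_cong[of \<mu> "modular_function G \<mu>"] by simp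
qed

text \<open>This is the inversion formula with both measures equal, in which the weight
  \<open>\<mu>(A) / \<mu>(A y)\<close> is the reciprocal of the modular function.\<close>

lemma (in haar_group) nn_integral_inverse:
  assumes f: "f \<in> borel_measurable \<mu>"
  shows "(\<integral>\<^sup>+x. f (inv x) \<partial>\<mu>) = (\<integral>\<^sup>+x. f x * ennreal (1 / modular_function G \<mu> x) \<partial>\<mu>)"
proof -
  obtain A K where A: "openin T A" "A \<noteq> {}" "A \<subseteq> K" "compactin T K"
    by (rule exists_open_relatively_compact)
  obtain a where a: "0 < a" "emeasure \<mu> A = ennreal a"
    using ennreal_pos_real[OF emeasure_open_pos[OF A(1,2)] emeasure_subset_compact[OF A(3,4)]]
    by (elim exE conjE)
  have As: "A \<in> sets \<mu>" using openin_borel_of[OF A(1)] by (simp add: sets_haar)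
  have m: "(\<lambda>y. f y / emeasure \<mu> (A #> y)) \<in> borel_measurable \<mu>"
    using measurable_emeasure_r_coset[OF As] f by measurable
  have "(\<integral>\<^sup>+x. f (inv x) \<partial>\<mu>) = (\<integral>\<^sup>+y. emeasure \<mu> A * (f y / emeasure \<mu> (A #> y)) \<partial>\<mu>)"
    unfolding haar_inversion_integral[OF haar_group_axioms haar_group_axioms f A]
    by (rule nn_integral_cmult[OF m, symmetric])
  also have "\<dots> = (\<integral>\<^sup>+x. f x * ennreal (1 / modular_function G \<mu> x) \<partial>\<mu>)"
  proof (rule nn_integral_cong)
    fix y assume "y \<in> space \<mu>"
    then have y: "y \<in> carrier G" by (simp add: space_haar)
    have p: "0 < modular_function G \<mu> y" by (rule modular_function_pos[OF y])
    have "ennreal a * (f y / ennreal (modular_function G \<mu> y * a)) =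
        f y * (ennreal a / ennreal (modular_function G \<mu> y * a))"
      by (simp add: divide_ennreal_def mult_ac)
    also have "ennreal a / ennreal (modular_function G \<mu> y * a) = ennreal (1 / modular_function G \<mu> y)"
      using p a by (simp add: divide_ennreal)
    finally show "emeasure \<mu> A * (f y / emeasure \<mu> (A #> y)) =
        f y * ennreal (1 / modular_function G \<mu> y)"
      using emeasure_r_coset_modular[OF y As] a p by (simp add: ennreal_mult[symmetric])
  qed
  finally show ?thesis .
qed

section \<open>Actions by automorphisms\<close>

locale haar_action =
  Q: haar_group Q TQ \<mu>Q + V: haar_group V TV \<mu>V
  for Q :: "('q, 'm) monoid_scheme" (structure) and TQ \<mu>Q and V :: "('v, 'n) monoid_scheme" and TV \<mu>V +
  fixes act :: "'q \<Rightarrow> 'v \<Rightarrow> 'v"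
  assumes action: "continuous_action Q TQ V TV act"
begin

lemma act_automorphism: "q \<in> carrier Q \<Longrightarrow> act q \<in> top_automorphisms V TV"
  using action unfolding continuous_action_def hom_def top_AutoGroup_def by auto

lemma act_homeomorphic: "q \<in> carrier Q \<Longrightarrow> homeomorphic_map TV TV (act q)"
  using act_automorphism by (simp add: top_automorphisms_def)

lemma act_auto: "q \<in> carrier Q \<Longrightarrow> act q \<in> auto V"
  using act_automorphism by (simp add: top_automorphisms_def)

lemma act_bij: "q \<in> carrier Q \<Longrightarrow> bij_betw (act q) (carrier V) (carrier V)"
  using act_auto by (simp add: auto_def Bij_def)

lemma act_closed: "q \<in> carrier Q \<Longrightarrow> v \<in> carrier V \<Longrightarrow> act q v \<in> carrier V"
  using act_bij bij_betwE by blast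

lemma act_hom: "q \<in> carrier Q \<Longrightarrow> v \<in> carrier V \<Longrightarrow> w \<in> carrier V \<Longrightarrow>
    act q (v \<otimes>\<^bsub>V\<^esub> w) = act q v \<otimes>\<^bsub>V\<^esub> act q w"
  using act_auto[of q] by (simp add: auto_def hom_def)

lemma act_comp:
  assumes "q1 \<in> carrier Q" "q2 \<in> carrier Q" "v \<in> carrier V"
  shows "act (q1 \<otimes> q2) v = act q1 (act q2 v)"
proof -
  have "act (q1 \<otimes> q2) = act q1 \<otimes>\<^bsub>top_AutoGroup V TV\<^esub> act q2"
    using action assms unfolding continuous_action_def by (simp add: hom_mult)
  also have "\<dots> = compose (carrier V) (act q1) (act q2)"
    using act_auto assms by (simp add: top_AutoGroup_def AutoGroup_def BijGroup_def auto_def)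
  finally show ?thesis using assms by (simp add: compose_def)
qed

lemma measurable_act:
  assumes "f \<in> M \<rightarrow>\<^sub>M \<mu>Q" "g \<in> M \<rightarrow>\<^sub>M \<mu>V"
  shows "(\<lambda>x. act (f x) (g x)) \<in> M \<rightarrow>\<^sub>M \<mu>V"
proof -
  have "(\<lambda>(q, v). act q v) \<in> \<mu>Q \<Otimes>\<^sub>M \<mu>V \<rightarrow>\<^sub>M borel_of TV"
    by (rule continuous_map_prod_measurable[OF Q.second_countable V.second_countable
        continuous_action_joint[OF action V.locally_compact V.Hausdorff Q.topspace_eq]])
      (simp_all add: Q.sets_haar V.sets_haar)
  then have "(\<lambda>(q, v). act q v) \<in> \<mu>Q \<Otimes>\<^sub>M \<mu>V \<rightarrow>\<^sub>M \<mu>V"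
    by (subst measurable_cong_sets[OF refl V.sets_haar])
  from measurable_compose[OF measurable_Pair[OF assms] this] show ?thesis by simp
qed

lemma measurable_act_const: "q \<in> carrier Q \<Longrightarrow> act q \<in> \<mu>V \<rightarrow>\<^sub>M \<mu>V"
  using measurable_act[OF Q.measurable_const_carrier measurable_ident_sets[OF refl], of q] by simp

section \<open>The modulus of the action\<close>

text \<open>An automorphism carries left translations to left translations, so the image of Haar
  measure under \<open>act q\<close> is a Haar measure, and uniqueness gives a factor
  \<open>c\<close>. The modulus is \<open>1 / c\<close> because the defining formula divides by
  it.\<close>

lemma modulus_ex1:
  assumes q: "q \<in> carrier Q"
  shows "\<exists>!r. 0 < r \<and> (\<forall>f\<in>borel_measurable \<mu>V.
    (\<integral>\<^sup>+v. f (act q v) \<partial>\<mu>V) = ennreal (1 / r) * (\<integral>\<^sup>+v. f v \<partial>\<mu>V))"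
proof -
  have D: "haar_group V TV (distr \<mu>V \<mu>V (act q))"
  proof (rule V.haar_group_distr[OF act_homeomorphic[OF q]])
    fix v assume v: "v \<in> carrier V"
    obtain w where w: "w \<in> carrier V" "act q w = v"
      using act_bij[OF q] v unfolding bij_betw_def by (metis imageE)
    then show "\<exists>w\<in>carrier V. \<forall>x\<in>carrier V. act q (w \<otimes>\<^bsub>V\<^esub> x) = v \<otimes>\<^bsub>V\<^esub> act q x"
      using act_hom[OF q] by auto
  qed
  obtain c where c: "0 < c" "\<And>f. f \<in> borel_measurable \<mu>V \<Longrightarrow>
      (\<integral>\<^sup>+x. f x \<partial>distr \<mu>V \<mu>V (act q)) = ennreal c * (\<integral>\<^sup>+x. f x \<partial>\<mu>V)"
    using haar_unique[OF D V.haar_group_axioms] by (elim exE conjE) simp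
  have eq: "(\<integral>\<^sup>+v. f (act q v) \<partial>\<mu>V) = ennreal c * (\<integral>\<^sup>+v. f v \<partial>\<mu>V)"
    if "f \<in> borel_measurable \<mu>V" for f
    using c(2)[OF that] nn_integral_distr[OF measurable_act_const[OF q], of f] that by simp
  obtain A a where A: "A \<in> sets \<mu>V" "0 < a" "emeasure \<mu>V A = ennreal a"
    by (rule V.finite_positive_set)
  show ?thesis
  proof (rule ex1I[of _ "1 / c"])
    show "0 < 1 / c \<and> (\<forall>f\<in>borel_measurable \<mu>V.
        (\<integral>\<^sup>+v. f (act q v) \<partial>\<mu>V) = ennreal (1 / (1 / c)) * (\<integral>\<^sup>+v. f v \<partial>\<mu>V))"
      using c(1) eq by simp
    fix r assume r: "0 < r \<and> (\<forall>f\<in>borel_measurable \<mu>V.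
        (\<integral>\<^sup>+v. f (act q v) \<partial>\<mu>V) = ennreal (1 / r) * (\<integral>\<^sup>+v. f v \<partial>\<mu>V))"
    have ind: "(indicator A :: 'v \<Rightarrow> ennreal) \<in> borel_measurable \<mu>V" using A(1) by simp
    have "ennreal (1 / r) * ennreal a = ennreal c * ennreal a"
      using eq[OF ind] conjunct2[OF r, THEN bspec, OF ind] A by simp
    then have "1 / r = c" using r c(1) A(2) ennreal_real_mult_right_cancel[of "1 / r" a c] by simp
    then show "r = 1 / c" by (simp flip: \<open>1 / r = c\<close>)
  qed
qed

lemma
  assumes q: "q \<in> carrier Q"
  shows modulus_pos: "0 < modulus \<mu>V act q"
    and nn_integral_act: "f \<in> borel_measurable \<mu>V \<Longrightarrow>
      (\<integral>\<^sup>+v. f (act q v) \<partial>\<mu>V) = ennreal (1 / modulus \<mu>V act q) * (\<integral>\<^sup>+v. f v \<partial>\<mu>V)"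
  using theI'[OF modulus_ex1[OF q]] unfolding modulus_def[symmetric] by auto

text \<open>The indicator of a test set is integrated along \<open>act (q1 q2)\<close> in one step
  and along \<open>act q1\<close> and \<open>act q2\<close> in two.\<close>

lemma modulus_mult:
  assumes q: "q1 \<in> carrier Q" "q2 \<in> carrier Q"
  shows "modulus \<mu>V act (q1 \<otimes> q2) = modulus \<mu>V act q1 * modulus \<mu>V act q2"
proof -
  obtain A a where A: "A \<in> sets \<mu>V" "0 < a" "emeasure \<mu>V A = ennreal a"
    by (rule V.finite_positive_set)
  have ind: "(indicator A :: 'v \<Rightarrow> ennreal) \<in> borel_measurable \<mu>V" using A(1) by simp
  have ind1: "(\<lambda>v. indicator A (act q1 v) :: ennreal) \<in> borel_measurable \<mu>V"
    by (rule measurable_compose[OF measurable_act_const[OF q(1)] ind])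
  have "ennreal (1 / modulus \<mu>V act (q1 \<otimes> q2)) * ennreal a =
      (\<integral>\<^sup>+v. indicator A (act (q1 \<otimes> q2) v) \<partial>\<mu>V)"
    using nn_integral_act[OF _ ind, of "q1 \<otimes> q2"] q A by simp
  also have "\<dots> = (\<integral>\<^sup>+v. indicator A (act q1 (act q2 v)) \<partial>\<mu>V)"
    by (intro nn_integral_cong) (simp add: act_comp q V.space_haar)
  also have "\<dots> = ennreal (1 / modulus \<mu>V act q2) * (ennreal (1 / modulus \<mu>V act q1) * ennreal a)"
    using nn_integral_act[OF q(2) ind1] nn_integral_act[OF q(1) ind] A by simp
  also have "\<dots> = ennreal (1 / (modulus \<mu>V act q1 * modulus \<mu>V act q2)) * ennreal a"
    using modulus_pos[OF q(1)] modulus_pos[OF q(2)] A by (simp add: ennreal_mult[symmetric])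
  finally have "1 / modulus \<mu>V act (q1 \<otimes> q2) = 1 / (modulus \<mu>V act q1 * modulus \<mu>V act q2)"
    using modulus_pos[OF q(1)] modulus_pos[OF q(2)] modulus_pos[of "q1 \<otimes> q2"] q A
    by (intro ennreal_real_mult_right_cancel[of _ a]) auto
  then show ?thesis by simp
qed

lemma modulus_inv:
  assumes q: "q \<in> carrier Q"
  shows "modulus \<mu>V act (inv q) = 1 / modulus \<mu>V act q"
proof -
  have 1: "modulus \<mu>V act \<one> = 1"
    using modulus_mult[of "\<one>" "\<one>"] modulus_pos[of "\<one>"] by simp
  then show ?thesis
    using modulus_mult[of q "inv q"] modulus_pos[OF q] q by (simp add: field_simps)
qed

text \<open>For a fixed test set \<open>A\<close> of measure \<open>a\<close>, the modulus is
  \<open>a\<close> divided by the measure of the preimage of \<open>A\<close> under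
  \<open>act q\<close>; joint measurability of the action makes that measure a measurable function
  of \<open>q\<close>.\<close>

lemma measurable_modulus: "modulus \<mu>V act \<in> borel_measurable \<mu>Q"
proof -
  interpret VS: sigma_finite_measure \<mu>V by (rule V.sigma_finite)
  obtain A a where A: "A \<in> sets \<mu>V" "0 < a" "emeasure \<mu>V A = ennreal a"
    by (rule V.finite_positive_set)
  have ind: "(indicator A :: 'v \<Rightarrow> ennreal) \<in> borel_measurable \<mu>V" using A(1) by simp
  have "(\<lambda>p. indicator A (act (fst p) (snd p)) :: ennreal) \<in> borel_measurable (\<mu>Q \<Otimes>\<^sub>M \<mu>V)"
    by (rule measurable_compose[OF measurable_act[OF measurable_fst measurable_snd] ind])
  then have m: "(\<lambda>q. \<integral>\<^sup>+v. indicator A (act q v) \<partial>\<mu>V) \<in> borel_measurable \<mu>Q"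
    by (intro VS.borel_measurable_nn_integral) (simp add: case_prod_beta')
  have "modulus \<mu>V act q = a / enn2real (\<integral>\<^sup>+v. indicator A (act q v) \<partial>\<mu>V)" if "q \<in> space \<mu>Q" for q
  proof -
    have q: "q \<in> carrier Q" using that by (simp add: Q.space_haar)
    have "(\<integral>\<^sup>+v. indicator A (act q v) \<partial>\<mu>V) = ennreal (a / modulus \<mu>V act q)"
      using nn_integral_act[OF q ind] modulus_pos[OF q] A by (simp add: ennreal_mult[symmetric])
    then show ?thesis using modulus_pos[OF q] A by simp
  qed
  moreover have "(\<lambda>q. a / enn2real (\<integral>\<^sup>+v. indicator A (act q v) \<partial>\<mu>V)) \<in> borel_measurable \<mu>Q"
    using m by measurable
  ultimately show ?thesis using measurable_cong[of \<mu>Q "modulus \<mu>V act"] by simp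
qed

end

section \<open>Square-integrable functions\<close>

lemma borel_measurable_cnj [measurable]: "cnj \<in> borel_measurable borel"
  by (intro borel_measurable_continuous_onI continuous_intros)

lemma L2_measurable: "f \<in> L2 M \<Longrightarrow> f \<in> borel_measurable M"
  and L2_integrable: "f \<in> L2 M \<Longrightarrow> integrable M (\<lambda>x. (cmod (f x))\<^sup>2)"
  by (auto simp: L2_def)

lemma L2_iff_nn_integral:
  "f \<in> L2 M \<longleftrightarrow> f \<in> borel_measurable M \<and> (\<integral>\<^sup>+x. ennreal ((cmod (f x))\<^sup>2) \<partial>M) < \<infinity>"
proof -
  have "integrable M (\<lambda>x. (cmod (f x))\<^sup>2) \<longleftrightarrow> (\<integral>\<^sup>+x. ennreal ((cmod (f x))\<^sup>2) \<partial>M) < \<infinity>"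
    if [measurable]: "f \<in> borel_measurable M"
    unfolding integrable_iff_bounded by simp
  then show ?thesis by (auto simp: L2_def)
qed

lemma nn_integral_L2_norm:
  "f \<in> L2 M \<Longrightarrow> (\<integral>\<^sup>+x. ennreal ((cmod (f x))\<^sup>2) \<partial>M) = ennreal ((L2_norm M f)\<^sup>2)"
  unfolding L2_norm_square by (rule nn_integral_eq_integral) (auto simp: L2_def)

lemma nn_integral_not_L2:
  "f \<in> borel_measurable M \<Longrightarrow> f \<notin> L2 M \<Longrightarrow> (\<integral>\<^sup>+x. ennreal ((cmod (f x))\<^sup>2) \<partial>M) = \<infinity>"
  by (simp add: L2_iff_nn_integral less_top[symmetric])

lemma L2_inner_self: "L2_inner M f f = complex_of_real ((L2_norm M f)\<^sup>2)"
  unfolding L2_inner_def L2_norm_square integral_complex_of_real[symmetric]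
  by (intro Bochner_Integration.integral_cong refl) (simp only: complex_norm_square)

lemma L2_norm_nonneg: "0 \<le> L2_norm M f"
  by (simp add: L2_norm_def)

lemma L2_norm_eq_0:
  assumes "f \<in> L2 M"
  shows "L2_norm M f = 0 \<longleftrightarrow> L2_eq M f (\<lambda>_. 0)"
proof -
  have "L2_norm M f = 0 \<longleftrightarrow> (\<integral>x. (cmod (f x))\<^sup>2 \<partial>M) = 0"
    by (simp add: L2_norm_def)
  also have "\<dots> \<longleftrightarrow> (AE x in M. (cmod (f x))\<^sup>2 = 0)"
    by (rule integral_nonneg_eq_0_iff_AE) (use assms in \<open>auto simp: L2_def\<close>)
  finally show ?thesis by (simp add: L2_eq_def)
qed

lemma cmod_add_square_le: "(cmod (a + b))\<^sup>2 \<le> 2 * (cmod a)\<^sup>2 + 2 * (cmod b)\<^sup>2"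
proof -
  have "(cmod (a + b))\<^sup>2 \<le> (cmod a + cmod b)\<^sup>2"
    by (intro power_mono norm_triangle_ineq) simp
  also have "\<dots> \<le> 2 * (cmod a)\<^sup>2 + 2 * (cmod b)\<^sup>2"
    using zero_le_power2[of "cmod a - cmod b"] by (simp add: power2_eq_square algebra_simps)
  finally show ?thesis .
qed

lemma L2_combination:
  assumes "f \<in> L2 M" "g \<in> L2 M"
  shows "(\<lambda>x. a * f x + b * g x) \<in> L2 M"
proof -
  have [measurable]: "f \<in> borel_measurable M" "g \<in> borel_measurable M"
    using assms by (auto simp: L2_def)
  have "integrable M (\<lambda>x. 2 * ((cmod a)\<^sup>2 * (cmod (f x))\<^sup>2) + 2 * ((cmod b)\<^sup>2 * (cmod (g x))\<^sup>2))"
    using assms by (auto simp: L2_def)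
  then have "integrable M (\<lambda>x. (cmod (a * f x + b * g x))\<^sup>2)"
  proof (rule Bochner_Integration.integrable_bound)
    show "AE x in M. norm ((cmod (a * f x + b * g x))\<^sup>2)
        \<le> norm (2 * ((cmod a)\<^sup>2 * (cmod (f x))\<^sup>2) + 2 * ((cmod b)\<^sup>2 * (cmod (g x))\<^sup>2))"
      using cmod_add_square_le[of "a * f _" "b * g _"]
      by (simp add: norm_mult power_mult_distrib)
  qed measurable
  then show ?thesis by (simp add: L2_def)
qed

lemma L2_diff: "f \<in> L2 M \<Longrightarrow> g \<in> L2 M \<Longrightarrow> (\<lambda>x. f x - g x) \<in> L2 M"
  using L2_combination[of f M g 1 "-1"] by simp

lemma L2_mult_bounded:
  assumes f: "f \<in> L2 M" and h: "h \<in> borel_measurable M" and le: "\<And>x. x \<in> space M \<Longrightarrow> cmod (h x) \<le> C"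
  shows "(\<lambda>x. h x * f x) \<in> L2 M"
proof -
  note [measurable] = h L2_measurable[OF f]
  have "integrable M (\<lambda>x. C\<^sup>2 * (cmod (f x))\<^sup>2)" using f by (auto simp: L2_def)
  then have "integrable M (\<lambda>x. (cmod (h x * f x))\<^sup>2)"
  proof (rule Bochner_Integration.integrable_bound)
    show "AE x in M. norm ((cmod (h x * f x))\<^sup>2) \<le> norm (C\<^sup>2 * (cmod (f x))\<^sup>2)"
    proof (rule AE_I2)
      fix x assume "x \<in> space M"
      then have "(cmod (h x))\<^sup>2 \<le> C\<^sup>2" using le by (intro power_mono) auto
      then show "norm ((cmod (h x * f x))\<^sup>2) \<le> norm (C\<^sup>2 * (cmod (f x))\<^sup>2)"
        by (simp add: norm_mult power_mult_distrib mult_right_mono)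
    qed
  qed measurable
  then show ?thesis by (simp add: L2_def)
qed

lemma L2_cong_AE:
  assumes "f \<in> L2 M" "g \<in> borel_measurable M" "AE x in M. f x = g x"
  shows "g \<in> L2 M"
proof -
  have "(\<integral>\<^sup>+x. ennreal ((cmod (g x))\<^sup>2) \<partial>M) = (\<integral>\<^sup>+x. ennreal ((cmod (f x))\<^sup>2) \<partial>M)"
    using assms(3) by (intro nn_integral_cong_AE) auto
  then show ?thesis using assms by (simp add: L2_iff_nn_integral)
qed

section \<open>Truncation and approximation in L2\<close>

text \<open>These functions lie in both L1 and L2, which is where the Fourier transform is given by
  its integral.\<close>

lemma L2_bounded_finite_support:
  assumes A: "A \<in> sets M" "emeasure M A < \<infinity>" and f: "f \<in> borel_measurable M"
    and le: "\<And>x. x \<in> A \<Longrightarrow> cmod (f x) \<le> C"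
  shows "(\<lambda>x. indicator A x * f x) \<in> L2 M" "integrable M (\<lambda>x. indicator A x * f x)"
proof -
  note [measurable] = A(1) f
  have I: "integrable M (\<lambda>x. indicator A x * D :: real)" for D
    using A by (intro integrable_mult_left) (simp add: integrable_indicator_iff)
  show "integrable M (\<lambda>x. indicator A x * f x)"
    using I[of C]
  proof (rule Bochner_Integration.integrable_bound)
    show "AE x in M. norm (indicator A x * f x) \<le> norm (indicator A x * C)"
      using le by (intro AE_I2) (force simp: indicator_def)
  qed measurable
  have "integrable M (\<lambda>x. (cmod (indicator A x * f x))\<^sup>2)"
    using I[of "C\<^sup>2"]
  proof (rule Bochner_Integration.integrable_bound)
    show "AE x in M. norm ((cmod (indicator A x * f x))\<^sup>2) \<le> norm (indicator A x * C\<^sup>2)"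
      using le by (intro AE_I2) (auto simp: indicator_def power_mono)
  qed measurable
  then show "(\<lambda>x. indicator A x * f x) \<in> L2 M" by (simp add: L2_def)
qed

text \<open>A finite-measure exhaustion is intersected with the sublevel sets of \<open>|f|\<close>.
  Every measurable \<open>f\<close>, integrable or not, becomes a function in L1 and L2 when cut off
  to such a set.\<close>

lemma (in sigma_finite_measure) truncation_sets:
  fixes f :: "'a \<Rightarrow> complex"
  assumes f [measurable]: "f \<in> borel_measurable M"
  obtains A :: "nat \<Rightarrow> 'a set" where "\<And>n. A n \<in> sets M" "\<And>n. emeasure M (A n) < \<infinity>" "incseq A"
    "(\<Union>n. A n) = space M" "\<And>n x. x \<in> A n \<Longrightarrow> cmod (f x) \<le> real n"
proof -
  obtain B :: "nat \<Rightarrow> 'a set" where B: "range B \<subseteq> sets M" "(\<Union>i. B i) = space M"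
    "\<And>i. emeasure M (B i) \<noteq> \<infinity>" "incseq B"
    using sigma_finite_incseq by metis
  have [measurable]: "B n \<in> sets M" for n using B(1) by auto
  define A where "A n = {x \<in> space M. x \<in> B n \<and> cmod (f x) \<le> real n}" for n
  show thesis
  proof (rule that[of A])
    show m: "A n \<in> sets M" for n unfolding A_def by measurable
    have "emeasure M (A n) \<le> emeasure M (B n)" for n
      by (intro emeasure_mono) (auto simp: A_def)
    then show "emeasure M (A n) < \<infinity>" for n
      using B(3)[of n] by (simp add: less_top) (metis less_top order.strict_trans1 infinity_ennreal_def)
    show "incseq A"
    proof (rule monoI)
      fix m n :: nat assume "m \<le> n"
      then have "B m \<subseteq> B n" "real m \<le> real n" using B(4) by (auto simp: incseq_def)
      then show "A m \<subseteq> A n" unfolding A_def by auto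
    qed
    show "(\<Union>n. A n) = space M"
    proof (intro equalityI subsetI)
      fix x assume x: "x \<in> space M"
      then obtain i where i: "x \<in> B i" using B(2) by auto
      obtain j where j: "cmod (f x) \<le> real j" using real_arch_simple by blast
      have "B i \<subseteq> B (max i j)" using B(4) by (simp add: incseq_def)
      then have "x \<in> B (max i j)" using i by auto
      moreover have "cmod (f x) \<le> real (max i j)" using j by auto
      ultimately show "x \<in> (\<Union>n. A n)" using x by (auto simp: A_def)
    qed (auto simp: A_def)
    show "x \<in> A n \<Longrightarrow> cmod (f x) \<le> real n" for n x by (simp add: A_def)
  qed
qed

lemma L2_restriction_tendsto:
  assumes f: "f \<in> L2 M" and A: "\<And>n. A n \<in> sets M" "incseq A" "(\<Union>n. A n) = space M"
  shows "(\<lambda>n. L2_norm M (\<lambda>x. f x - indicator (A n) x * f x)) \<longlonglongrightarrow> 0"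
proof -
  note [measurable] = L2_measurable[OF f] A(1)
  have "(\<lambda>n. \<integral>x. (cmod (f x - indicator (A n) x * f x))\<^sup>2 \<partial>M) \<longlonglongrightarrow> (\<integral>x. 0 \<partial>M)"
  proof (rule integral_dominated_convergence[where w = "\<lambda>x. (cmod (f x))\<^sup>2"])
    show "integrable M (\<lambda>x. (cmod (f x))\<^sup>2)" by (rule L2_integrable[OF f])
    show "AE x in M. (\<lambda>n. (cmod (f x - indicator (A n) x * f x))\<^sup>2) \<longlonglongrightarrow> 0"
    proof (rule AE_I2)
      fix x assume "x \<in> space M"
      then obtain N where N: "x \<in> A N" using A(3) by auto
      have "(cmod (f x - indicator (A n) x * f x))\<^sup>2 = 0" if "N \<le> n" for n
        using N A(2) that by (auto simp: incseq_def indicator_def)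
      then show "(\<lambda>n. (cmod (f x - indicator (A n) x * f x))\<^sup>2) \<longlonglongrightarrow> 0"
        by (intro tendsto_eventually) (auto simp: eventually_sequentially)
    qed
    show "AE x in M. norm ((cmod (f x - indicator (A n) x * f x))\<^sup>2) \<le> (cmod (f x))\<^sup>2" for n
      by (intro AE_I2) (auto simp: indicator_def)
  qed measurable
  then have "(\<lambda>n. sqrt (\<integral>x. (cmod (f x - indicator (A n) x * f x))\<^sup>2 \<partial>M)) \<longlonglongrightarrow> sqrt (\<integral>x. 0 \<partial>M)"
    by (rule tendsto_real_sqrt)
  then show ?thesis by (simp add: L2_norm_def)
qed

text \<open>The squared differences tend to 0 in L1, so a subsequence of them tends to 0 almost
  everywhere. Pointwise limits are what dominated convergence consumes later.\<close>

lemma L2_tendsto_AE_subseq: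
  assumes f: "\<And>n. f n \<in> L2 M" and g: "g \<in> L2 M"
    and lim: "(\<lambda>n. L2_norm M (\<lambda>x. f n x - g x)) \<longlonglongrightarrow> 0"
  obtains r :: "nat \<Rightarrow> nat" where "strict_mono r" "AE x in M. (\<lambda>n. f (r n) x) \<longlonglongrightarrow> g x"
proof -
  have 1: "integrable M (\<lambda>x. (cmod (f n x - g x))\<^sup>2)" for n
    by (rule L2_integrable[OF L2_diff[OF f g]])
  have "(\<lambda>n. (L2_norm M (\<lambda>x. f n x - g x))\<^sup>2) \<longlonglongrightarrow> 0\<^sup>2" by (intro tendsto_power lim)
  then have "(\<lambda>n. \<integral>x. norm ((cmod (f n x - g x))\<^sup>2) \<partial>M) \<longlonglongrightarrow> 0"
    by (simp add: L2_norm_square)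
  from tendsto_L1_AE_subseq[OF 1 this]
  obtain r where r: "strict_mono r" "AE x in M. (\<lambda>n. (cmod (f (r n) x - g x))\<^sup>2) \<longlonglongrightarrow> 0" by auto
  from r(2) have "AE x in M. (\<lambda>n. f (r n) x) \<longlonglongrightarrow> g x"
  proof eventually_elim
    case (elim x)
    then have "(\<lambda>n. sqrt ((cmod (f (r n) x - g x))\<^sup>2)) \<longlonglongrightarrow> sqrt 0" by (rule tendsto_real_sqrt)
    then show ?case by (simp add: tendsto_norm_zero_iff LIM_zero_iff)
  qed
  with r(1) show thesis by (rule that)
qed

section \<open>Plancherel's formula for integrable functions\<close>

text \<open>The kernel \<open>e\<close> plays the part of the pairing \<open>e\<^bsup>i\<langle>\<xi>,v\<rangle>\<^esup>\<close>, with \<open>\<xi>\<close> ranging over any measure space.\<close>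

locale fourier_kernel = N: sigma_finite_measure \<nu> + M: sigma_finite_measure \<mu>
  for \<nu> :: "'x measure" and \<mu> :: "'v measure" +
  fixes e :: "'x \<Rightarrow> 'v \<Rightarrow> complex" and F :: "('v \<Rightarrow> complex) \<Rightarrow> ('x \<Rightarrow> complex)"
  assumes kernel_measurable: "(\<lambda>p. e (fst p) (snd p)) \<in> borel_measurable (\<nu> \<Otimes>\<^sub>M \<mu>)"
    and kernel_norm: "\<And>x v. x \<in> space \<nu> \<Longrightarrow> v \<in> space \<mu> \<Longrightarrow> cmod (e x v) = 1"
    and kernel_mult: "\<And>v w. v \<in> space \<mu> \<Longrightarrow> w \<in> space \<mu> \<Longrightarrow>
      \<exists>u\<in>space \<mu>. \<forall>x\<in>space \<nu>. e x u = e x v * e x w"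
    and kernel_cnj: "\<And>v. v \<in> space \<mu> \<Longrightarrow> \<exists>u\<in>space \<mu>. \<forall>x\<in>space \<nu>. e x u = cnj (e x v)"
    and kernel_translate: "\<And>v f. v \<in> space \<mu> \<Longrightarrow> f \<in> L2 \<mu> \<Longrightarrow> integrable \<mu> f \<Longrightarrow>
      \<exists>f'\<in>L2 \<mu>. integrable \<mu> f' \<and>
        (\<forall>x\<in>space \<nu>. (\<integral>w. cnj (e x w) * f' w \<partial>\<mu>) = e x v * (\<integral>w. cnj (e x w) * f w \<partial>\<mu>))"
    and F_unitary: "L2_unitary \<mu> \<nu> F"
    and F_integrable: "\<And>f. f \<in> L2 \<mu> \<Longrightarrow> integrable \<mu> f \<Longrightarrow>
      L2_eq \<nu> (F f) (\<lambda>x. \<integral>v. cnj (e x v) * f v \<partial>\<mu>)"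
    and space_nonempty: "space \<mu> \<noteq> {}"
begin

sublocale P: pair_sigma_finite \<nu> \<mu> ..

definition ft :: "('v \<Rightarrow> complex) \<Rightarrow> 'x \<Rightarrow> complex" where
  "ft f x = (\<integral>v. cnj (e x v) * f v \<partial>\<mu>)"

definition ift :: "('x \<Rightarrow> complex) \<Rightarrow> 'v \<Rightarrow> complex" where
  "ift k v = (\<integral>x. k x * e x v \<partial>\<nu>)"

lemma measurable_kernel [measurable (raw)]:
  assumes "f \<in> L \<rightarrow>\<^sub>M \<nu>" "g \<in> L \<rightarrow>\<^sub>M \<mu>"
  shows "(\<lambda>p. e (f p) (g p)) \<in> borel_measurable L"
  using measurable_compose[OF measurable_Pair[OF assms] kernel_measurable] by simp

lemma ft_measurable [measurable]:
  assumes [measurable]: "f \<in> borel_measurable \<mu>"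
  shows "ft f \<in> borel_measurable \<nu>"
proof -
  have "(\<lambda>x. \<integral>v. cnj (e x v) * f v \<partial>\<mu>) \<in> borel_measurable \<nu>" by measurable
  then show ?thesis by (simp add: ft_def[abs_def])
qed

lemma ift_measurable [measurable]:
  assumes [measurable]: "k \<in> borel_measurable \<nu>"
  shows "ift k \<in> borel_measurable \<mu>"
proof -
  have "(\<lambda>v. \<integral>x. k x * e x v \<partial>\<nu>) \<in> borel_measurable \<mu>" by measurable
  then show ?thesis by (simp add: ift_def[abs_def])
qed

section \<open>Duality between the transform and its inverse\<close>

lemma ft_bounded:
  assumes "integrable \<mu> f" "x \<in> space \<nu>"
  shows "cmod (ft f x) \<le> (\<integral>v. cmod (f v) \<partial>\<mu>)"
proof -
  have "cmod (ft f x) \<le> (\<integral>v. cmod (cnj (e x v) * f v) \<partial>\<mu>)"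
    unfolding ft_def by (rule integral_norm_bound)
  also have "\<dots> = (\<integral>v. cmod (f v) \<partial>\<mu>)"
    using assms(2) kernel_norm by (intro Bochner_Integration.integral_cong) (auto simp: norm_mult)
  finally show ?thesis .
qed

text \<open>Since \<open>g\<close> is bounded by 1, the product \<open>|k(x)| |f(v)|\<close>
  dominates the double integrand and Fubini applies. The kernel is left general because both
  \<open>e\<close> and its conjugate are inserted for it.\<close>

lemma integral_swap:
  assumes k: "integrable \<nu> k" and f: "integrable \<mu> f"
    and g: "(\<lambda>p. g (fst p) (snd p)) \<in> borel_measurable (\<nu> \<Otimes>\<^sub>M \<mu>)"
    and g1: "\<And>x v. x \<in> space \<nu> \<Longrightarrow> v \<in> space \<mu> \<Longrightarrow> cmod (g x v) \<le> 1"
  shows "(\<integral>v. f v * (\<integral>x. k x * g x v \<partial>\<nu>) \<partial>\<mu>) = (\<integral>x. k x * (\<integral>v. g x v * f v \<partial>\<mu>) \<partial>\<nu>)"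
proof -
  note [measurable] = borel_measurable_integrable[OF k] borel_measurable_integrable[OF f]
  have [measurable]: "(\<lambda>p. g (a p) (b p)) \<in> borel_measurable L"
    if "a \<in> L \<rightarrow>\<^sub>M \<nu>" "b \<in> L \<rightarrow>\<^sub>M \<mu>" for a b and L :: "'z measure"
    using measurable_compose[OF measurable_Pair[OF that] g] by simp
  have meas: "(\<lambda>p. k (fst p) * f (snd p) * g (fst p) (snd p)) \<in> borel_measurable (\<nu> \<Otimes>\<^sub>M \<mu>)"
    by measurable
  have int: "integrable (\<nu> \<Otimes>\<^sub>M \<mu>) (\<lambda>p. k (fst p) * f (snd p) * g (fst p) (snd p))"
  proof (rule Bochner_Integration.integrable_bound)
    have "integrable (\<nu> \<Otimes>\<^sub>M \<mu>) (\<lambda>p. cmod (k (fst p)) * cmod (f (snd p)))"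
    proof (rule P.Fubini_integrable)
      show "integrable \<nu> (\<lambda>x. \<integral>v. norm (cmod (k (fst (x, v))) * cmod (f (snd (x, v)))) \<partial>\<mu>)"
        using k by simp
      show "AE x in \<nu>. integrable \<mu> (\<lambda>v. cmod (k (fst (x, v))) * cmod (f (snd (x, v))))"
        using f by simp
    qed measurable
    then show "integrable (\<nu> \<Otimes>\<^sub>M \<mu>) (\<lambda>p. cmod (k (fst p)) * cmod (f (snd p)))" .
    show "AE p in \<nu> \<Otimes>\<^sub>M \<mu>. norm (k (fst p) * f (snd p) * g (fst p) (snd p))
        \<le> norm (cmod (k (fst p)) * cmod (f (snd p)))"
    proof (rule AE_I2)
      fix p assume "p \<in> space (\<nu> \<Otimes>\<^sub>M \<mu>)"
      then have "cmod (g (fst p) (snd p)) \<le> 1" by (intro g1) (auto simp: space_pair_measure)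
      then show "norm (k (fst p) * f (snd p) * g (fst p) (snd p))
          \<le> norm (cmod (k (fst p)) * cmod (f (snd p)))"
        by (simp add: norm_mult mult_left_le)
    qed
  qed (rule meas)
  have "(\<integral>v. f v * (\<integral>x. k x * g x v \<partial>\<nu>) \<partial>\<mu>) = (\<integral>v. (\<integral>x. k x * f v * g x v \<partial>\<nu>) \<partial>\<mu>)"
    by (simp add: integral_mult_right_zero[symmetric] mult_ac del: integral_mult_right_zero)
  also have "\<dots> = (\<integral>x. (\<integral>v. k x * f v * g x v \<partial>\<mu>) \<partial>\<nu>)"
    using int by (intro P.Fubini_integral) (simp add: case_prod_beta')
  also have "\<dots> = (\<integral>x. k x * (\<integral>v. g x v * f v \<partial>\<mu>) \<partial>\<nu>)"
    by (simp add: integral_mult_right_zero[symmetric] mult_ac del: integral_mult_right_zero)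
  finally show ?thesis .
qed

text \<open>\<open>ift\<close> is the formal adjoint of \<open>ft\<close>: for two integrable
  functions this needs only Fubini, no L2 theory.\<close>

lemma integral_cnj_ift:
  assumes k: "integrable \<nu> k" and f: "integrable \<mu> f"
  shows "(\<integral>v. f v * cnj (ift k v) \<partial>\<mu>) = (\<integral>x. ft f x * cnj (k x) \<partial>\<nu>)"
proof -
  have m: "(\<lambda>p. cnj (e (fst p) (snd p))) \<in> borel_measurable (\<nu> \<Otimes>\<^sub>M \<mu>)" by measurable
  have "(\<integral>v. f v * cnj (ift k v) \<partial>\<mu>) = (\<integral>v. f v * (\<integral>x. cnj (k x) * cnj (e x v) \<partial>\<nu>) \<partial>\<mu>)"
    by (simp add: ift_def flip: complex_cnj_mult)
  also have "\<dots> = (\<integral>x. cnj (k x) * (\<integral>v. cnj (e x v) * f v \<partial>\<mu>) \<partial>\<nu>)"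
    using k f by (intro integral_swap m) (auto simp: kernel_norm)
  finally show ?thesis by (simp add: ft_def mult.commute)
qed

lemma F_L2: "f \<in> L2 \<mu> \<Longrightarrow> F f \<in> L2 \<nu>"
  and F_inner: "f \<in> L2 \<mu> \<Longrightarrow> g \<in> L2 \<mu> \<Longrightarrow> L2_inner \<nu> (F f) (F g) = L2_inner \<mu> f g"
  and F_surj: "h \<in> L2 \<nu> \<Longrightarrow> \<exists>f\<in>L2 \<mu>. L2_eq \<nu> (F f) h"
  and F_combination: "f \<in> L2 \<mu> \<Longrightarrow> g \<in> L2 \<mu> \<Longrightarrow>
    L2_eq \<nu> (F (\<lambda>x. a * f x + b * g x)) (\<lambda>y. a * F f y + b * F g y)"
  using F_unitary unfolding L2_unitary_def by blast+

lemma F_norm: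
  assumes "f \<in> L2 \<mu>"
  shows "L2_norm \<nu> (F f) = L2_norm \<mu> f"
proof -
  have "(L2_norm \<nu> (F f))\<^sup>2 = (L2_norm \<mu> f)\<^sup>2"
    using F_inner[OF assms assms] unfolding L2_inner_self of_real_eq_iff .
  then show ?thesis by (simp add: power2_eq_iff_nonneg[OF L2_norm_nonneg L2_norm_nonneg])
qed

lemma ft_eq_F: "f \<in> L2 \<mu> \<Longrightarrow> integrable \<mu> f \<Longrightarrow> AE x in \<nu>. F f x = ft f x"
  using F_integrable by (simp add: L2_eq_def ft_def)

lemma ft_L2: "f \<in> L2 \<mu> \<Longrightarrow> integrable \<mu> f \<Longrightarrow> ft f \<in> L2 \<nu>"
  by (rule L2_cong_AE[OF F_L2 _ ft_eq_F]) auto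

text \<open>Surjectivity of \<open>F\<close> provides an \<open>f\<close> with
  \<open>F f = h\<close>. Its truncations lie in L1 and L2, where \<open>F\<close> coincides with
  \<open>ft\<close>, and they converge to \<open>f\<close> in L2; the isometry carries this over to
  \<open>h\<close>, and a subsequence converges almost everywhere.\<close>

lemma ft_approximation:
  assumes h: "h \<in> L2 \<nu>"
  obtains u where "\<And>n. u n \<in> L2 \<mu>" "\<And>n :: nat. integrable \<mu> (u n)"
    "AE x in \<nu>. (\<lambda>n. ft (u n) x) \<longlonglongrightarrow> h x"
proof -
  obtain f where f: "f \<in> L2 \<mu>" "AE x in \<nu>. F f x = h x"
    using F_surj[OF h] by (auto simp: L2_eq_def)
  note [measurable] = L2_measurable[OF f(1)]
  obtain A where A: "\<And>n. A n \<in> sets \<mu>" "\<And>n. emeasure \<mu> (A n) < \<infinity>" "incseq A"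
    "(\<Union>n. A n) = space \<mu>" "\<And>n x. x \<in> A n \<Longrightarrow> cmod (f x) \<le> real n"
    using M.truncation_sets[OF L2_measurable[OF f(1)]] by metis
  define g where "g n x = indicator (A n) x * f x" for n x
  have g: "g n \<in> L2 \<mu>" "integrable \<mu> (g n)" for n
    unfolding g_def using L2_bounded_finite_support[OF A(1,2) L2_measurable[OF f(1)] A(5)] by auto
  have eq: "L2_norm \<nu> (\<lambda>x. ft (g n) x - h x) = L2_norm \<mu> (\<lambda>x. f x - g n x)" for n
  proof -
    have 1: "(\<lambda>x. f x - g n x) \<in> L2 \<mu>" by (rule L2_diff[OF f(1) g(1)])
    have "AE x in \<nu>. F (\<lambda>x. 1 * f x + (-1) * g n x) x = 1 * F f x + (-1) * F (g n) x"
      using F_combination[OF f(1) g(1)] unfolding L2_eq_def .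
    then have AE: "AE x in \<nu>. (cmod (ft (g n) x - h x))\<^sup>2 = (cmod (F (\<lambda>x. f x - g n x) x))\<^sup>2"
      using ft_eq_F[OF g, of n] f(2) by eventually_elim (simp add: norm_minus_commute)
    note [measurable] = L2_measurable[OF F_L2[OF 1]] L2_measurable[OF h] L2_measurable[OF g(1)[of n]]
    have "L2_norm \<nu> (\<lambda>x. ft (g n) x - h x) = L2_norm \<nu> (F (\<lambda>x. f x - g n x))"
      unfolding L2_norm_def using AE
      by (intro arg_cong[where f = sqrt] integral_cong_AE) measurable
    then show ?thesis using F_norm[OF 1] by simp
  qed
  have "(\<lambda>n. L2_norm \<nu> (\<lambda>x. ft (g n) x - h x)) \<longlonglongrightarrow> 0"
    unfolding eq unfolding g_def by (rule L2_restriction_tendsto[OF f(1) A(1,3,4)])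
  from L2_tendsto_AE_subseq[OF ft_L2[OF g] h this] obtain r :: "nat \<Rightarrow> nat" where
    r: "AE x in \<nu>. (\<lambda>n. ft (g (r n)) x) \<longlonglongrightarrow> h x" by metis
  show thesis by (rule that[of "\<lambda>n. g (r n)", OF g r])
qed

section \<open>Injectivity of the inverse transform on L1\<close>

text \<open>The set of \<open>k \<in> L\<^sup>1\<close> with vanishing inverse transform is stable under multiplication by Fourier
  transforms, hence by \<open>exp (- |ft u|\<^sup>2)\<close>.  The functions \<open>|ft u|\<^sup>2\<close> approximate indicators.\<close>

definition null_ift :: "('x \<Rightarrow> complex) set" where
  "null_ift = {k. integrable \<nu> k \<and> (\<forall>v\<in>space \<mu>. ift k v = 0)}"

text \<open>Products and conjugates of the functions \<open>e _ v\<close> are again functions of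
  this kind, so both integrals are values of \<open>ift k\<close> at suitable points.\<close>

lemma null_ift_mult_kernel:
  assumes k: "k \<in> null_ift" and w: "w \<in> space \<mu>" and v: "v \<in> space \<mu>"
  shows "(\<integral>x. k x * e x w * cnj (e x v) \<partial>\<nu>) = 0" "(\<integral>x. k x * e x w * e x v \<partial>\<nu>) = 0"
proof -
  obtain u where u: "u \<in> space \<mu>" "\<And>x. x \<in> space \<nu> \<Longrightarrow> e x u = e x w * e x v"
    using kernel_mult[OF w v] by auto
  have "(\<integral>x. k x * e x w * e x v \<partial>\<nu>) = ift k u"
    unfolding ift_def using u(2) by (intro Bochner_Integration.integral_cong refl) (simp add: mult.assoc)
  then show "(\<integral>x. k x * e x w * e x v \<partial>\<nu>) = 0" using k u(1) by (simp add: null_ift_def)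
  obtain v' where v': "v' \<in> space \<mu>" "\<And>x. x \<in> space \<nu> \<Longrightarrow> e x v' = cnj (e x v)"
    using kernel_cnj[OF v] by auto
  obtain u' where u': "u' \<in> space \<mu>" "\<And>x. x \<in> space \<nu> \<Longrightarrow> e x u' = e x w * e x v'"
    using kernel_mult[OF w v'(1)] by auto
  have "(\<integral>x. k x * e x w * cnj (e x v) \<partial>\<nu>) = ift k u'"
    unfolding ift_def using u'(2) v'(2)
    by (intro Bochner_Integration.integral_cong refl) (simp add: mult.assoc)
  then show "(\<integral>x. k x * e x w * cnj (e x v) \<partial>\<nu>) = 0" using k u'(1) by (simp add: null_ift_def)
qed

lemma integrable_mult_bounded:
  fixes k m :: "'x \<Rightarrow> complex"
  assumes "integrable \<nu> k" "m \<in> borel_measurable \<nu>" "\<And>x. x \<in> space \<nu> \<Longrightarrow> cmod (m x) \<le> C"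
  shows "integrable \<nu> (\<lambda>x. k x * m x)"
proof (rule Bochner_Integration.integrable_bound)
  note [measurable] = borel_measurable_integrable[OF assms(1)] assms(2)
  show "integrable \<nu> (\<lambda>x. C * cmod (k x))" using assms(1) by auto
  show "AE x in \<nu>. norm (k x * m x) \<le> norm (C * cmod (k x))"
  proof (rule AE_I2)
    fix x assume "x \<in> space \<nu>"
    then have "cmod (m x) \<le> \<bar>C\<bar>" using assms(3) by force
    then show "norm (k x * m x) \<le> norm (C * cmod (k x))"
      using mult_left_mono[of "cmod (m x)" "\<bar>C\<bar>" "cmod (k x)"]
      by (simp add: norm_mult abs_mult mult.commute)
  qed
  show "(\<lambda>x. k x * m x) \<in> borel_measurable \<nu>" by measurable
qed

lemma null_ift_integrable: "k \<in> null_ift \<Longrightarrow> integrable \<nu> k"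
  by (simp add: null_ift_def)

text \<open>Writing the transform as an integral over \<open>v\<close> and exchanging the integrals
  leaves inner integrals that vanish by \<open>null_ift_mult_kernel\<close>. The conjugate version
  is there to produce \<open>|ft f|^2\<close> from two multiplications.\<close>

lemma null_ift_mult_ft:
  assumes k: "k \<in> null_ift" and f: "integrable \<mu> f"
  shows "(\<lambda>x. k x * ft f x) \<in> null_ift" "(\<lambda>x. k x * cnj (ft f x)) \<in> null_ift"
proof -
  note [measurable] = borel_measurable_integrable[OF f]
    borel_measurable_integrable[OF null_ift_integrable[OF k]]
  have i1: "integrable \<nu> (\<lambda>x. k x * ft f x)" "integrable \<nu> (\<lambda>x. k x * cnj (ft f x))"
    using ft_bounded[OF f]
    by (auto intro!: integrable_mult_bounded[OF null_ift_integrable[OF k]])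
  have ke: "integrable \<nu> (\<lambda>x. k x * e x w)" if "w \<in> space \<mu>" for w
    using that kernel_norm
    by (intro integrable_mult_bounded[OF null_ift_integrable[OF k], where C = 1]) auto
  have "ift (\<lambda>x. k x * ft f x) w = 0" "ift (\<lambda>x. k x * cnj (ft f x)) w = 0" if w: "w \<in> space \<mu>" for w
  proof -
    have "ift (\<lambda>x. k x * ft f x) w = (\<integral>x. k x * e x w * (\<integral>v. cnj (e x v) * f v \<partial>\<mu>) \<partial>\<nu>)"
      unfolding ift_def ft_def by (simp add: mult_ac)
    also have "\<dots> = (\<integral>v. f v * (\<integral>x. k x * e x w * cnj (e x v) \<partial>\<nu>) \<partial>\<mu>)"
      by (rule integral_swap[OF ke[OF w] f, symmetric]) (measurable, simp add: kernel_norm)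
    also have "\<dots> = (\<integral>v. 0 \<partial>\<mu>)"
      using null_ift_mult_kernel(1)[OF k w] by (intro Bochner_Integration.integral_cong) auto
    finally show "ift (\<lambda>x. k x * ft f x) w = 0" by simp
    have cnj_ft: "cnj (\<integral>v. cnj (e x v) * f v \<partial>\<mu>) = (\<integral>v. e x v * cnj (f v) \<partial>\<mu>)" for x
      using Bochner_Integration.integral_cnj[of \<mu> "\<lambda>v. cnj (e x v) * f v"] by simp
    have "ift (\<lambda>x. k x * cnj (ft f x)) w = (\<integral>x. k x * e x w * (\<integral>v. e x v * cnj (f v) \<partial>\<mu>) \<partial>\<nu>)"
      unfolding ift_def ft_def cnj_ft by (simp only: mult_ac)
    also have "\<dots> = (\<integral>v. cnj (f v) * (\<integral>x. k x * e x w * e x v \<partial>\<nu>) \<partial>\<mu>)"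
      using f by (intro integral_swap[OF ke[OF w], symmetric]) (auto simp: kernel_norm)
    also have "\<dots> = (\<integral>v. 0 \<partial>\<mu>)"
      using null_ift_mult_kernel(2)[OF k w] by (intro Bochner_Integration.integral_cong) auto
    finally show "ift (\<lambda>x. k x * cnj (ft f x)) w = 0" by simp
  qed
  with i1 show "(\<lambda>x. k x * ft f x) \<in> null_ift" "(\<lambda>x. k x * cnj (ft f x)) \<in> null_ift"
    by (auto simp: null_ift_def)
qed

lemma null_ift_combination:
  assumes k: "k \<in> null_ift" "l \<in> null_ift"
  shows "(\<lambda>x. k x + c * l x) \<in> null_ift"
proof -
  have i: "integrable \<nu> (\<lambda>x. k x * e x v)" "integrable \<nu> (\<lambda>x. l x * e x v)" if "v \<in> space \<mu>" for v
    using that kernel_norm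
    by (auto intro!: integrable_mult_bounded[OF null_ift_integrable, where C = 1] k)
  have "ift (\<lambda>x. k x + c * l x) v = ift k v + c * ift l v" if "v \<in> space \<mu>" for v
    using i[OF that] unfolding ift_def by (simp add: distrib_right mult.assoc)
  then show ?thesis using k by (auto simp: null_ift_def)
qed

text \<open>The exponential is the limit of \<open>(1 - a/n)^n\<close> with
  \<open>a = |ft f|^2\<close>, and each power stays in \<open>null_ift\<close>. It serves as a
  cutoff: transforms that approximate an indicator converge only almost everywhere, with no common
  bound, whereas \<open>exp (- a)\<close> always lies between 0 and 1.\<close>

lemma null_ift_exp:
  assumes k: "k \<in> null_ift" and f: "integrable \<mu> f"
  shows "(\<lambda>x. k x * complex_of_real (exp (- (cmod (ft f x))\<^sup>2))) \<in> null_ift"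
proof -
  note [measurable] = borel_measurable_integrable[OF f]
    borel_measurable_integrable[OF null_ift_integrable[OF k]]
  define a where "a x = (cmod (ft f x))\<^sup>2" for x
  have [measurable]: "a \<in> borel_measurable \<nu>" unfolding a_def[abs_def] by measurable
  define C where "C = (\<integral>v. cmod (f v) \<partial>\<mu>)\<^sup>2"
  have a: "0 \<le> a x" "a x \<le> C" if "x \<in> space \<nu>" for x
    using ft_bounded[OF f that] unfolding a_def C_def by (auto intro: power_mono)
  \<comment> \<open>Multiplication by \<open>1 - a/m\<close> adds \<open>-1/m\<close> times the
    product with \<open>ft f\<close> and its conjugate, hence stays in
    \<open>null_ift\<close>.\<close>
  have step: "(\<lambda>x. l x * complex_of_real (1 - a x / real m)) \<in> null_ift" if l: "l \<in> null_ift" for l m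
  proof -
    have "(\<lambda>x. l x + (- 1 / of_nat m) * (l x * ft f x * cnj (ft f x))) \<in> null_ift"
      by (intro null_ift_combination l null_ift_mult_ft f)
    moreover have "l x + (- 1 / of_nat m) * (l x * ft f x * cnj (ft f x)) =
        l x * complex_of_real (1 - a x / real m)" for x
      unfolding a_def by (simp add: complex_norm_square[symmetric] algebra_simps mult.assoc)
    ultimately show ?thesis by simp
  qed
  have pow: "(\<lambda>x. k x * complex_of_real ((1 - a x / real m) ^ n)) \<in> null_ift" for m n
  proof (induction n)
    case (Suc n)
    from step[OF this, of m] show ?case by (simp add: mult_ac)
  qed (use k in simp)
  have int: "integrable \<nu> (\<lambda>x. k x * complex_of_real (exp (- a x)))"
    using a(1) by (intro integrable_mult_bounded[OF null_ift_integrable[OF k], where C = 1]) auto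
  have "ift (\<lambda>x. k x * complex_of_real (exp (- a x))) v = 0" if v: "v \<in> space \<mu>" for v
  proof -
    obtain m0 where m0: "C \<le> real m0" using real_arch_simple by blast
    \<comment> \<open>The exponents start beyond \<open>m0\<close>, hence beyond the bound
      \<open>C\<close> of \<open>a\<close>: then \<open>1 - a / N m\<close> lies between -1 and 1
      and \<open>|k|\<close> dominates all terms. The successor keeps the denominator nonzero and
      matches a shift of the sequence by \<open>Suc m0\<close>.\<close>
    define N where "N m = Suc (m + m0)" for m
    define p where "p m x = k x * complex_of_real ((1 - a x / real (N m)) ^ N m) * e x v" for m x
    define l where "l x = k x * complex_of_real (exp (- a x)) * e x v" for x
    have "(\<lambda>m. \<integral>x. p m x \<partial>\<nu>) \<longlonglongrightarrow> (\<integral>x. l x \<partial>\<nu>)"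
    proof (rule integral_dominated_convergence[where w = "\<lambda>x. cmod (k x)"])
      show "integrable \<nu> (\<lambda>x. cmod (k x))" using null_ift_integrable[OF k] by simp
      show "l \<in> borel_measurable \<nu>" "p m \<in> borel_measurable \<nu>" for m
        unfolding l_def[abs_def] p_def[abs_def] using v by measurable
      show "AE x in \<nu>. (\<lambda>m. p m x) \<longlonglongrightarrow> l x"
      proof (rule AE_I2)
        fix x
        have "(\<lambda>n. (1 + (- a x) / real n) ^ n) \<longlonglongrightarrow> exp (- a x)"
          by (rule tendsto_exp_limit_sequentially)
        then have "(\<lambda>m. (1 + (- a x) / real (m + Suc m0)) ^ (m + Suc m0)) \<longlonglongrightarrow> exp (- a x)"
          by (rule LIMSEQ_ignore_initial_segment)
        then have "(\<lambda>m. (1 - a x / real (N m)) ^ N m) \<longlonglongrightarrow> exp (- a x)" by (simp add: N_def)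
        then show "(\<lambda>m. p m x) \<longlonglongrightarrow> l x" unfolding p_def l_def by (intro tendsto_intros)
      qed
      show "AE x in \<nu>. norm (p m x) \<le> cmod (k x)" for m
      proof (rule AE_I2)
        fix x assume x: "x \<in> space \<nu>"
        have "a x \<le> real (N m)" using a(2)[OF x] m0 by (simp add: N_def)
        then have "\<bar>1 - a x / real (N m)\<bar> \<le> 1"
          using a(1)[OF x] by (simp add: abs_le_iff divide_le_eq)
        then have "\<bar>1 - a x / real (N m)\<bar> ^ N m \<le> 1" by (intro power_le_one) auto
        then have "cmod (complex_of_real ((1 - a x / real (N m)) ^ N m)) \<le> 1"
          by (simp only: norm_of_real power_abs)
        then show "norm (p m x) \<le> cmod (k x)"
          using kernel_norm[OF x v] by (simp add: p_def norm_mult mult_left_le del: of_real_power)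
      qed
    qed
    moreover have "(\<integral>x. p m x \<partial>\<nu>) = 0" for m
      using pow[of "N m" "N m"] v by (simp add: null_ift_def ift_def p_def)
    ultimately have "(\<lambda>m::nat. 0) \<longlonglongrightarrow> (\<integral>x. l x \<partial>\<nu>)" by simp
    then show ?thesis unfolding ift_def l_def by (rule LIMSEQ_unique[OF _ tendsto_const])
  qed
  then show ?thesis using int by (simp add: null_ift_def a_def)
qed

text \<open>The hypothesis is tested on the part of \<open>A n\<close> where \<open>Re (c h)\<close>
  is positive, a set of finite measure; the integral of a positive function there can vanish only if
  that set is null. Only sets of finite measure appear because only their indicators belong to
  L2.\<close>

lemma integrable_zero_AE:
  fixes h :: "'x \<Rightarrow> complex"
  assumes h: "integrable \<nu> h"
    and 0: "\<And>E. E \<in> sets \<nu> \<Longrightarrow> emeasure \<nu> E < \<infinity> \<Longrightarrow> (\<integral>x. h x * indicator E x \<partial>\<nu>) = 0"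
  shows "AE x in \<nu>. h x = 0"
proof -
  note [measurable] = borel_measurable_integrable[OF h]
  obtain A where A: "\<And>n. A n \<in> sets \<nu>" "\<And>n. emeasure \<nu> (A n) < \<infinity>"
    "(\<Union>n :: nat. A n) = space \<nu>"
    using N.truncation_sets[OF borel_measurable_integrable[OF h]] by metis
  note [measurable] = A(1)
  have neg: "AE x in \<nu>. x \<in> A n \<longrightarrow> Re (c * h x) \<le> 0" for n c
  proof -
    define E where "E = {x \<in> space \<nu>. x \<in> A n \<and> 0 < Re (c * h x)}"
    have E [measurable]: "E \<in> sets \<nu>" unfolding E_def by measurable
    have "emeasure \<nu> E \<le> emeasure \<nu> (A n)" by (intro emeasure_mono) (auto simp: E_def)
    then have fin: "emeasure \<nu> E < \<infinity>" using A(2)[of n] by (rule le_less_trans)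
    have i: "integrable \<nu> (\<lambda>x. c * (h x * indicator E x))"
      by (intro integrable_mult_right integrable_mult_bounded[OF h, where C = 1])
        (auto simp: indicator_def)
    have eq: "Re (c * (h x * indicator E x)) = Re (c * h x) * indicator E x" for x
      by (simp add: indicator_def)
    have i': "integrable \<nu> (\<lambda>x. Re (c * h x) * indicator E x)"
      using integrable_Re[OF i] unfolding eq .
    have "(\<integral>x. Re (c * h x) * indicator E x \<partial>\<nu>) = Re (c * (\<integral>x. h x * indicator E x \<partial>\<nu>))"
      using integral_Re[OF i] unfolding eq by simp
    also have "\<dots> = 0" using 0[OF E fin] by simp
    finally have "(\<integral>x. Re (c * h x) * indicator E x \<partial>\<nu>) = 0" .
    moreover have "AE x in \<nu>. 0 \<le> Re (c * h x) * indicator E x"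
      by (intro AE_I2) (simp add: E_def indicator_def del: times_complex.simps)
    ultimately have "AE x in \<nu>. Re (c * h x) * indicator E x = 0"
      using integral_nonneg_eq_0_iff_AE[OF i'] by simp
    then show ?thesis
      by (rule AE_mp) (intro AE_I2, auto simp: E_def indicator_def not_less simp del: times_complex.simps)
  qed
  have "AE x in \<nu>. \<forall>n. x \<in> A n \<longrightarrow> Re (c * h x) \<le> 0" for c
    using neg[of _ c] by (simp only: AE_all_countable simp_thms)
  \<comment> \<open>The four values of \<open>c\<close> bound the real and imaginary parts of
    \<open>h\<close> from above and below by 0.\<close>
  from this[of 1] this[of "-1"] this[of \<i>] this[of "-\<i>"] show ?thesis
  proof (rule AE_mp[OF _ AE_mp[OF _ AE_mp[OF _ AE_mp[OF _ AE_I2]]]], intro impI)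
    fix x assume x: "x \<in> space \<nu>"
    then obtain n where n: "x \<in> A n" using A(3) by auto
    assume "\<forall>n. x \<in> A n \<longrightarrow> Re (1 * h x) \<le> 0" "\<forall>n. x \<in> A n \<longrightarrow> Re (- 1 * h x) \<le> 0"
      "\<forall>n. x \<in> A n \<longrightarrow> Re (\<i> * h x) \<le> 0" "\<forall>n. x \<in> A n \<longrightarrow> Re (- \<i> * h x) \<le> 0"
    then have "Re (h x) = 0" "Im (h x) = 0" using n by (force intro: antisym)+
    then show "h x = 0" by (simp add: complex_eq_iff)
  qed
qed

text \<open>For \<open>E\<close> of finite measure choose transforms that converge to the indicator
  of \<open>E\<close>. Multiplying \<open>k\<close> by their exponential cutoffs and passing to the
  limit shows that \<open>k e(_, w)\<close> integrates to 0 over \<open>E\<close>.\<close>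

lemma null_ift_AE:
  assumes k: "k \<in> null_ift"
  shows "AE x in \<nu>. k x = 0"
proof -
  \<comment> \<open>Any point of the space serves: \<open>e x w\<close> has modulus 1, so
    multiplying by it does not change where \<open>k\<close> vanishes, and the integral of
    \<open>k e(_, w)\<close> is the value of \<open>ift k\<close> at \<open>w\<close>.\<close>
  obtain w where w: "w \<in> space \<mu>" using space_nonempty by auto
  note [measurable] = borel_measurable_integrable[OF null_ift_integrable[OF k]]
  have kw: "integrable \<nu> (\<lambda>x. k x * e x w)"
    using w kernel_norm
    by (intro integrable_mult_bounded[OF null_ift_integrable[OF k], where C = 1]) auto
  have *: "(\<integral>x. k x * e x w * indicator E x \<partial>\<nu>) = 0"
    if E [measurable]: "E \<in> sets \<nu>" and fin: "emeasure \<nu> E < \<infinity>" for E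
  proof -
    have "(\<lambda>x. indicator E x * 1 :: complex) \<in> L2 \<nu>"
      by (rule L2_bounded_finite_support[OF E fin, where C = 1]) auto
    then have "(\<lambda>x. indicator E x :: complex) \<in> L2 \<nu>" by simp
    from ft_approximation[OF this] obtain u :: "nat \<Rightarrow> 'v \<Rightarrow> complex" where
      u: "\<And>n. integrable \<mu> (u n)" "AE x in \<nu>. (\<lambda>n. ft (u n) x) \<longlonglongrightarrow> indicator E x" by metis
    note [measurable] = borel_measurable_integrable[OF u(1)]
    define p where "p n x = k x * complex_of_real (exp (- (cmod (ft (u n) x))\<^sup>2)) * e x w" for n x
    define l where "l x = k x * complex_of_real (exp (- (cmod (indicator E x))\<^sup>2)) * e x w" for x
    have "(\<lambda>n. \<integral>x. p n x \<partial>\<nu>) \<longlonglongrightarrow> (\<integral>x. l x \<partial>\<nu>)"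
    proof (rule integral_dominated_convergence[where w = "\<lambda>x. cmod (k x)"])
      show "integrable \<nu> (\<lambda>x. cmod (k x))" using null_ift_integrable[OF k] by simp
      show "AE x in \<nu>. (\<lambda>n. p n x) \<longlonglongrightarrow> l x"
        unfolding p_def l_def using u(2) by eventually_elim (intro tendsto_intros)
      show "AE x in \<nu>. norm (p n x) \<le> cmod (k x)" for n
        using w by (intro AE_I2) (simp add: p_def norm_mult kernel_norm mult_left_le)
      show "l \<in> borel_measurable \<nu>" "p n \<in> borel_measurable \<nu>" for n
        unfolding l_def[abs_def] p_def[abs_def] using w by measurable
    qed
    moreover have "(\<integral>x. p n x \<partial>\<nu>) = 0" for n
      using null_ift_exp[OF k u(1)[of n]] w unfolding null_ift_def ift_def p_def by simp
    ultimately have "(\<lambda>m::nat. 0) \<longlonglongrightarrow> (\<integral>x. l x \<partial>\<nu>)" by simp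
    then have "(\<integral>x. l x \<partial>\<nu>) = 0" by (rule LIMSEQ_unique[OF _ tendsto_const])
    \<comment> \<open>On \<open>E\<close> the limiting cutoff is \<open>exp (- 1)\<close> and off
      \<open>E\<close> it is 1, so it equals 1 minus \<open>1 - exp (- 1)\<close> times the
      indicator. The first term integrates to 0 and the coefficient of the second is
      nonzero.\<close>
    moreover have "l x = k x * e x w - complex_of_real (1 - exp (- 1)) * (k x * e x w * indicator E x)" for x
      by (simp add: l_def indicator_def algebra_simps)
    moreover have "integrable \<nu> (\<lambda>x. k x * e x w * indicator E x)"
      by (rule integrable_mult_bounded[OF kw, where C = 1]) (auto simp: indicator_def)
    moreover have "(\<integral>x. k x * e x w \<partial>\<nu>) = 0"
      using k w by (simp add: null_ift_def ift_def)
    ultimately have "complex_of_real (1 - exp (- 1)) * (\<integral>x. k x * e x w * indicator E x \<partial>\<nu>) = 0"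
      using kw by simp
    moreover have "complex_of_real (1 - exp (- 1)) \<noteq> 0"
      unfolding of_real_eq_0_iff by simp
    ultimately show ?thesis by simp
  qed
  have "AE x in \<nu>. k x * e x w = 0"
    by (rule integrable_zero_AE[OF kw]) (rule *)
  then show ?thesis
  proof (rule AE_mp, intro AE_I2 impI)
    fix x assume "x \<in> space \<nu>" "k x * e x w = 0"
    then show "k x = 0" using kernel_norm[of x w] w by auto
  qed
qed

section \<open>Plancherel's formula in the finite and the infinite case\<close>

text \<open>If \<open>F u = k\<close>, then \<open>u\<close> and \<open>ift k\<close> have the same
  inner products with all functions in L1 and L2: for \<open>u\<close> by unitarity, for
  \<open>ift k\<close> by Fubini. Hence they agree almost everywhere and the norms follow from the
  isometry.\<close>

lemma ift_L2:
  assumes k: "integrable \<nu> k" "k \<in> L2 \<nu>"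
  shows "ift k \<in> L2 \<mu>" "L2_norm \<mu> (ift k) = L2_norm \<nu> k"
proof -
  note [measurable] = L2_measurable[OF k(2)]
  obtain u where u: "u \<in> L2 \<mu>" "AE x in \<nu>. F u x = k x"
    using F_surj[OF k(2)] by (auto simp: L2_eq_def)
  note [measurable] = L2_measurable[OF u(1)]
  define d where "d v = u v - ift k v" for v
  have [measurable]: "d \<in> borel_measurable \<mu>" unfolding d_def[abs_def] by measurable
  obtain A where A: "\<And>n. A n \<in> sets \<mu>" "\<And>n. emeasure \<mu> (A n) < \<infinity>"
    "(\<Union>n. A n) = space \<mu>" "\<And>n x. x \<in> A n \<Longrightarrow> cmod (d x) \<le> real n"
    using M.truncation_sets[of d] by (metis \<open>d \<in> borel_measurable \<mu>\<close>)
  note [measurable] = A(1)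
  have "AE v in \<mu>. v \<in> A n \<longrightarrow> d v = 0" for n
  proof -
    \<comment> \<open>The test function is the truncated difference itself, so that equality of the
      two inner products says that its squared norm is 0.\<close>
    define p where "p v = indicator (A n) v * d v" for v
    have p: "p \<in> L2 \<mu>" "integrable \<mu> p"
      unfolding p_def[abs_def]
      using L2_bounded_finite_support[OF A(1,2) \<open>d \<in> borel_measurable \<mu>\<close> A(4)] by auto
    have [measurable]: "p \<in> borel_measurable \<mu>" by (rule L2_measurable[OF p(1)])
    have bd: "\<exists>C. \<forall>v\<in>space \<mu>. cmod (ift k v) \<le> C"
    proof (intro exI ballI)
      fix v assume v: "v \<in> space \<mu>"
      have "cmod (ift k v) \<le> (\<integral>x. cmod (k x * e x v) \<partial>\<nu>)"
        unfolding ift_def by (rule integral_norm_bound)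
      also have "\<dots> = (\<integral>x. cmod (k x) \<partial>\<nu>)"
        using v kernel_norm by (intro Bochner_Integration.integral_cong) (auto simp: norm_mult)
      finally show "cmod (ift k v) \<le> (\<integral>x. cmod (k x) \<partial>\<nu>)" .
    qed
    then obtain C where C: "\<And>v. v \<in> space \<mu> \<Longrightarrow> cmod (ift k v) \<le> C" by auto
    have i1: "integrable \<mu> (\<lambda>v. p v * cnj (u v))" by (rule L2_integrable_prod[OF p(1) u(1)])
    have i2: "integrable \<mu> (\<lambda>v. p v * cnj (ift k v))"
    proof (rule Bochner_Integration.integrable_bound)
      show "integrable \<mu> (\<lambda>v. C * cmod (p v))" using p(2) by auto
      show "AE v in \<mu>. norm (p v * cnj (ift k v)) \<le> norm (C * cmod (p v))"
      proof (rule AE_I2)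
        fix v assume "v \<in> space \<mu>"
        then have "cmod (ift k v) \<le> \<bar>C\<bar>" using C by force
        then show "norm (p v * cnj (ift k v)) \<le> norm (C * cmod (p v))"
          using mult_left_mono[of "cmod (ift k v)" "\<bar>C\<bar>" "cmod (p v)"]
          by (simp add: norm_mult abs_mult mult.commute)
      qed
    qed measurable
    have "(\<integral>v. p v * cnj (u v) \<partial>\<mu>) = L2_inner \<nu> (F p) (F u)"
      unfolding F_inner[OF p(1) u(1)] by (simp add: L2_inner_def)
    also have "\<dots> = (\<integral>x. ft p x * cnj (k x) \<partial>\<nu>)"
    proof -
      have m: "F p \<in> borel_measurable \<nu>" "F u \<in> borel_measurable \<nu>"
        using L2_measurable[OF F_L2] p(1) u(1) by auto
      show ?thesis unfolding L2_inner_def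
      proof (rule integral_cong_AE)
        show "AE x in \<nu>. F p x * cnj (F u x) = ft p x * cnj (k x)"
          using ft_eq_F[OF p] u(2) by eventually_elim simp
        show "(\<lambda>x. F p x * cnj (F u x)) \<in> borel_measurable \<nu>" using m by measurable
      qed measurable
    qed
    also have "\<dots> = (\<integral>v. p v * cnj (ift k v) \<partial>\<mu>)"
      by (rule integral_cnj_ift[OF k(1) p(2), symmetric])
    finally have "(\<integral>v. p v * cnj (u v) - p v * cnj (ift k v) \<partial>\<mu>) = 0" using i1 i2 by simp
    moreover have "p v * cnj (u v) - p v * cnj (ift k v) = complex_of_real ((cmod (p v))\<^sup>2)" for v
    proof -
      have "p v * cnj (u v) - p v * cnj (ift k v) = p v * cnj (d v)"
        by (simp add: d_def algebra_simps)
      also have "\<dots> = p v * cnj (p v)" by (simp add: p_def indicator_def)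
      finally show ?thesis by (simp only: complex_norm_square)
    qed
    ultimately have "(\<integral>v. complex_of_real ((cmod (p v))\<^sup>2) \<partial>\<mu>) = 0" by (simp only:)
    then have "complex_of_real ((L2_norm \<mu> p)\<^sup>2) = 0"
      unfolding L2_norm_square integral_complex_of_real[symmetric] .
    then have "AE v in \<mu>. p v = 0"
      using L2_norm_eq_0[OF p(1)] by (simp add: L2_eq_def)
    then show ?thesis by (rule AE_mp) (auto simp: p_def)
  qed
  then have "AE v in \<mu>. \<forall>n. v \<in> A n \<longrightarrow> d v = 0" by (simp only: AE_all_countable simp_thms)
  then have eq: "AE v in \<mu>. u v = ift k v"
  proof (rule AE_mp, intro AE_I2 impI)
    fix v assume "v \<in> space \<mu>" "\<forall>n. v \<in> A n \<longrightarrow> d v = 0"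
    then show "u v = ift k v" using A(3) by (auto simp: d_def)
  qed
  show "ift k \<in> L2 \<mu>" by (rule L2_cong_AE[OF u(1) _ eq]) measurable
  have m: "F u \<in> borel_measurable \<nu>" using L2_measurable[OF F_L2] u(1) by auto
  have "L2_norm \<mu> (ift k) = L2_norm \<mu> u"
    unfolding L2_norm_def using eq by (intro arg_cong[where f = sqrt] integral_cong_AE) auto
  also have "\<dots> = L2_norm \<nu> (F u)" by (rule F_norm[OF u(1), symmetric])
  also have "\<dots> = L2_norm \<nu> k"
    unfolding L2_norm_def using u(2) m by (intro arg_cong[where f = sqrt] integral_cong_AE) auto
  finally show "L2_norm \<mu> (ift k) = L2_norm \<nu> k" .
qed

text \<open>The candidate is \<open>u = F (ift k)\<close>, which is in L2; it must be shown that
  \<open>u = k\<close>. Both have the same pairing with every \<open>ft p\<close>, and translating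
  \<open>p\<close> upgrades this to the vanishing of the whole inverse transform of \<open>d\<close>
  times \<open>ft p\<close>. Injectivity on L1 then gives \<open>d = 0\<close> wherever some
  transform is nonzero, and transforms approximate indicators.\<close>

lemma L2_of_ift_L2:
  assumes k: "integrable \<nu> k" and ik: "ift k \<in> L2 \<mu>"
  shows "k \<in> L2 \<nu>"
proof -
  note [measurable] = borel_measurable_integrable[OF k]
  define u where "u = F (ift k)"
  have u: "u \<in> L2 \<nu>" unfolding u_def by (rule F_L2[OF ik])
  note [measurable] = L2_measurable[OF u]
  define d where "d x = cnj (k x) - cnj (u x)" for x
  have [measurable]: "d \<in> borel_measurable \<nu>" unfolding d_def[abs_def] by measurable
  have i1: "integrable \<nu> (\<lambda>x. ft p x * cnj (k x))" if p: "p \<in> L2 \<mu>" "integrable \<mu> p" for p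
  proof -
    have "integrable \<nu> (\<lambda>x. cnj (k x) * ft p x)"
      using L2_measurable[OF ft_L2[OF p]] ft_bounded[OF p(2)]
      by (intro integrable_mult_bounded) (auto simp: k)
    then show ?thesis by (simp add: mult.commute)
  qed
  have i2: "integrable \<nu> (\<lambda>x. ft p x * cnj (u x))" if p: "p \<in> L2 \<mu>" "integrable \<mu> p" for p
    by (rule L2_integrable_prod[OF ft_L2[OF p] u])
  have zero: "(\<integral>x. d x * ft p x \<partial>\<nu>) = 0" if p: "p \<in> L2 \<mu>" "integrable \<mu> p" for p
  proof -
    note [measurable] = L2_measurable[OF ft_L2[OF p]]
    have m: "F p \<in> borel_measurable \<nu>" using L2_measurable[OF F_L2] p(1) by auto
    have "(\<integral>x. ft p x * cnj (k x) \<partial>\<nu>) = L2_inner \<mu> p (ift k)"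
      unfolding L2_inner_def by (rule integral_cnj_ift[OF k p(2), symmetric])
    also have "\<dots> = L2_inner \<nu> (F p) u" unfolding u_def by (rule F_inner[OF p(1) ik, symmetric])
    also have "\<dots> = (\<integral>x. ft p x * cnj (u x) \<partial>\<nu>)"
      unfolding L2_inner_def
    proof (rule integral_cong_AE)
      show "AE x in \<nu>. F p x * cnj (u x) = ft p x * cnj (u x)"
        using ft_eq_F[OF p] by eventually_elim simp
      show "(\<lambda>x. F p x * cnj (u x)) \<in> borel_measurable \<nu>" using m by measurable
    qed measurable
    finally have "(\<integral>x. ft p x * cnj (k x) - ft p x * cnj (u x) \<partial>\<nu>) = 0"
      using i1[OF p] i2[OF p] by simp
    then show ?thesis by (simp add: d_def algebra_simps)
  qed
  \<comment> \<open>The difference \<open>d\<close> need not be integrable, since \<open>u\<close>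
    is only in L2. Its product with \<open>ft p\<close> is: the part from \<open>k\<close> because
    \<open>ft p\<close> is bounded, the part from \<open>u\<close> because \<open>ft p\<close> is in
    L2.\<close>
  have null: "(\<lambda>x. d x * ft p x) \<in> null_ift" if p: "p \<in> L2 \<mu>" "integrable \<mu> p" for p
  proof -
    have "integrable \<nu> (\<lambda>x. ft p x * cnj (k x) - ft p x * cnj (u x))"
      using i1[OF p] i2[OF p] by simp
    then have "integrable \<nu> (\<lambda>x. d x * ft p x)" by (simp add: d_def algebra_simps)
    moreover have "ift (\<lambda>x. d x * ft p x) v = 0" if v: "v \<in> space \<mu>" for v
    proof -
      obtain p' where p': "p' \<in> L2 \<mu>" "integrable \<mu> p'" "\<And>x. x \<in> space \<nu> \<Longrightarrow> ft p' x = e x v * ft p x"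
        using kernel_translate[OF v p] unfolding ft_def by auto
      have "ift (\<lambda>x. d x * ft p x) v = (\<integral>x. d x * ft p' x \<partial>\<nu>)"
        unfolding ift_def using p'(3) by (intro Bochner_Integration.integral_cong) auto
      then show ?thesis using zero[OF p'(1,2)] by simp
    qed
    ultimately show ?thesis by (simp add: null_ift_def)
  qed
  obtain A where A: "\<And>n. A n \<in> sets \<nu>" "\<And>n. emeasure \<nu> (A n) < \<infinity>"
    "(\<Union>n :: nat. A n) = space \<nu>"
    using N.truncation_sets[of d] by (metis \<open>d \<in> borel_measurable \<nu>\<close>)
  have "AE x in \<nu>. x \<in> A n \<longrightarrow> d x = 0" for n
  proof -
    have "(\<lambda>x. indicator (A n) x * 1 :: complex) \<in> L2 \<nu>"
      by (rule L2_bounded_finite_support[OF A(1,2), where C = 1]) auto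
    then have "(\<lambda>x. indicator (A n) x :: complex) \<in> L2 \<nu>" by simp
    from ft_approximation[OF this] obtain p :: "nat \<Rightarrow> 'v \<Rightarrow> complex" where
      p: "\<And>n. p n \<in> L2 \<mu>" "\<And>n. integrable \<mu> (p n)"
        "AE x in \<nu>. (\<lambda>j. ft (p j) x) \<longlonglongrightarrow> indicator (A n) x" by metis
    have "AE x in \<nu>. \<forall>j. d x * ft (p j) x = 0"
      using null_ift_AE[OF null[OF p(1,2)]] by (simp only: AE_all_countable) simp
    with p(3) show ?thesis
    proof eventually_elim
      case (elim x)
      have "(\<lambda>j. d x * ft (p j) x) \<longlonglongrightarrow> d x * indicator (A n) x"
        by (intro tendsto_intros elim)
      moreover have "(\<lambda>j. d x * ft (p j) x) = (\<lambda>_. 0)" using elim by auto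
      ultimately have "d x * indicator (A n) x = 0"
        using LIMSEQ_unique[OF tendsto_const] by metis
      then show ?case by auto
    qed
  qed
  then have "AE x in \<nu>. \<forall>n. x \<in> A n \<longrightarrow> d x = 0" by (simp only: AE_all_countable simp_thms)
  then have eq: "AE x in \<nu>. u x = k x"
  proof (rule AE_mp, intro AE_I2 impI)
    fix x assume "x \<in> space \<nu>" "\<forall>n. x \<in> A n \<longrightarrow> d x = 0"
    then have "d x = 0" using A(3) by auto
    then show "u x = k x" by (simp add: d_def)
  qed
  show ?thesis by (rule L2_cong_AE[OF u _ eq]) measurable
qed

text \<open>If \<open>k\<close> is in L2, the norms agree; otherwise \<open>ift k\<close> is not in
  L2 either and both sides are infinite.\<close>

theorem plancherel_L1:
  assumes k: "integrable \<nu> k"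
  shows "(\<integral>\<^sup>+v. ennreal ((cmod (ift k v))\<^sup>2) \<partial>\<mu>) = (\<integral>\<^sup>+x. ennreal ((cmod (k x))\<^sup>2) \<partial>\<nu>)"
proof (cases "k \<in> L2 \<nu>")
  case True
  then show ?thesis using ift_L2[OF k] by (simp add: nn_integral_L2_norm)
next
  case False
  then have "ift k \<notin> L2 \<mu>" using L2_of_ift_L2[OF k] by auto
  then show ?thesis
    using False k by (simp add: nn_integral_not_L2)
qed

end

section \<open>Orthogonal complements and multiplication operators\<close>

lemma L2_Fatou:
  fixes u :: "nat \<Rightarrow> 'a \<Rightarrow> complex"
  assumes u: "\<And>n. u n \<in> borel_measurable M" and lim: "AE x in M. (\<lambda>n. u n x) \<longlonglongrightarrow> g x"
    and le: "\<And>n. N \<le> n \<Longrightarrow> (\<integral>\<^sup>+x. ennreal ((cmod (u n x))\<^sup>2) \<partial>M) \<le> B"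
  shows "(\<integral>\<^sup>+x. ennreal ((cmod (g x))\<^sup>2) \<partial>M) \<le> B"
proof -
  note [measurable] = u
  have "(\<integral>\<^sup>+x. ennreal ((cmod (g x))\<^sup>2) \<partial>M) =
      (\<integral>\<^sup>+x. liminf (\<lambda>n. ennreal ((cmod (u n x))\<^sup>2)) \<partial>M)"
  proof (rule nn_integral_cong_AE, use lim in eventually_elim)
    case (elim x)
    have "(\<lambda>n. ennreal ((cmod (u n x))\<^sup>2)) \<longlonglongrightarrow> ennreal ((cmod (g x))\<^sup>2)"
      by (intro tendsto_ennrealI tendsto_intros elim)
    then show ?case by (intro lim_imp_Liminf[symmetric]) auto
  qed
  also have "\<dots> \<le> liminf (\<lambda>n. \<integral>\<^sup>+x. ennreal ((cmod (u n x))\<^sup>2) \<partial>M)"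
    by (rule nn_integral_liminf) measurable
  also have "\<dots> \<le> liminf (\<lambda>n. B)"
    using le by (intro Liminf_mono) (auto simp: eventually_sequentially)
  also have "\<dots> = B" by (simp add: Liminf_const)
  finally show ?thesis .
qed

text \<open>The weights \<open>2 ^ n\<close> leave a series of integrals bounded by
  \<open>C (1/4)^n\<close>, so the weighted series of squared increments is finite almost
  everywhere. At such a point its terms are bounded, and the increments themselves decay like
  \<open>2^(-n/2)\<close>, which is summable.\<close>

lemma L2_fast_Cauchy_AE_convergent:
  assumes f: "\<And>n. f n \<in> L2 M"
    and C: "\<And>n. (L2_norm M (\<lambda>x. f (Suc n) x - f n x))\<^sup>2 \<le> C * (1/8) ^ n"
  shows "AE x in M. convergent (\<lambda>n. f n x)"
proof -
  note [measurable] = L2_measurable[OF f]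
  define d where "d n x = f (Suc n) x - f n x" for n x
  have d: "d n \<in> L2 M" for n unfolding d_def[abs_def] by (rule L2_diff[OF f f])
  note [measurable] = L2_measurable[OF d]
  have C0: "0 \<le> C" using C[of 0] by (simp add: order_trans[OF zero_le_power2])
  have summ: "summable (\<lambda>n. C * (1/4 :: real) ^ n)" by (intro summable_mult summable_geometric) simp
  have "(\<integral>\<^sup>+x. (\<Sum>n. ennreal (2 ^ n * (cmod (d n x))\<^sup>2)) \<partial>M) =
      (\<Sum>n. \<integral>\<^sup>+x. ennreal (2 ^ n * (cmod (d n x))\<^sup>2) \<partial>M)"
    by (rule nn_integral_suminf) measurable
  also have "\<dots> \<le> (\<Sum>n. ennreal (C * (1/4) ^ n))"
  proof (rule suminf_le)
    fix n
    have "(\<integral>\<^sup>+x. ennreal (2 ^ n * (cmod (d n x))\<^sup>2) \<partial>M) =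
        ennreal (2 ^ n) * (\<integral>\<^sup>+x. ennreal ((cmod (d n x))\<^sup>2) \<partial>M)"
      by (subst nn_integral_cmult[symmetric]) (auto simp: ennreal_mult)
    also have "\<dots> = ennreal (2 ^ n * (L2_norm M (d n))\<^sup>2)"
      by (simp add: nn_integral_L2_norm[OF d] ennreal_mult)
    also have "\<dots> \<le> ennreal (2 ^ n * (C * (1/8) ^ n))"
      using C[of n] by (intro ennreal_leI mult_left_mono) (auto simp: d_def[abs_def])
    also have "2 ^ n * (C * (1/8) ^ n) = C * (1/4 :: real) ^ n"
      by (simp add: power_mult_distrib[symmetric])
    finally show "(\<integral>\<^sup>+x. ennreal (2 ^ n * (cmod (d n x))\<^sup>2) \<partial>M) \<le> ennreal (C * (1/4) ^ n)" .
  qed auto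
  also have "\<dots> < \<infinity>" using summ C0 by (subst suminf_ennreal2) auto
  finally have "AE x in M. (\<Sum>n. ennreal (2 ^ n * (cmod (d n x))\<^sup>2)) \<noteq> \<infinity>"
    by (intro nn_integral_PInf_AE) auto
  then show ?thesis
  proof eventually_elim
    case (elim x)
    have "summable (\<lambda>n. 2 ^ n * (cmod (d n x))\<^sup>2)"
      by (rule summable_suminf_not_top) (use elim in auto)
    then have "(\<lambda>n. 2 ^ n * (cmod (d n x))\<^sup>2) \<longlonglongrightarrow> 0" by (rule summable_LIMSEQ_zero)
    then have "Bseq (\<lambda>n. 2 ^ n * (cmod (d n x))\<^sup>2)" by (intro convergent_imp_Bseq convergentI)
    then obtain K where "\<forall>n. norm (2 ^ n * (cmod (d n x))\<^sup>2) \<le> K" by (elim BseqE)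
    then have K: "2 ^ n * (cmod (d n x))\<^sup>2 \<le> K" for n by simp
    have K0: "0 \<le> K" using K[of 0] by (auto intro: order_trans[OF zero_le_power2])
    have bound: "cmod (d n x) \<le> sqrt K * (1 / sqrt 2) ^ n" for n
    proof -
      have "(cmod (d n x))\<^sup>2 \<le> K / 2 ^ n" using K[of n] by (simp add: field_simps)
      then have "cmod (d n x) \<le> sqrt (K / 2 ^ n)" by (rule real_le_rsqrt)
      also have "\<dots> = sqrt K * (1 / sqrt 2) ^ n"
        by (simp add: real_sqrt_divide real_sqrt_power power_divide)
      finally show ?thesis .
    qed
    have "summable (\<lambda>n. sqrt K * (1 / sqrt 2) ^ n)"
      by (intro summable_mult summable_geometric) simp
    then have "summable (\<lambda>n. d n x)"
      using bound by (rule summable_comparison_test'[where N = 0])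
    then have "convergent (\<lambda>n. \<Sum>i<n. d i x)" by (simp add: summable_iff_convergent)
    moreover have "(\<Sum>i<n. d i x) = f n x - f 0 x" for n
      unfolding d_def by (rule sum_lessThan_telescope)
    ultimately have "convergent (\<lambda>n. f n x - f 0 x)" by simp
    then have "convergent (\<lambda>n. f n x - f 0 x + f 0 x)" by (intro convergent_add convergent_const)
    then show ?case by simp
  qed
qed

lemma L2_parallelogram:
  assumes "f \<in> L2 M" "g \<in> L2 M"
  shows "(L2_norm M (\<lambda>x. f x + g x))\<^sup>2 + (L2_norm M (\<lambda>x. f x - g x))\<^sup>2 =
    2 * (L2_norm M f)\<^sup>2 + 2 * (L2_norm M g)\<^sup>2"
  using L2_norm_combination[OF assms, of 1] L2_norm_combination[OF assms, of "-1"] by simp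

text \<open>For \<open>f\<close> outside \<open>W\<close>, a minimizing sequence in \<open>W\<close>
  is Cauchy by the parallelogram law; its limit \<open>G\<close> is a nearest point and
  \<open>f - G\<close> is orthogonal to \<open>W\<close>.\<close>

lemma L2_orthogonal_complement:
  assumes W: "L2_closed_subspace M W" and ne: "W \<noteq> L2 M"
  obtains h where "h \<in> L2 M" "\<not> L2_eq M h (\<lambda>_. 0)" "\<And>w. w \<in> W \<Longrightarrow> L2_inner M h w = 0"
proof -
  have W2: "W \<subseteq> L2 M" and W0: "(\<lambda>_. 0) \<in> W"
    and Wc: "\<And>f g a b. f \<in> W \<Longrightarrow> g \<in> W \<Longrightarrow> (\<lambda>x. a * f x + b * g x) \<in> W"
    and Wcl: "\<And>f. f \<in> L2 M \<Longrightarrow> (\<And>\<epsilon>. 0 < \<epsilon> \<Longrightarrow> \<exists>g\<in>W. L2_norm M (\<lambda>x. f x - g x) < \<epsilon>) \<Longrightarrow> f \<in> W"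
    using W by (auto simp: L2_closed_subspace_def)
  obtain f where f: "f \<in> L2 M" "f \<notin> W" using ne W2 by auto
  define D where "D g = (L2_norm M (\<lambda>x. f x - g x))\<^sup>2" for g
  define \<delta> where "\<delta> = (INF g\<in>W. D g)"
  have bdd: "bdd_below (D ` W)" by (rule bdd_belowI[of _ 0]) (auto simp: D_def)
  have \<delta>: "\<delta> \<le> D g" if "g \<in> W" for g
    unfolding \<delta>_def by (rule cINF_lower[OF bdd that])
  \<comment> \<open>The rate \<open>(1/8)^n\<close> is the one for which the minimizing sequence
    converges almost everywhere without passing to a subsequence.\<close>
  have "\<exists>g\<in>W. D g < \<delta> + (1/8) ^ n" for n :: nat
  proof -
    have "(INF g\<in>W. D g) < \<delta> + (1/8) ^ n" by (simp add: \<delta>_def)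
    then show ?thesis using cINF_less_iff[OF _ bdd] W0 by auto
  qed
  then obtain g where g: "\<And>n :: nat. g n \<in> W" "\<And>n. D (g n) < \<delta> + (1/8) ^ n" by metis
  have gL: "g n \<in> L2 M" for n using g(1) W2 by auto
  note [measurable] = L2_measurable[OF gL] L2_measurable[OF f(1)]
  \<comment> \<open>The midpoint of \<open>g m\<close> and \<open>g n\<close> lies in
    \<open>W\<close>, so four times its squared distance from \<open>f\<close> is at least
    \<open>4 \<delta>\<close>; the parallelogram law leaves at most twice the two excesses over
    \<open>\<delta>\<close>, whence the constant 4.\<close>
  have cauchy: "(L2_norm M (\<lambda>x. g n x - g m x))\<^sup>2 \<le> 4 * (1/8) ^ m" if "m \<le> n" for m n
  proof -
    have mid: "(\<lambda>x. (1/2) * g m x + (1/2) * g n x) \<in> W" by (intro Wc g)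
    have "(L2_norm M (\<lambda>x. (f x - g m x) + (f x - g n x)))\<^sup>2 =
        4 * D (\<lambda>x. (1/2) * g m x + (1/2) * g n x)"
    proof -
      have "(cmod ((f x - g m x) + (f x - g n x)))\<^sup>2 =
          4 * (cmod (f x - ((1/2) * g m x + (1/2) * g n x)))\<^sup>2" for x
      proof -
        have "(f x - g m x) + (f x - g n x) = 2 * (f x - ((1/2) * g m x + (1/2) * g n x))" by simp
        then show ?thesis by (simp only: norm_mult power_mult_distrib) simp
      qed
      then show ?thesis unfolding D_def L2_norm_square by simp
    qed
    moreover have "(L2_norm M (\<lambda>x. (f x - g m x) + (f x - g n x)))\<^sup>2 +
        (L2_norm M (\<lambda>x. (f x - g m x) - (f x - g n x)))\<^sup>2 = 2 * D (g m) + 2 * D (g n)"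
      unfolding D_def by (rule L2_parallelogram) (intro L2_diff f gL)+
    moreover have "(\<lambda>x. (f x - g m x) - (f x - g n x)) = (\<lambda>x. g n x - g m x)" by auto
    ultimately have "4 * D (\<lambda>x. (1/2) * g m x + (1/2) * g n x) + (L2_norm M (\<lambda>x. g n x - g m x))\<^sup>2 =
        2 * D (g m) + 2 * D (g n)" by (simp only:)
    moreover have "(1/8 :: real) ^ n \<le> (1/8) ^ m" using that by (intro power_decreasing) auto
    ultimately show ?thesis using \<delta>[OF mid] g(2)[of m] g(2)[of n] by linarith
  qed
  have conv: "AE x in M. convergent (\<lambda>n. g n x)"
    by (rule L2_fast_Cauchy_AE_convergent[OF gL cauchy]) simp
  \<comment> \<open>\<open>lim\<close> is total, so \<open>G\<close> is defined and measurable
    everywhere; its values on the null set of divergence do not matter.\<close>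
  define G where "G x = lim (\<lambda>n. g n x)" for x
  have [measurable]: "G \<in> borel_measurable M" unfolding G_def[abs_def] by measurable
  have lim: "AE x in M. (\<lambda>n. g n x) \<longlonglongrightarrow> G x"
    using conv by eventually_elim (simp add: G_def convergent_LIMSEQ_iff)
  have dist: "(\<integral>\<^sup>+x. ennreal ((cmod (G x - g m x))\<^sup>2) \<partial>M) \<le> ennreal (4 * (1/8) ^ m)" for m
  proof (rule L2_Fatou[where u = "\<lambda>n x. g n x - g m x" and N = m])
    show "AE x in M. (\<lambda>n. g n x - g m x) \<longlonglongrightarrow> G x - g m x"
      using lim by eventually_elim (intro tendsto_intros)
    show "(\<integral>\<^sup>+x. ennreal ((cmod (g n x - g m x))\<^sup>2) \<partial>M) \<le> ennreal (4 * (1/8) ^ m)" if "m \<le> n" for n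
      unfolding nn_integral_L2_norm[OF L2_diff[OF gL gL]] by (intro ennreal_leI cauchy that)
  qed measurable
  have Gg: "(\<lambda>x. G x - g m x) \<in> L2 M" for m
    unfolding L2_iff_nn_integral using le_less_trans[OF dist[of m]] by auto
  have GL: "G \<in> L2 M" using L2_combination[OF Gg[of 0] gL[of 0], of 1 1] by simp
  have "G \<in> W"
  proof (rule Wcl[OF GL])
    fix \<epsilon> :: real assume \<epsilon>: "0 < \<epsilon>"
    have "(\<lambda>m. 4 * (1/8 :: real) ^ m) \<longlonglongrightarrow> 4 * 0" by (intro tendsto_intros LIMSEQ_power_zero) simp
    then have "\<forall>\<^sub>F m in sequentially. 4 * (1/8 :: real) ^ m < \<epsilon>\<^sup>2"
      by (rule order_tendstoD(2)) (use \<epsilon> in simp)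
    then obtain m where m: "4 * (1/8 :: real) ^ m < \<epsilon>\<^sup>2" by (auto simp: eventually_sequentially)
    have "(L2_norm M (\<lambda>x. G x - g m x))\<^sup>2 \<le> 4 * (1/8) ^ m"
      using dist[of m] unfolding nn_integral_L2_norm[OF Gg] by (simp add: ennreal_le_iff)
    then have "L2_norm M (\<lambda>x. G x - g m x) < \<epsilon>"
      using m \<epsilon> by (intro power2_less_imp_less[of _ \<epsilon>]) auto
    then show "\<exists>g\<in>W. L2_norm M (\<lambda>x. G x - g x) < \<epsilon>" using g(1) by blast
  qed
  define h where "h x = f x - G x" for x
  have h: "h \<in> L2 M" unfolding h_def[abs_def] by (rule L2_diff[OF f(1) GL])
  have "D G \<le> \<delta> + (1/8) ^ N" for N
  proof -
    have "(\<integral>\<^sup>+x. ennreal ((cmod (f x - G x))\<^sup>2) \<partial>M) \<le> ennreal (\<delta> + (1/8) ^ N)"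
    proof (rule L2_Fatou[where u = "\<lambda>n x. f x - g n x" and N = N])
      show "AE x in M. (\<lambda>n. f x - g n x) \<longlonglongrightarrow> f x - G x"
        using lim by eventually_elim (intro tendsto_intros)
      fix n assume "N \<le> n"
      then have "(1/8 :: real) ^ n \<le> (1/8) ^ N" by (intro power_decreasing) auto
      then have "D (g n) \<le> \<delta> + (1/8) ^ N" using g(2)[of n] by linarith
      then show "(\<integral>\<^sup>+x. ennreal ((cmod (f x - g n x))\<^sup>2) \<partial>M) \<le> ennreal (\<delta> + (1/8) ^ N)"
        unfolding nn_integral_L2_norm[OF L2_diff[OF f(1) gL]] D_def by (rule ennreal_leI)
    qed measurable
    moreover have "0 \<le> \<delta> + (1/8) ^ N"
      using g(2)[of N] by (intro order_trans[OF _ less_imp_le[OF g(2)]]) (simp add: D_def)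
    ultimately show ?thesis
      unfolding nn_integral_L2_norm[OF L2_diff[OF f(1) GL]] D_def by (simp add: ennreal_le_iff)
  qed
  moreover have "(\<lambda>N. \<delta> + (1/8 :: real) ^ N) \<longlonglongrightarrow> \<delta> + 0"
    by (intro tendsto_intros LIMSEQ_power_zero) simp
  ultimately have DG: "D G \<le> \<delta>"
    by (intro LIMSEQ_le_const[of "\<lambda>N. \<delta> + (1/8 :: real) ^ N"]) auto
  have DGh: "D G = (L2_norm M h)\<^sup>2" by (simp add: D_def h_def[abs_def])
  have "L2_inner M h w = 0" if w: "w \<in> W" for w
  proof (rule ccontr)
    assume ne0: "L2_inner M h w \<noteq> 0"
    have wL: "w \<in> L2 M" using w W2 by auto
    define s where "s = L2_inner M h w"
    \<comment> \<open>With \<open>c = - t s\<close>, replacing \<open>h\<close> by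
      \<open>h + c w\<close> changes the squared norm by \<open>|s|^2 (t^2 |w|^2 - 2 t)\<close>. The
      choice of \<open>t\<close> makes \<open>t |w|^2 < 1\<close>, hence this change negative; the
      summand 1 covers the case of a null \<open>w\<close>.\<close>
    define t where "t = 1 / ((L2_norm M w)\<^sup>2 + 1)"
    define c where "c = - (complex_of_real t * s)"
    have t: "0 < t" "t * (L2_norm M w)\<^sup>2 < 1"
      unfolding t_def by (auto simp: add_nonneg_pos divide_less_eq_1)
    have "(\<lambda>x. 1 * G x + (- c) * w x) \<in> W" by (rule Wc[OF \<open>G \<in> W\<close> w])
    from \<delta>[OF this] have "\<delta> \<le> (L2_norm M (\<lambda>x. 1 * h x + c * w x))\<^sup>2"
      by (simp add: D_def h_def algebra_simps)
    also have "\<dots> = D G + (cmod c)\<^sup>2 * (L2_norm M w)\<^sup>2 + 2 * Re (cnj c * s)"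
      unfolding DGh s_def by (rule L2_norm_combination[OF h wL])
    also have "(cmod c)\<^sup>2 = t\<^sup>2 * (cmod s)\<^sup>2"
      by (simp add: c_def norm_mult power_mult_distrib)
    also have "cnj c * s = - complex_of_real (t * (cmod s)\<^sup>2)"
      unfolding of_real_mult complex_norm_square by (simp add: c_def mult_ac)
    finally have "0 \<le> t\<^sup>2 * (cmod s)\<^sup>2 * (L2_norm M w)\<^sup>2 - 2 * t * (cmod s)\<^sup>2"
      using DG by (simp add: algebra_simps)
    also have "\<dots> = (t * (cmod s)\<^sup>2) * (t * (L2_norm M w)\<^sup>2 - 2)"
      by (simp add: power2_eq_square algebra_simps)
    finally have "0 \<le> (t * (cmod s)\<^sup>2) * (t * (L2_norm M w)\<^sup>2 - 2)" .
    moreover have "0 < t * (cmod s)\<^sup>2" using t ne0 by (simp add: s_def)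
    ultimately show False using t(2) by (simp add: zero_le_mult_iff)
  qed
  moreover have "\<not> L2_eq M h (\<lambda>_. 0)"
  proof
    assume "L2_eq M h (\<lambda>_. 0)"
    then have "L2_norm M (\<lambda>x. f x - G x) = 0"
      using L2_norm_eq_0[OF h] by (simp add: h_def[abs_def])
    then have "f \<in> W" using \<open>G \<in> W\<close> by (intro Wcl[OF f(1)] bexI[of _ G]) auto
    then show False using f(2) by simp
  qed
  ultimately show thesis using h by (intro that[of h])
qed

section \<open>Multiplication by a positive function\<close>

locale multiplication_operator =
  fixes M :: "'a measure" and m :: "'a \<Rightarrow> real"
  assumes measurable_m [measurable]: "m \<in> borel_measurable M"
    and m_pos: "\<And>x. x \<in> space M \<Longrightarrow> 0 < m x"
begin

abbreviation D :: "('a \<Rightarrow> complex) rel" where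
  "D \<equiv> L2_mult_operator M (\<lambda>x. complex_of_real (m x))"

text \<open>Sublevel sets of the multiplier: cutting off any L2 function to \<open>cut n\<close>
  puts it into the domain of \<open>D\<close>. Such functions give both the density of the domain
  and the test functions for the adjoint.\<close>

definition cut :: "nat \<Rightarrow> 'a set" where
  "cut n = {x \<in> space M. m x \<le> real n}"

lemma cut_sets [measurable]: "cut n \<in> sets M"
  unfolding cut_def by measurable

lemma cut_incseq: "incseq cut"
  by (auto simp: cut_def incseq_def intro: order_trans)

lemma cut_Union: "(\<Union>n. cut n) = space M"
  using real_arch_simple by (auto simp: cut_def)

lemma D_iff: "(f, g) \<in> D \<longleftrightarrow> f \<in> L2 M \<and> g \<in> L2 M \<and> (AE x in M. g x = of_real (m x) * f x)"
  by (auto simp: L2_mult_operator_def L2_eq_def)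

lemma cut_L2:
  assumes "f \<in> L2 M"
  shows "(\<lambda>x. indicator (cut n) x * f x) \<in> L2 M"
    "(\<lambda>x. of_real (m x) * (indicator (cut n) x * f x)) \<in> L2 M"
proof -
  show "(\<lambda>x. indicator (cut n) x * f x) \<in> L2 M"
    by (rule L2_mult_bounded[OF assms, where C = 1]) (auto simp: indicator_def)
  have "(\<lambda>x. (of_real (m x) * indicator (cut n) x) * f x) \<in> L2 M"
  proof (rule L2_mult_bounded[OF assms, where C = "real n"])
    show "cmod (of_real (m x) * indicator (cut n) x) \<le> real n" if "x \<in> space M" for x
      using m_pos[OF that] by (auto simp: indicator_def cut_def)
  qed measurable
  then show "(\<lambda>x. of_real (m x) * (indicator (cut n) x * f x)) \<in> L2 M" by (simp add: mult.assoc)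
qed

lemma cut_D:
  assumes "f \<in> L2 M"
  shows "(\<lambda>x. indicator (cut n) x * f x, \<lambda>x. of_real (m x) * (indicator (cut n) x * f x)) \<in> D"
  using cut_L2[OF assms] by (simp add: D_iff)

lemma D_L2_operator: "L2_operator M D"
  unfolding L2_operator_def
proof (intro conjI)
  show "D \<subseteq> L2 M \<times> L2 M" by (auto simp: L2_mult_operator_def)
  show "\<forall>(f, g)\<in>D. \<forall>f'\<in>L2 M. \<forall>g'\<in>L2 M. L2_eq M f f' \<longrightarrow> L2_eq M g g' \<longrightarrow> (f', g') \<in> D"
  proof clarify
    fix f g f' g' assume fg: "(f, g) \<in> D" "f' \<in> L2 M" "g' \<in> L2 M" "L2_eq M f f'" "L2_eq M g g'"
    then have "AE x in M. g x = of_real (m x) * f x" "AE x in M. f x = f' x" "AE x in M. g x = g' x"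
      by (simp_all add: D_iff L2_eq_def)
    then have "AE x in M. g' x = of_real (m x) * f' x" by eventually_elim simp
    then show "(f', g') \<in> D" using fg by (simp add: D_iff)
  qed
  show "\<forall>f g g'. (f, g) \<in> D \<longrightarrow> (f, g') \<in> D \<longrightarrow> L2_eq M g g'"
  proof clarify
    fix f g g' assume "(f, g) \<in> D" "(f, g') \<in> D"
    then have "AE x in M. g x = of_real (m x) * f x" "AE x in M. g' x = of_real (m x) * f x"
      by (simp_all add: D_iff)
    then show "L2_eq M g g'" unfolding L2_eq_def by eventually_elim simp
  qed
  have "(\<lambda>x. a * f x + b * f' x, \<lambda>x. a * g x + b * g' x) \<in> D"
    if fg: "(f, g) \<in> D" "(f', g') \<in> D" for f g f' g' a b
  proof -
    have "AE x in M. g x = of_real (m x) * f x" "AE x in M. g' x = of_real (m x) * f' x"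
      using fg by (auto simp: D_iff)
    then have "AE x in M. a * g x + b * g' x = of_real (m x) * (a * f x + b * f' x)"
      by eventually_elim (simp add: algebra_simps)
    then show ?thesis using fg by (auto simp: D_iff intro!: L2_combination)
  qed
  then show "\<forall>(f, g)\<in>D. \<forall>(f', g')\<in>D. \<forall>a b.
      (\<lambda>x. a * f x + b * f' x, \<lambda>x. a * g x + b * g' x) \<in> D" by blast
qed

lemma D_densely_defined: "L2_densely_defined M D"
  unfolding L2_densely_defined_def
proof (intro ballI allI impI)
  fix f and \<epsilon> :: real assume f: "f \<in> L2 M" and "0 < \<epsilon>"
  have "\<forall>\<^sub>F n in sequentially. L2_norm M (\<lambda>x. f x - indicator (cut n) x * f x) < \<epsilon>"
    by (rule order_tendstoD(2)[OF L2_restriction_tendsto[OF f cut_sets cut_incseq cut_Union] \<open>0 < \<epsilon>\<close>])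
  then obtain n where "L2_norm M (\<lambda>x. f x - indicator (cut n) x * f x) < \<epsilon>"
    by (auto simp: eventually_sequentially)
  then show "\<exists>g\<in>Domain D. L2_norm M (\<lambda>x. f x - g x) < \<epsilon>"
    by (intro bexI[OF _ DomainI[OF cut_D[OF f, of n]]])
qed

lemma D_inner:
  assumes "(f, k) \<in> D" "(g, h) \<in> D"
  shows "L2_inner M k g = L2_inner M f h"
proof -
  have [measurable]: "f \<in> borel_measurable M" "g \<in> borel_measurable M"
    "h \<in> borel_measurable M" "k \<in> borel_measurable M"
    using assms by (auto simp: D_iff L2_def)
  have "AE x in M. k x = of_real (m x) * f x" "AE x in M. h x = of_real (m x) * g x"
    using assms by (auto simp: D_iff)
  then have "AE x in M. k x * cnj (g x) = f x * cnj (h x)" by eventually_elim simp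
  then show ?thesis unfolding L2_inner_def by (intro integral_cong_AE) measurable
qed

text \<open>The nontrivial inclusion is maximality of the domain. A pair \<open>(g, h)\<close> of
  the adjoint satisfies \<open>h = m g\<close> on each \<open>cut n\<close>, where everything is
  bounded, hence almost everywhere, and \<open>h\<close> is in L2 by assumption.\<close>

lemma D_self_adjoint: "L2_adjoint M D = D"
proof (intro equalityI subsetI)
  fix p assume "p \<in> D"
  then show "p \<in> L2_adjoint M D"
    using D_inner by (cases p) (auto simp: L2_adjoint_def D_iff)
next
  fix p assume p: "p \<in> L2_adjoint M D"
  obtain g h where gh: "p = (g, h)" by (cases p)
  have g: "g \<in> L2 M" and h: "h \<in> L2 M" and adj: "\<And>f k. (f, k) \<in> D \<Longrightarrow> L2_inner M k g = L2_inner M f h"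
    using p unfolding gh L2_adjoint_def by auto
  have [measurable]: "g \<in> borel_measurable M" "h \<in> borel_measurable M"
    using g h by (auto simp: L2_def)
  have "AE x in M. x \<in> cut n \<longrightarrow> h x = of_real (m x) * g x" for n
  proof -
    \<comment> \<open>The truncated defect \<open>m g - h\<close> is used as its own test vector;
      the adjoint relation then reads that its squared norm is 0.\<close>
    define f where "f x = of_real (m x) * (indicator (cut n) x * g x) - indicator (cut n) x * h x" for x
    have f: "f \<in> L2 M" unfolding f_def[abs_def] by (intro L2_diff cut_L2 g h)
    have fc: "indicator (cut n) x * f x = f x" for x
      by (simp add: f_def indicator_def)
    have D: "(f, \<lambda>x. of_real (m x) * f x) \<in> D"
      using cut_D[OF f, of n] unfolding fc .
    have i: "integrable M (\<lambda>x. of_real (m x) * f x * cnj (g x))" "integrable M (\<lambda>x. f x * cnj (h x))"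
      using D g h by (auto simp: D_iff intro!: L2_integrable_prod)
    have "(\<integral>x. of_real (m x) * f x * cnj (g x) - f x * cnj (h x) \<partial>M) = 0"
      using adj[OF D] i by (simp add: L2_inner_def)
    moreover have "of_real (m x) * f x * cnj (g x) - f x * cnj (h x) = f x * cnj (f x)" for x
      by (simp add: f_def indicator_def algebra_simps)
    ultimately have "L2_inner M f f = 0" by (simp add: L2_inner_def)
    then have "AE x in M. f x = 0"
      using L2_norm_eq_0[OF f] by (simp add: L2_inner_self L2_eq_def)
    then show ?thesis by (rule AE_mp) (auto simp: f_def)
  qed
  then have "AE x in M. \<forall>n. x \<in> cut n \<longrightarrow> h x = of_real (m x) * g x"
    by (simp only: AE_all_countable simp_thms)
  then have "AE x in M. h x = of_real (m x) * g x"
  proof (rule AE_mp, intro AE_I2 impI)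
    fix x assume "x \<in> space M" "\<forall>n. x \<in> cut n \<longrightarrow> h x = of_real (m x) * g x"
    then show "h x = of_real (m x) * g x" using cut_Union by auto
  qed
  then show "p \<in> D" using g h by (simp add: gh D_iff)
qed

lemma D_positive: "L2_positive_operator M D"
  unfolding L2_positive_operator_def
proof (intro conjI D_L2_operator D_densely_defined D_self_adjoint)
  have "Im (L2_inner M g f) = 0 \<and> 0 \<le> Re (L2_inner M g f)" if fg: "(f, g) \<in> D" for f g
  proof -
    have [measurable]: "f \<in> borel_measurable M" "g \<in> borel_measurable M"
      using fg by (auto simp: D_iff L2_def)
    have "L2_inner M g f = (\<integral>x. complex_of_real (m x * (cmod (f x))\<^sup>2) \<partial>M)"
      unfolding L2_inner_def
    proof (rule integral_cong_AE)
      have "AE x in M. g x = of_real (m x) * f x" using fg by (simp add: D_iff)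
      then show "AE x in M. g x * cnj (f x) = complex_of_real (m x * (cmod (f x))\<^sup>2)"
        by eventually_elim (simp add: complex_norm_square mult.assoc del: of_real_power)
    qed measurable
    also have "\<dots> = complex_of_real (\<integral>x. m x * (cmod (f x))\<^sup>2 \<partial>M)"
      by (rule integral_complex_of_real)
    finally have "L2_inner M g f = complex_of_real (\<integral>x. m x * (cmod (f x))\<^sup>2 \<partial>M)" .
    moreover have "0 \<le> (\<integral>x. m x * (cmod (f x))\<^sup>2 \<partial>M)"
      using m_pos by (intro integral_nonneg_AE AE_I2) (simp add: less_imp_le)
    ultimately show ?thesis by simp
  qed
  then show "\<forall>(f, g)\<in>D. Im (L2_inner M g f) = 0 \<and> 0 \<le> Re (L2_inner M g f)" by blast
qed

lemma D_nonsingular: "L2_nonsingular M D"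
proof -
  have "L2_eq M f (\<lambda>_. 0)" if fg: "(f, g) \<in> D" and g: "L2_eq M g (\<lambda>_. 0)" for f g
  proof -
    have "AE x in M. g x = of_real (m x) * f x" "AE x in M. g x = 0"
      using fg g by (auto simp: D_iff L2_eq_def)
    moreover have "AE x in M. 0 < m x" using m_pos by (rule AE_I2)
    ultimately have "AE x in M. f x = 0" by eventually_elim auto
    then show ?thesis by (simp add: L2_eq_def)
  qed
  then show ?thesis unfolding L2_nonsingular_def by blast
qed

end

text \<open>The graphs must agree including domains. The step that matters is that \<open>f\<close>
  and \<open>m f\<close> in L2 force \<open>sqrt m f\<close> into L2, so that the square of the root
  has the full domain of multiplication by \<open>m\<close>.\<close>

lemma L2_mult_operator_sqrt:
  assumes "multiplication_operator M m"
  shows "L2_positive_sqrt M (L2_mult_operator M (\<lambda>x. complex_of_real (m x)))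
    (L2_mult_operator M (\<lambda>x. complex_of_real (sqrt (m x))))"
proof -
  interpret m: multiplication_operator M m by fact
  interpret s: multiplication_operator M "\<lambda>x. sqrt (m x)"
    by unfold_locales (use m.m_pos in auto)
  have sqrt: "complex_of_real (sqrt (m x)) * complex_of_real (sqrt (m x)) = complex_of_real (m x)"
    if "0 < m x" for x
    using that by (simp flip: of_real_mult)
  have pos: "AE x in M. 0 < m x" using m.m_pos by (rule AE_I2)
  have "s.D O s.D = m.D"
  proof (intro equalityI subsetI)
    fix p assume "p \<in> s.D O s.D"
    then obtain f h g where p: "p = (f, g)" "(f, h) \<in> s.D" "(h, g) \<in> s.D" by auto
    have "AE x in M. h x = of_real (sqrt (m x)) * f x" "AE x in M. g x = of_real (sqrt (m x)) * h x"
      using p by (auto simp: s.D_iff)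
    with pos have "AE x in M. g x = of_real (m x) * f x"
      by eventually_elim (simp add: mult.assoc[symmetric] sqrt)
    then show "p \<in> m.D" using p by (auto simp: m.D_iff s.D_iff)
  next
    fix p assume "p \<in> m.D"
    then obtain f g where p: "p = (f, g)" and fg: "(f, g) \<in> m.D" by (cases p) auto
    have f: "f \<in> L2 M" and g: "g \<in> L2 M" and eq: "AE x in M. g x = of_real (m x) * f x"
      using fg by (auto simp: m.D_iff)
    note [measurable] = L2_measurable[OF f] L2_measurable[OF g]
    define h where "h x = of_real (sqrt (m x)) * f x" for x
    have [measurable]: "h \<in> borel_measurable M" unfolding h_def[abs_def] by measurable
    have "integrable M (\<lambda>x. (cmod (f x))\<^sup>2 + (cmod (g x))\<^sup>2)" using f g by (auto simp: L2_def)
    then have "integrable M (\<lambda>x. (cmod (h x))\<^sup>2)"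
    proof (rule Bochner_Integration.integrable_bound)
      show "AE x in M. norm ((cmod (h x))\<^sup>2) \<le> norm ((cmod (f x))\<^sup>2 + (cmod (g x))\<^sup>2)"
        using eq pos
      proof eventually_elim
        case (elim x)
        \<comment> \<open>The squared modulus of \<open>sqrt m f\<close> is the geometric mean of
          those of \<open>f\<close> and \<open>m f\<close>, hence bounded by their sum.\<close>
        have "(cmod (h x))\<^sup>2 = cmod (f x) * cmod (g x)"
          using elim by (simp add: h_def norm_mult power_mult_distrib power2_eq_square)
        also have "\<dots> \<le> (cmod (f x))\<^sup>2 + (cmod (g x))\<^sup>2"
          using sum_squares_bound[of "cmod (f x)" "cmod (g x)", unfolded mult.assoc]
            mult_nonneg_nonneg[OF norm_ge_zero[of "f x"] norm_ge_zero[of "g x"]] by linarith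
        finally show ?case by simp
      qed
    qed measurable
    then have h: "h \<in> L2 M" by (simp add: L2_def)
    have "AE x in M. g x = of_real (sqrt (m x)) * h x"
      using eq pos by eventually_elim (simp add: h_def mult.assoc[symmetric] sqrt)
    then have "(f, h) \<in> s.D" "(h, g) \<in> s.D" using f g h by (auto simp: s.D_iff h_def)
    then show "p \<in> s.D O s.D" unfolding p by blast
  qed
  then show ?thesis using s.D_positive by (simp add: L2_positive_sqrt_def)
qed

section \<open>Matrix coefficients\<close>

lemma AE_density_positive:
  assumes "f \<in> borel_measurable M" "\<And>x. x \<in> space M \<Longrightarrow> 0 < f x"
  shows "(AE x in density M (\<lambda>x. ennreal (f x)). P x) \<longleftrightarrow> (AE x in M. P x)"
proof -
  have "(AE x in density M (\<lambda>x. ennreal (f x)). P x) \<longleftrightarrow> (AE x in M. 0 < ennreal (f x) \<longrightarrow> P x)"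
    by (rule AE_density) (use assms(1) in measurable)
  also have "\<dots> \<longleftrightarrow> (AE x in M. P x)"
    using assms(2) by (intro AE_cong) simp
  finally show ?thesis .
qed

locale cocycle_pair = haar_action Q TQ \<mu>Q V TV \<mu>V act
  for Q :: "'q monoid" (structure) and TQ \<mu>Q and V :: "'v monoid" and TV \<mu>V and act +
  fixes \<mu>V' :: "('v \<Rightarrow> complex) measure" and \<eta> :: "'q \<Rightarrow> 'v \<Rightarrow> complex"
    and \<beta> :: "'q \<Rightarrow> 'q \<Rightarrow> 'v" and b :: "'q \<Rightarrow> 'q \<Rightarrow> complex"
  assumes sets_dual: "sets \<mu>V' = sets (borel_of (dual_topology V TV))"
    and \<eta>: "\<eta> \<in> continuous_dual_1cocycles Q TQ V TV act"
    and \<beta>: "\<beta> \<in> borel_2cocycles Q TQ V TV act"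
    and ess_bij: "essentially_bijective \<mu>Q \<mu>V' \<eta>"
    and normalization_Q: "\<And>f. f \<in> borel_measurable \<mu>V' \<Longrightarrow>
        (\<integral>\<^sup>+q. f (\<eta> q) * ennreal (1 / modulus \<mu>V act q) \<partial>\<mu>Q) = (\<integral>\<^sup>+\<xi>. f \<xi> \<partial>\<mu>V')"
    and normalization_V: "fourier_unitary \<mu>V \<mu>V'"
    and b: "b \<in> circle_2cochains TQ"
    and psi_b: "\<And>q1 q2 q3. q1 \<in> carrier Q \<Longrightarrow> q2 \<in> carrier Q \<Longrightarrow> q3 \<in> carrier Q \<Longrightarrow>
        psi_cocycle Q \<eta> \<beta> q1 q2 q3 = coboundary2 Q b q1 q2 q3"
begin

abbreviation mo :: "'q \<Rightarrow> real" where
  "mo \<equiv> modulus \<mu>V act"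

text \<open>The weight is dictated by the normalization of \<open>dq\<close>: with it,
  \<open>\<eta>\<close> carries this measure to the given Haar measure on the dual group.\<close>

definition \<nu> :: "'q measure" where
  "\<nu> = density \<mu>Q (\<lambda>q. ennreal (1 / mo q))"

section \<open>Pointwise rules and measurability of the cocycles\<close>

lemma \<eta>_continuous: "continuous_map TQ (dual_topology V TV) \<eta>"
  using \<eta> by (simp add: continuous_dual_1cocycles_def)

lemma \<eta>_character: "q \<in> carrier Q \<Longrightarrow> \<eta> q \<in> characters V TV"
  using continuous_map_funspace[OF \<eta>_continuous] topspace_dual_topology[of V TV] Q.topspace_eq by auto

lemma \<eta>_norm: "q \<in> carrier Q \<Longrightarrow> v \<in> carrier V \<Longrightarrow> cmod (\<eta> q v) = 1"
  and \<eta>_hom: "q \<in> carrier Q \<Longrightarrow> v \<in> carrier V \<Longrightarrow> w \<in> carrier V \<Longrightarrow> \<eta> q (v \<otimes>\<^bsub>V\<^esub> w) = \<eta> q v * \<eta> q w"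
  using \<eta>_character by (auto simp: characters_def)

lemma \<eta>_one: "q \<in> carrier Q \<Longrightarrow> \<eta> q \<one>\<^bsub>V\<^esub> = 1"
  using \<eta>_hom[of q "\<one>\<^bsub>V\<^esub>" "\<one>\<^bsub>V\<^esub>"] \<eta>_norm[of q "\<one>\<^bsub>V\<^esub>"] by auto

lemma \<eta>_cnj_self: "q \<in> carrier Q \<Longrightarrow> v \<in> carrier V \<Longrightarrow> \<eta> q v * cnj (\<eta> q v) = 1"
  using \<eta>_norm by (simp add: complex_norm_square[symmetric])

lemma \<eta>_inv:
  assumes "q \<in> carrier Q" "v \<in> carrier V"
  shows "\<eta> q (inv\<^bsub>V\<^esub> v) = cnj (\<eta> q v)"
proof -
  have "\<eta> q v * \<eta> q (inv\<^bsub>V\<^esub> v) = \<eta> q v * cnj (\<eta> q v)"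
    using \<eta>_hom[of q v "inv\<^bsub>V\<^esub> v"] \<eta>_one \<eta>_cnj_self assms by simp
  moreover have "\<eta> q v \<noteq> 0" using \<eta>_norm[OF assms] by auto
  ultimately show ?thesis by simp
qed

lemma \<eta>_cocycle:
  assumes "q1 \<in> carrier Q" "q2 \<in> carrier Q" "v \<in> carrier V"
  shows "\<eta> (q1 \<otimes> q2) v = \<eta> q1 v * \<eta> q2 (act (inv q1) v)"
  using \<eta> assms by (simp add: continuous_dual_1cocycles_def dual_group_def dual_action_def)

lemma measurable_\<eta>: "\<eta> \<in> \<mu>Q \<rightarrow>\<^sub>M \<mu>V'"
  using continuous_map_borel_of[OF \<eta>_continuous Q.sets_haar]
  by (subst measurable_cong_sets[OF refl sets_dual])

lemma measurable_\<eta>_pairing: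
  assumes "f \<in> M \<rightarrow>\<^sub>M \<mu>Q" "g \<in> M \<rightarrow>\<^sub>M \<mu>V"
  shows "(\<lambda>x. \<eta> (f x) (g x)) \<in> borel_measurable M"
proof -
  have "(\<lambda>(q, v). \<eta> q v) \<in> \<mu>Q \<Otimes>\<^sub>M \<mu>V \<rightarrow>\<^sub>M borel_of euclidean"
    by (rule continuous_map_prod_measurable[OF Q.second_countable V.second_countable
        continuous_dual_joint[OF \<eta>_continuous V.locally_compact V.Hausdorff]])
      (simp_all add: Q.sets_haar V.sets_haar)
  from measurable_compose[OF measurable_Pair[OF assms] this] show ?thesis
    by (simp add: borel_of_euclidean)
qed

lemma b_circle_measurable: "(\<lambda>(q1, q2). b q1 q2) \<in> \<mu>Q \<Otimes>\<^sub>M \<mu>Q \<rightarrow>\<^sub>M borel_of circle_topology"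
  using b measurable_cong_sets[OF sets_pair_measure_cong[OF Q.sets_haar Q.sets_haar] refl]
  unfolding borel_2cochains_def by auto

lemma b_norm: "q1 \<in> carrier Q \<Longrightarrow> q2 \<in> carrier Q \<Longrightarrow> cmod (b q1 q2) = 1"
  using b_circle_measurable unfolding measurable_circle_topology
  by (auto simp: space_pair_measure Q.space_haar)

lemma measurable_b:
  assumes "f \<in> M \<rightarrow>\<^sub>M \<mu>Q" "g \<in> M \<rightarrow>\<^sub>M \<mu>Q"
  shows "(\<lambda>x. b (f x) (g x)) \<in> borel_measurable M"
proof -
  have "(\<lambda>(q1, q2). b q1 q2) \<in> borel_measurable (\<mu>Q \<Otimes>\<^sub>M \<mu>Q)"
    using b_circle_measurable unfolding measurable_circle_topology by simp
  from measurable_compose[OF measurable_Pair[OF assms] this] show ?thesis by simp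
qed

lemma measurable_\<beta>:
  assumes "f \<in> M \<rightarrow>\<^sub>M \<mu>Q" "g \<in> M \<rightarrow>\<^sub>M \<mu>Q"
  shows "(\<lambda>x. \<beta> (f x) (g x)) \<in> M \<rightarrow>\<^sub>M \<mu>V"
proof -
  have "(\<lambda>(q1, q2). \<beta> q1 q2) \<in> \<mu>Q \<Otimes>\<^sub>M \<mu>Q \<rightarrow>\<^sub>M \<mu>V"
    using \<beta> measurable_cong_sets[OF sets_pair_measure_cong[OF Q.sets_haar Q.sets_haar] V.sets_haar]
    unfolding borel_2cocycles_def borel_2cochains_def by auto
  from measurable_compose[OF measurable_Pair[OF assms] this] show ?thesis by simp
qed

lemma \<beta>_closed: "q1 \<in> carrier Q \<Longrightarrow> q2 \<in> carrier Q \<Longrightarrow> \<beta> q1 q2 \<in> carrier V"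
  using measurable_space[OF measurable_\<beta>[OF measurable_fst measurable_snd], of "(q1, q2)"]
  by (simp add: space_pair_measure Q.space_haar V.space_haar)

text \<open>The relation \<open>\<psi> = \<partial>b\<close> cleared of denominators. Both the
  product rule of the representation and the cocycle identity of its multiplier reduce to
  it.\<close>

lemma \<eta>_\<beta>:
  assumes q: "q1 \<in> carrier Q" "q2 \<in> carrier Q" "q3 \<in> carrier Q"
  shows "\<eta> (inv q1) (\<beta> q2 q3) * (b q1 q2 * b (q1 \<otimes> q2) q3) = b q2 q3 * b q1 (q2 \<otimes> q3)"
proof -
  have "b q1 q2 \<noteq> 0" "b (q1 \<otimes> q2) q3 \<noteq> 0"
    using b_norm[of q1 q2] b_norm[of "q1 \<otimes> q2" q3] q by auto
  then show ?thesis
    using psi_b[OF q] unfolding psi_cocycle_def coboundary2_def by (simp add: field_simps)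
qed

section \<open>Transfer of the Fourier transform from the dual group to the group\<close>

lemma mo_measurable [measurable]: "mo \<in> borel_measurable \<mu>Q"
  by (rule measurable_modulus)

lemma mo_pos: "q \<in> space \<mu>Q \<Longrightarrow> 0 < mo q"
  by (simp add: modulus_pos Q.space_haar)

lemma sets_\<nu>: "sets \<nu> = sets \<mu>Q" and space_\<nu>: "space \<nu> = carrier Q"
  by (simp_all add: \<nu>_def Q.space_haar)

lemma measurable_\<nu>: "measurable \<nu> N = measurable \<mu>Q N"
  by (rule measurable_cong_sets[OF sets_\<nu> refl])

lemma AE_\<nu>: "(AE q in \<nu>. P q) \<longleftrightarrow> (AE q in \<mu>Q. P q)"
  unfolding \<nu>_def using mo_pos by (intro AE_density_positive) auto

lemma sigma_finite_\<nu>: "sigma_finite_measure \<nu>"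
proof -
  interpret sigma_finite_measure \<mu>Q by (rule Q.sigma_finite)
  show ?thesis unfolding \<nu>_def by (subst sigma_finite_iff_density_finite) auto
qed

lemma distr_\<eta>: "distr \<nu> \<mu>V' \<eta> = \<mu>V'"
proof (rule measure_eqI)
  fix A assume "A \<in> sets (distr \<nu> \<mu>V' \<eta>)"
  then have A: "A \<in> sets \<mu>V'" by simp
  have m: "\<eta> \<in> \<nu> \<rightarrow>\<^sub>M \<mu>V'" by (simp add: measurable_\<nu> measurable_\<eta>)
  have ind: "(\<lambda>q. indicator A (\<eta> q) :: ennreal) \<in> borel_measurable \<mu>Q"
    by (rule measurable_compose[OF measurable_\<eta> borel_measurable_indicator[OF A]])
  have "emeasure (distr \<nu> \<mu>V' \<eta>) A = (\<integral>\<^sup>+\<xi>. indicator A \<xi> \<partial>distr \<nu> \<mu>V' \<eta>)" using A by simp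
  also have "\<dots> = (\<integral>\<^sup>+q. indicator A (\<eta> q) \<partial>\<nu>)"
    using A by (intro nn_integral_distr[OF m]) simp
  also have "\<dots> = (\<integral>\<^sup>+q. ennreal (1 / mo q) * indicator A (\<eta> q) \<partial>\<mu>Q)"
    unfolding \<nu>_def by (rule nn_integral_density[OF _ ind]) measurable
  also have "\<dots> = (\<integral>\<^sup>+\<xi>. indicator A \<xi> \<partial>\<mu>V')"
    using normalization_Q[of "indicator A"] A by (simp add: mult.commute)
  finally show "emeasure (distr \<nu> \<mu>V' \<eta>) A = emeasure \<mu>V' A" using A by simp
qed simp

lemma measurable_\<eta>_\<nu>: "\<eta> \<in> \<nu> \<rightarrow>\<^sub>M \<mu>V'"
  by (simp add: measurable_\<nu> measurable_\<eta>)

lemma L2_compose_\<eta>: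
  assumes "h \<in> borel_measurable \<mu>V'"
  shows "(\<lambda>q. h (\<eta> q)) \<in> L2 \<nu> \<longleftrightarrow> h \<in> L2 \<mu>V'"
proof -
  have "integrable (distr \<nu> \<mu>V' \<eta>) (\<lambda>\<xi>. (cmod (h \<xi>))\<^sup>2) \<longleftrightarrow> integrable \<nu> (\<lambda>q. (cmod (h (\<eta> q)))\<^sup>2)"
    using assms by (intro integrable_distr_eq measurable_\<eta>_\<nu>) measurable
  then show ?thesis
    using assms measurable_compose[OF measurable_\<eta>_\<nu> assms] by (simp add: L2_def distr_\<eta>)
qed

lemma AE_compose_\<eta>:
  assumes "AE \<xi> in \<mu>V'. P \<xi>"
  shows "AE q in \<nu>. P (\<eta> q)"
proof -
  have "AE \<xi> in distr \<nu> \<mu>V' \<eta>. P \<xi>" unfolding distr_\<eta> by fact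
  then show ?thesis by (rule AE_distrD[OF measurable_\<eta>_\<nu>])
qed

lemma L2_inner_compose_\<eta>:
  assumes "f \<in> L2 \<mu>V'" "g \<in> L2 \<mu>V'"
  shows "L2_inner \<nu> (\<lambda>q. f (\<eta> q)) (\<lambda>q. g (\<eta> q)) = L2_inner \<mu>V' f g"
proof -
  have [measurable]: "f \<in> borel_measurable \<mu>V'" "g \<in> borel_measurable \<mu>V'"
    using assms by (auto simp: L2_def)
  have "(\<integral>\<xi>. f \<xi> * cnj (g \<xi>) \<partial>distr \<nu> \<mu>V' \<eta>) = (\<integral>q. f (\<eta> q) * cnj (g (\<eta> q)) \<partial>\<nu>)"
    by (intro integral_distr measurable_\<eta>_\<nu>) measurable
  then show ?thesis by (simp add: L2_inner_def distr_\<eta>)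
qed

text \<open>Essential bijectivity enters here: composing \<open>h\<close> with the measurable
  inverse of \<open>\<eta>\<close> yields \<open>k\<close>. Without it, functions of the form
  \<open>k\<close> composed with \<open>\<eta>\<close> could miss part of L2, and the pulled-back
  transform would not be onto.\<close>

lemma L2_factor_\<eta>:
  assumes h: "h \<in> L2 \<nu>"
  obtains k where "k \<in> L2 \<mu>V'" "AE q in \<nu>. k (\<eta> q) = h q"
proof -
  obtain A B where A: "A \<in> null_sets \<mu>Q" and B: "B \<in> null_sets \<mu>V'"
    and bij: "bij_betw \<eta> (space \<mu>Q - A) (space \<mu>V' - B)"
    and inv: "inv_into (space \<mu>Q - A) \<eta> \<in>
      restrict_space \<mu>V' (space \<mu>V' - B) \<rightarrow>\<^sub>M restrict_space \<mu>Q (space \<mu>Q - A)"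
    using ess_bij unfolding essentially_bijective_def by (elim bexE conjE) (rule that)
  define \<theta> where "\<theta> = inv_into (space \<mu>Q - A) \<eta>"
  \<comment> \<open>Outside the exceptional set \<open>A\<close> the values of \<open>\<eta>\<close>
    avoid \<open>B\<close>, so the default 0 on \<open>B\<close> is seen only on a null set.\<close>
  define k where "k \<xi> = (if \<xi> \<in> space \<mu>V' - B then h (\<theta> \<xi>) else 0)" for \<xi>
  have hm: "h \<in> borel_measurable \<mu>Q" using L2_measurable[OF h] by (simp add: measurable_\<nu>)
  have "h \<in> borel_measurable (restrict_space \<mu>Q (space \<mu>Q - A))"
    by (rule measurable_restrict_space1[OF hm])
  from measurable_compose[OF inv this]
  have "(\<lambda>\<xi>. h (\<theta> \<xi>)) \<in> borel_measurable (restrict_space \<mu>V' (space \<mu>V' - B))"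
    by (simp add: \<theta>_def)
  moreover have "(space \<mu>V' - B) \<inter> space \<mu>V' \<in> sets \<mu>V'" using B by auto
  ultimately have k: "k \<in> borel_measurable \<mu>V'"
    unfolding k_def[abs_def] by (subst measurable_restrict_space_iff[symmetric]) auto
  have "k (\<eta> q) = h q" if "q \<in> space \<mu>Q - A" for q
    using that bij bij_betwE[OF bij] inv_into_f_f[of \<eta> "space \<mu>Q - A" q]
    by (simp add: k_def \<theta>_def bij_betw_def)
  then have "AE q in \<mu>Q. k (\<eta> q) = h q"
    by (intro AE_I'[OF A]) auto
  then have AE: "AE q in \<nu>. k (\<eta> q) = h q" by (simp add: AE_\<nu>)
  then have "AE q in \<nu>. h q = k (\<eta> q)" by eventually_elim simp
  from L2_cong_AE[OF h measurable_compose[OF measurable_\<eta>_\<nu> k] this]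
  have "k \<in> L2 \<mu>V'" by (simp add: L2_compose_\<eta>[OF k])
  then show thesis using AE by (rule that)
qed

text \<open>The map \<open>f \<mapsto> F f\<close> composed with \<open>\<eta>\<close> is isometric
  because \<open>\<eta>\<close> pushes \<open>\<nu>\<close> to \<open>\<mu>V'\<close>, and onto by
  \<open>L2_factor_\<eta>\<close>. The algebraic conditions on the kernel are the homomorphism rules
  of characters.\<close>

lemma fourier_kernel_exists: "\<exists>F. fourier_kernel \<nu> \<mu>V \<eta> F"
proof -
  obtain F where unitary: "L2_unitary \<mu>V \<mu>V' F"
    and F1: "\<And>f. f \<in> L2 \<mu>V \<Longrightarrow> integrable \<mu>V f \<Longrightarrow> L2_eq \<mu>V' (F f) (fourier \<mu>V f)"
    using normalization_V unfolding fourier_unitary_def by (elim exE conjE) (rule that, auto)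
  have FL: "\<And>f. f \<in> L2 \<mu>V \<Longrightarrow> F f \<in> L2 \<mu>V'"
    and Feq: "\<And>f g. f \<in> L2 \<mu>V \<Longrightarrow> g \<in> L2 \<mu>V \<Longrightarrow> L2_eq \<mu>V f g \<Longrightarrow> L2_eq \<mu>V' (F f) (F g)"
    and Flin: "\<And>f g a b. f \<in> L2 \<mu>V \<Longrightarrow> g \<in> L2 \<mu>V \<Longrightarrow>
      L2_eq \<mu>V' (F (\<lambda>x. a * f x + b * g x)) (\<lambda>y. a * F f y + b * F g y)"
    and Finn: "\<And>f g. f \<in> L2 \<mu>V \<Longrightarrow> g \<in> L2 \<mu>V \<Longrightarrow> L2_inner \<mu>V' (F f) (F g) = L2_inner \<mu>V f g"
    and Fsurj: "\<And>h. h \<in> L2 \<mu>V' \<Longrightarrow> \<exists>f\<in>L2 \<mu>V. L2_eq \<mu>V' (F f) h"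
    using unitary unfolding L2_unitary_def by auto
  define F' where "F' f = (\<lambda>q. F f (\<eta> q))" for f
  have "L2_unitary \<mu>V \<nu> F'"
    unfolding L2_unitary_def
  proof (intro conjI ballI allI impI)
    fix f g a b assume f: "f \<in> L2 \<mu>V" and g: "g \<in> L2 \<mu>V"
    show "F' f \<in> L2 \<nu>"
      unfolding F'_def by (simp add: L2_compose_\<eta> L2_measurable FL f)
    show "L2_eq \<nu> (F' f) (F' g)" if "L2_eq \<mu>V f g"
      using AE_compose_\<eta> Feq[OF f g that] unfolding L2_eq_def F'_def .
    show "L2_eq \<nu> (F' (\<lambda>x. a * f x + b * g x)) (\<lambda>y. a * F' f y + b * F' g y)"
      using AE_compose_\<eta> Flin[OF f g, of a b] unfolding L2_eq_def F'_def .
    show "L2_inner \<nu> (F' f) (F' g) = L2_inner \<mu>V f g"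
      unfolding F'_def L2_inner_compose_\<eta>[OF FL[OF f] FL[OF g]] by (rule Finn[OF f g])
  next
    fix h assume h: "h \<in> L2 \<nu>"
    obtain k where k: "k \<in> L2 \<mu>V'" "AE q in \<nu>. k (\<eta> q) = h q" by (rule L2_factor_\<eta>[OF h])
    obtain f where f: "f \<in> L2 \<mu>V" "AE \<xi> in \<mu>V'. F f \<xi> = k \<xi>"
      using Fsurj[OF k(1)] by (auto simp: L2_eq_def)
    have "AE q in \<nu>. F' f q = h q"
      using AE_compose_\<eta>[OF f(2)] k(2) unfolding F'_def by eventually_elim simp
    then show "\<exists>f\<in>L2 \<mu>V. L2_eq \<nu> (F' f) h" using f(1) by (auto simp: L2_eq_def)
  qed
  moreover have "L2_eq \<nu> (F' f) (\<lambda>x. \<integral>v. cnj (\<eta> x v) * f v \<partial>\<mu>V)"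
    if "f \<in> L2 \<mu>V" "integrable \<mu>V f" for f
    using AE_compose_\<eta> F1[OF that] unfolding L2_eq_def F'_def fourier_def .
  moreover have "\<exists>f'\<in>L2 \<mu>V. integrable \<mu>V f' \<and> (\<forall>x\<in>space \<nu>.
      (\<integral>w. cnj (\<eta> x w) * f' w \<partial>\<mu>V) = \<eta> x v * (\<integral>w. cnj (\<eta> x w) * f w \<partial>\<mu>V))"
    if v: "v \<in> space \<mu>V" and f: "f \<in> L2 \<mu>V" "integrable \<mu>V f" for v f
  proof (intro bexI conjI ballI)
    have v': "v \<in> carrier V" using v by (simp add: V.space_haar)
    have fm: "f \<in> borel_measurable \<mu>V" by (rule L2_measurable[OF f(1)])
    \<comment> \<open>The transform carries the conjugate character, so the shift by
      \<open>v\<close>, and not by its inverse, multiplies it by \<open>\<eta> x v\<close>.\<close>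
    show "(\<lambda>w. f (v \<otimes>\<^bsub>V\<^esub> w)) \<in> L2 \<mu>V"
      using f(1) measurable_compose[OF V.measurable_lmult[OF v'] fm]
        V.integrable_translate[OF v', of "\<lambda>x. (cmod (f x))\<^sup>2"] fm
      by (simp add: L2_def)
    show "integrable \<mu>V (\<lambda>w. f (v \<otimes>\<^bsub>V\<^esub> w))" using V.integrable_translate[OF v' fm] f(2) by simp
    fix x assume "x \<in> space \<nu>"
    then have x: "x \<in> carrier Q" by (simp add: space_\<nu>)
    have "(\<lambda>w. \<eta> x (inv\<^bsub>V\<^esub> v \<otimes>\<^bsub>V\<^esub> w)) \<in> borel_measurable \<mu>V"
      using x v' by (intro measurable_\<eta>_pairing Q.measurable_const_carrier V.measurable_lmult) auto
    then have "(\<lambda>w. cnj (\<eta> x (inv\<^bsub>V\<^esub> v \<otimes>\<^bsub>V\<^esub> w)) * f w) \<in> borel_measurable \<mu>V"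
      using fm by measurable
    from V.integral_translate[OF v' this]
    have "(\<integral>w. cnj (\<eta> x (inv\<^bsub>V\<^esub> v \<otimes>\<^bsub>V\<^esub> (v \<otimes>\<^bsub>V\<^esub> w))) * f (v \<otimes>\<^bsub>V\<^esub> w) \<partial>\<mu>V) =
        (\<integral>w. cnj (\<eta> x (inv\<^bsub>V\<^esub> v \<otimes>\<^bsub>V\<^esub> w)) * f w \<partial>\<mu>V)" .
    also have "(\<integral>w. cnj (\<eta> x (inv\<^bsub>V\<^esub> v \<otimes>\<^bsub>V\<^esub> (v \<otimes>\<^bsub>V\<^esub> w))) * f (v \<otimes>\<^bsub>V\<^esub> w) \<partial>\<mu>V) =
        (\<integral>w. cnj (\<eta> x w) * f (v \<otimes>\<^bsub>V\<^esub> w) \<partial>\<mu>V)"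
      using v' by (intro Bochner_Integration.integral_cong refl)
        (simp add: V.space_haar V.m_assoc[symmetric])
    also have "(\<integral>w. cnj (\<eta> x (inv\<^bsub>V\<^esub> v \<otimes>\<^bsub>V\<^esub> w)) * f w \<partial>\<mu>V) =
        (\<integral>w. \<eta> x v * (cnj (\<eta> x w) * f w) \<partial>\<mu>V)"
      using v' x by (intro Bochner_Integration.integral_cong refl)
        (simp add: V.space_haar \<eta>_hom \<eta>_inv mult.assoc)
    finally show "(\<integral>w. cnj (\<eta> x w) * f (v \<otimes>\<^bsub>V\<^esub> w) \<partial>\<mu>V) = \<eta> x v * (\<integral>w. cnj (\<eta> x w) * f w \<partial>\<mu>V)"
      by simp
  qed
  ultimately have "fourier_kernel \<nu> \<mu>V \<eta> F'"
  proof (intro fourier_kernel.intro fourier_kernel_axioms.intro sigma_finite_\<nu> V.sigma_finite)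
    have "fst \<in> \<nu> \<Otimes>\<^sub>M \<mu>V \<rightarrow>\<^sub>M \<mu>Q" using measurable_fst[of \<nu> \<mu>V] measurable_cong_sets[OF refl sets_\<nu>] by auto
    then show "(\<lambda>p. \<eta> (fst p) (snd p)) \<in> borel_measurable (\<nu> \<Otimes>\<^sub>M \<mu>V)"
      by (intro measurable_\<eta>_pairing measurable_snd)
    show "cmod (\<eta> x v) = 1" if "x \<in> space \<nu>" "v \<in> space \<mu>V" for x v
      using that by (simp add: \<eta>_norm space_\<nu> V.space_haar)
    show "\<exists>u\<in>space \<mu>V. \<forall>x\<in>space \<nu>. \<eta> x u = \<eta> x v * \<eta> x w"
      if "v \<in> space \<mu>V" "w \<in> space \<mu>V" for v w
      using that by (intro bexI[of _ "v \<otimes>\<^bsub>V\<^esub> w"]) (simp_all add: \<eta>_hom space_\<nu> V.space_haar)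
    show "\<exists>u\<in>space \<mu>V. \<forall>x\<in>space \<nu>. \<eta> x u = cnj (\<eta> x v)" if "v \<in> space \<mu>V" for v
      using that by (intro bexI[of _ "inv\<^bsub>V\<^esub> v"]) (simp_all add: \<eta>_inv space_\<nu> V.space_haar)
    show "space \<mu>V \<noteq> {}" using V.one_closed by (auto simp: V.space_haar)
  qed
  then show ?thesis by (intro exI)
qed

lemma coefficient_plancherel:
  assumes \<phi>: "\<phi>1 \<in> L2 \<mu>Q" "\<phi>2 \<in> L2 \<mu>Q" and q: "q \<in> carrier Q"
  shows "(\<integral>\<^sup>+v. ennreal ((cmod (L2_inner \<mu>Q \<phi>1 (L2_representation Q \<eta> b (q, v) \<phi>2)))\<^sup>2) \<partial>\<mu>V) =
    (\<integral>\<^sup>+x. ennreal ((cmod (\<phi>1 x))\<^sup>2 * (cmod (\<phi>2 (inv q \<otimes> x)))\<^sup>2 * mo x) \<partial>\<mu>Q)"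
proof -
  obtain F where "fourier_kernel \<nu> \<mu>V \<eta> F" using fourier_kernel_exists by auto
  then interpret K: fourier_kernel \<nu> \<mu>V \<eta> F .
  have q': "inv q \<in> carrier Q" using q by simp
  define t where "t x = \<phi>2 (inv q \<otimes> x)" for x
  have t: "t \<in> L2 \<mu>Q"
    using \<phi>(2) measurable_compose[OF Q.measurable_lmult[OF q'] L2_measurable[OF \<phi>(2)]]
      Q.integrable_translate[OF q', of "\<lambda>x. (cmod (\<phi>2 x))\<^sup>2"] L2_measurable[OF \<phi>(2)]
    by (simp add: L2_def t_def[abs_def])
  define B where "B x = b (inv x) q" for x
  have B [measurable]: "B \<in> borel_measurable \<mu>Q"
    unfolding B_def[abs_def] using q
    by (intro measurable_b Q.measurable_m_inv Q.measurable_const_carrier measurable_ident_sets refl)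
  have B1: "cmod (B x) = 1" if "x \<in> space \<mu>Q" for x
    using that q by (simp add: B_def b_norm Q.space_haar)
  note [measurable] = L2_measurable[OF \<phi>(1)] L2_measurable[OF t]
  have Bt: "(\<lambda>x. B x * t x) \<in> L2 \<mu>Q" by (rule L2_mult_bounded[OF t B, where C = 1]) (simp add: B1)
  define h where "h x = \<phi>1 x * cnj (B x * t x)" for x
  have h: "integrable \<mu>Q h" unfolding h_def[abs_def] by (rule L2_integrable_prod[OF \<phi>(1) Bt])
  have [measurable]: "h \<in> borel_measurable \<mu>Q" using h by (rule borel_measurable_integrable)
  \<comment> \<open>The factor \<open>mo x\<close> cancels the density of \<open>\<nu>\<close>,
    which makes \<open>ift k\<close> the coefficient integral against \<open>\<mu>Q\<close>. In the
    squared norm one of two such factors cancels and one remains.\<close>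
  define k where "k x = complex_of_real (mo x) * h x" for x
  have [measurable]: "k \<in> borel_measurable \<mu>Q" unfolding k_def[abs_def] by measurable
  have dens: "integral\<^sup>L \<nu> f = (\<integral>x. (1 / mo x) *\<^sub>R f x \<partial>\<mu>Q)"
    and dens_int: "integrable \<nu> f \<longleftrightarrow> integrable \<mu>Q (\<lambda>x. (1 / mo x) *\<^sub>R f x)"
    if "f \<in> borel_measurable \<mu>Q" for f :: "'q \<Rightarrow> complex"
  proof -
    have nn: "AE x in \<mu>Q. 0 \<le> 1 / mo x" using mo_pos by (intro AE_I2) (simp add: less_imp_le)
    have m: "(\<lambda>x. 1 / mo x) \<in> borel_measurable \<mu>Q" by measurable
    show "integral\<^sup>L \<nu> f = (\<integral>x. (1 / mo x) *\<^sub>R f x \<partial>\<mu>Q)"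
      unfolding \<nu>_def by (rule integral_density[OF that m nn])
    show "integrable \<nu> f \<longleftrightarrow> integrable \<mu>Q (\<lambda>x. (1 / mo x) *\<^sub>R f x)"
      unfolding \<nu>_def by (rule integrable_density[OF that m nn])
  qed
  have kh: "(1 / mo x) *\<^sub>R k x = h x" if "x \<in> space \<mu>Q" for x
    using mo_pos[OF that] by (simp add: k_def scaleR_conv_of_real)
  have k: "integrable \<nu> k"
    unfolding dens_int[OF \<open>k \<in> borel_measurable \<mu>Q\<close>]
    using h by (subst Bochner_Integration.integrable_cong[OF refl kh])
  have coeff: "L2_inner \<mu>Q \<phi>1 (L2_representation Q \<eta> b (q, v) \<phi>2) = K.ift k v"
    if "v \<in> space \<mu>V" for v
  proof -
    have v: "v \<in> carrier V" using that by (simp add: V.space_haar)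
    have m: "(\<lambda>x. \<eta> x v) \<in> borel_measurable \<mu>Q"
      using v by (intro measurable_\<eta>_pairing V.measurable_const_carrier measurable_ident_sets refl)
    have "K.ift k v = (\<integral>x. (1 / mo x) *\<^sub>R (k x * \<eta> x v) \<partial>\<mu>Q)"
      unfolding K.ift_def by (rule dens[OF borel_measurable_times[OF \<open>k \<in> borel_measurable \<mu>Q\<close> m]])
    also have "\<dots> = (\<integral>x. h x * \<eta> x v \<partial>\<mu>Q)"
      using kh by (intro Bochner_Integration.integral_cong refl) (metis mult_scaleR_left)
    also have "\<dots> = L2_inner \<mu>Q \<phi>1 (L2_representation Q \<eta> b (q, v) \<phi>2)"
      unfolding L2_inner_def by (simp add: h_def B_def t_def L2_representation_def mult_ac)
    finally show ?thesis by simp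
  qed
  have "(\<integral>\<^sup>+v. ennreal ((cmod (L2_inner \<mu>Q \<phi>1 (L2_representation Q \<eta> b (q, v) \<phi>2)))\<^sup>2) \<partial>\<mu>V) =
      (\<integral>\<^sup>+v. ennreal ((cmod (K.ift k v))\<^sup>2) \<partial>\<mu>V)"
    by (intro nn_integral_cong) (simp add: coeff)
  also have "\<dots> = (\<integral>\<^sup>+x. ennreal ((cmod (k x))\<^sup>2) \<partial>\<nu>)" by (rule K.plancherel_L1[OF k])
  also have "\<dots> = (\<integral>\<^sup>+x. ennreal (1 / mo x) * ennreal ((cmod (k x))\<^sup>2) \<partial>\<mu>Q)"
    unfolding \<nu>_def by (rule nn_integral_density) measurable
  also have "\<dots> = (\<integral>\<^sup>+x. ennreal ((cmod (\<phi>1 x))\<^sup>2 * (cmod (\<phi>2 (inv q \<otimes> x)))\<^sup>2 * mo x) \<partial>\<mu>Q)"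
  proof (rule nn_integral_cong)
    fix x assume x: "x \<in> space \<mu>Q"
    have "(1 / mo x) * (cmod (k x))\<^sup>2 = (cmod (\<phi>1 x))\<^sup>2 * (cmod (t x))\<^sup>2 * mo x"
      using mo_pos[OF x] B1[OF x]
      by (simp add: k_def h_def norm_mult power_mult_distrib power2_eq_square)
    then show "ennreal (1 / mo x) * ennreal ((cmod (k x))\<^sup>2) =
        ennreal ((cmod (\<phi>1 x))\<^sup>2 * (cmod (\<phi>2 (inv q \<otimes> x)))\<^sup>2 * mo x)"
      using mo_pos[OF x] by (simp add: ennreal_mult[symmetric] t_def)
  qed
  finally show ?thesis .
qed

end

section \<open>Matrix coefficients over the whole extension\<close>

context cocycle_pair
begin

abbreviation \<pi> :: "'q \<times> 'v \<Rightarrow> ('q \<Rightarrow> complex) \<Rightarrow> ('q \<Rightarrow> complex)" where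
  "\<pi> \<equiv> L2_representation Q \<eta> b"

abbreviation \<mu>G :: "('q \<times> 'v) measure" where
  "\<mu>G \<equiv> extension_haar \<mu>Q \<mu>V act"

abbreviation G :: "('q \<times> 'v) monoid" where
  "G \<equiv> extension_group Q V act \<beta>"

abbreviation \<Delta> :: "'q \<Rightarrow> real" where
  "\<Delta> \<equiv> modular_function Q \<mu>Q"

lemma measurable_coefficient_integrand:
  assumes "\<phi>2 \<in> borel_measurable \<mu>Q"
    and f: "f \<in> M \<rightarrow>\<^sub>M \<mu>Q" and g: "g \<in> M \<rightarrow>\<^sub>M \<mu>V" and h: "h \<in> M \<rightarrow>\<^sub>M \<mu>Q"
  shows "(\<lambda>p. \<pi> (f p, g p) \<phi>2 (h p)) \<in> borel_measurable M"
proof -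
  have "(\<lambda>p. cnj (\<eta> (h p) (g p))) \<in> borel_measurable M"
    using measurable_\<eta>_pairing[OF h g] by measurable
  moreover have "(\<lambda>p. b (inv (h p)) (f p)) \<in> borel_measurable M"
    by (intro measurable_b Q.measurable_m_inv f h)
  moreover have "(\<lambda>p. \<phi>2 (inv (f p) \<otimes> h p)) \<in> borel_measurable M"
    by (intro measurable_compose[OF _ assms(1)] Q.measurable_mult Q.measurable_m_inv f h)
  ultimately show ?thesis
    unfolding L2_representation_def by (simp add: borel_measurable_times)
qed

lemma measurable_coefficient:
  assumes "\<phi>1 \<in> L2 \<mu>Q" "\<phi>2 \<in> L2 \<mu>Q"
  shows "(\<lambda>g. L2_inner \<mu>Q \<phi>1 (\<pi> g \<phi>2)) \<in> borel_measurable (\<mu>Q \<Otimes>\<^sub>M \<mu>V)"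
proof -
  interpret sigma_finite_measure \<mu>Q by (rule Q.sigma_finite)
  note [measurable] = L2_measurable[OF assms(1)]
  have m: "(\<lambda>p. \<pi> (fst (fst p), snd (fst p)) \<phi>2 (snd p)) \<in> borel_measurable ((\<mu>Q \<Otimes>\<^sub>M \<mu>V) \<Otimes>\<^sub>M \<mu>Q)"
    by (intro measurable_coefficient_integrand L2_measurable[OF assms(2)]) measurable
  have "(\<lambda>p. \<phi>1 (snd p) * cnj (\<pi> (fst (fst p), snd (fst p)) \<phi>2 (snd p)))
      \<in> borel_measurable ((\<mu>Q \<Otimes>\<^sub>M \<mu>V) \<Otimes>\<^sub>M \<mu>Q)"
    by (intro borel_measurable_times measurable_compose[OF m borel_measurable_cnj]) measurable
  then have "(\<lambda>g. \<integral>x. \<phi>1 x * cnj (\<pi> g \<phi>2 x) \<partial>\<mu>Q) \<in> borel_measurable (\<mu>Q \<Otimes>\<^sub>M \<mu>V)"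
    by (intro borel_measurable_lebesgue_integral) (simp add: case_prod_beta')
  then show ?thesis by (simp add: L2_inner_def)
qed

text \<open>The identity holds for all L2 vectors with values in \<open>ennreal\<close>, so that the
  domain of the square root, its complement and the vanishing of coefficients can all be read off
  from it. Tonelli alone justifies the exchanges of integrals.\<close>

lemma coefficient_formula:
  assumes \<phi>: "\<phi>1 \<in> L2 \<mu>Q" "\<phi>2 \<in> L2 \<mu>Q"
  shows "(\<integral>\<^sup>+g. ennreal ((cmod (L2_inner \<mu>Q \<phi>1 (\<pi> g \<phi>2)))\<^sup>2) \<partial>\<mu>G) =
    (\<integral>\<^sup>+x. ennreal ((cmod (\<phi>1 x))\<^sup>2) \<partial>\<mu>Q) *
    (\<integral>\<^sup>+x. ennreal (mo x / \<Delta> x * (cmod (\<phi>2 x))\<^sup>2) \<partial>\<mu>Q)"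
proof -
  interpret VS: sigma_finite_measure \<mu>V by (rule V.sigma_finite)
  interpret QQ: pair_sigma_finite \<mu>Q \<mu>Q by (intro pair_sigma_finite.intro Q.sigma_finite)
  note [measurable] = L2_measurable[OF \<phi>(1)] L2_measurable[OF \<phi>(2)] Q.measurable_modular_function
  define C where "C g = ennreal ((cmod (L2_inner \<mu>Q \<phi>1 (\<pi> g \<phi>2)))\<^sup>2)" for g
  have C: "C \<in> borel_measurable (\<mu>Q \<Otimes>\<^sub>M \<mu>V)"
    unfolding C_def[abs_def] using measurable_coefficient[OF \<phi>] by measurable
  define \<Phi> where "\<Phi> y = ennreal ((cmod (\<phi>2 y))\<^sup>2 * mo y)" for y
  have \<Phi> [measurable]: "\<Phi> \<in> borel_measurable \<mu>Q" unfolding \<Phi>_def[abs_def] by measurable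
  have w: "(\<lambda>p. ennreal (1 / mo (fst p))) \<in> borel_measurable (\<mu>Q \<Otimes>\<^sub>M \<mu>V)" by measurable
  have m1: "(\<lambda>p. \<Phi> (inv (f p) \<otimes> h p)) \<in> borel_measurable M"
    if "f \<in> M \<rightarrow>\<^sub>M \<mu>Q" "h \<in> M \<rightarrow>\<^sub>M \<mu>Q" for f h and M :: "'z measure"
    using that by (intro measurable_compose[OF _ \<Phi>] Q.measurable_mult Q.measurable_m_inv)
  have "(\<integral>\<^sup>+g. C g \<partial>\<mu>G) = (\<integral>\<^sup>+p. ennreal (1 / mo (fst p)) * C p \<partial>(\<mu>Q \<Otimes>\<^sub>M \<mu>V))"
    unfolding extension_haar_def case_prod_beta' by (rule nn_integral_density[OF w C])
  also have "\<dots> = (\<integral>\<^sup>+q. \<integral>\<^sup>+v. ennreal (1 / mo q) * C (q, v) \<partial>\<mu>V \<partial>\<mu>Q)"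
    using VS.nn_integral_fst[OF borel_measurable_times_ennreal[OF w C]] by simp
  also have "\<dots> = (\<integral>\<^sup>+q. \<integral>\<^sup>+x. ennreal ((cmod (\<phi>1 x))\<^sup>2) * \<Phi> (inv q \<otimes> x) \<partial>\<mu>Q \<partial>\<mu>Q)"
  proof (rule nn_integral_cong)
    fix q assume qs: "q \<in> space \<mu>Q"
    then have q: "q \<in> carrier Q" by (simp add: Q.space_haar)
    define H where "H x = ennreal ((cmod (\<phi>1 x))\<^sup>2 * (cmod (\<phi>2 (inv q \<otimes> x)))\<^sup>2 * mo x)" for x
    have [measurable]: "(\<lambda>x. \<phi>2 (inv q \<otimes> x)) \<in> borel_measurable \<mu>Q"
      using q by (intro measurable_compose[OF Q.measurable_lmult L2_measurable[OF \<phi>(2)]]) simp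
    have H: "H \<in> borel_measurable \<mu>Q" unfolding H_def[abs_def] by measurable
    have "(\<lambda>v. C (q, v)) \<in> borel_measurable \<mu>V" using measurable_compose[OF measurable_Pair1'[OF qs] C] by simp
    then have "(\<integral>\<^sup>+v. ennreal (1 / mo q) * C (q, v) \<partial>\<mu>V) = ennreal (1 / mo q) * (\<integral>\<^sup>+v. C (q, v) \<partial>\<mu>V)"
      by (rule nn_integral_cmult)
    also have "(\<integral>\<^sup>+v. C (q, v) \<partial>\<mu>V) = (\<integral>\<^sup>+x. H x \<partial>\<mu>Q)"
      unfolding C_def H_def by (rule coefficient_plancherel[OF \<phi> q])
    also have "ennreal (1 / mo q) * (\<integral>\<^sup>+x. H x \<partial>\<mu>Q) = (\<integral>\<^sup>+x. ennreal (1 / mo q) * H x \<partial>\<mu>Q)"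
      by (rule nn_integral_cmult[OF H, symmetric])
    also have "\<dots> = (\<integral>\<^sup>+x. ennreal ((cmod (\<phi>1 x))\<^sup>2) * \<Phi> (inv q \<otimes> x) \<partial>\<mu>Q)"
    proof (rule nn_integral_cong)
      fix x assume xs: "x \<in> space \<mu>Q"
      then have x: "x \<in> carrier Q" by (simp add: Q.space_haar)
      \<comment> \<open>Multiplicativity of the modulus merges the Haar weight
        \<open>1 / mo q\<close> of the extension with the factor \<open>mo x\<close> from
        Plancherel, so that apart from \<open>\<phi>1\<close> the integrand depends only on
        \<open>inv q \<otimes> x\<close>.\<close>
      have "mo (inv q \<otimes> x) = 1 / mo q * mo x"
        using q x by (simp add: modulus_mult modulus_inv)
      then show "ennreal (1 / mo q) * H x = ennreal ((cmod (\<phi>1 x))\<^sup>2) * \<Phi> (inv q \<otimes> x)"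
        using mo_pos[OF xs] mo_pos[OF qs]
        by (simp add: H_def \<Phi>_def ennreal_mult[symmetric] mult_ac)
    qed
    finally show "(\<integral>\<^sup>+v. ennreal (1 / mo q) * C (q, v) \<partial>\<mu>V) =
        (\<integral>\<^sup>+x. ennreal ((cmod (\<phi>1 x))\<^sup>2) * \<Phi> (inv q \<otimes> x) \<partial>\<mu>Q)" .
  qed
  also have "\<dots> = (\<integral>\<^sup>+x. \<integral>\<^sup>+q. ennreal ((cmod (\<phi>1 x))\<^sup>2) * \<Phi> (inv q \<otimes> x) \<partial>\<mu>Q \<partial>\<mu>Q)"
  proof (rule QQ.Fubini')
    have "(\<lambda>p. \<Phi> (inv (snd p) \<otimes> fst p)) \<in> borel_measurable (\<mu>Q \<Otimes>\<^sub>M \<mu>Q)"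
      by (rule m1) measurable
    then have "(\<lambda>p. ennreal ((cmod (\<phi>1 (fst p)))\<^sup>2) * \<Phi> (inv (snd p) \<otimes> fst p))
        \<in> borel_measurable (\<mu>Q \<Otimes>\<^sub>M \<mu>Q)"
      by (intro borel_measurable_times_ennreal) measurable
    then show "(\<lambda>(x, q). ennreal ((cmod (\<phi>1 x))\<^sup>2) * \<Phi> (inv q \<otimes> x)) \<in> borel_measurable (\<mu>Q \<Otimes>\<^sub>M \<mu>Q)"
      by (simp only: case_prod_beta')
  qed
  also have "\<dots> = (\<integral>\<^sup>+x. ennreal ((cmod (\<phi>1 x))\<^sup>2) * (\<integral>\<^sup>+y. \<Phi> y * ennreal (1 / \<Delta> y) \<partial>\<mu>Q) \<partial>\<mu>Q)"
  proof (rule nn_integral_cong)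
    fix x assume "x \<in> space \<mu>Q"
    then have x: "x \<in> carrier Q" by (simp add: Q.space_haar)
    have m2: "(\<lambda>q. \<Phi> (inv q \<otimes> x)) \<in> borel_measurable \<mu>Q"
      by (intro m1 measurable_ident_sets[OF refl] Q.measurable_const_carrier x)
    have "(\<integral>\<^sup>+q. \<Phi> (inv q \<otimes> x) \<partial>\<mu>Q) = (\<integral>\<^sup>+q. \<Phi> (inv (x \<otimes> q) \<otimes> x) \<partial>\<mu>Q)"
      by (rule Q.nn_integral_translate[OF x m2, symmetric])
    also have "\<dots> = (\<integral>\<^sup>+q. \<Phi> (inv q) \<partial>\<mu>Q)"
    proof (rule nn_integral_cong)
      fix q assume "q \<in> space \<mu>Q"
      then have "q \<in> carrier Q" by (simp add: Q.space_haar)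
      then have "inv (x \<otimes> q) \<otimes> x = inv q"
        using x by (simp add: Q.inv_mult_group Q.m_assoc)
      then show "\<Phi> (inv (x \<otimes> q) \<otimes> x) = \<Phi> (inv q)" by (simp only:)
    qed
    also have "\<dots> = (\<integral>\<^sup>+y. \<Phi> y * ennreal (1 / \<Delta> y) \<partial>\<mu>Q)" by (rule Q.nn_integral_inverse[OF \<Phi>])
    finally show "(\<integral>\<^sup>+q. ennreal ((cmod (\<phi>1 x))\<^sup>2) * \<Phi> (inv q \<otimes> x) \<partial>\<mu>Q) =
        ennreal ((cmod (\<phi>1 x))\<^sup>2) * (\<integral>\<^sup>+y. \<Phi> y * ennreal (1 / \<Delta> y) \<partial>\<mu>Q)"
      by (simp add: nn_integral_cmult[OF m2])
  qed
  also have "\<dots> = (\<integral>\<^sup>+x. ennreal ((cmod (\<phi>1 x))\<^sup>2) \<partial>\<mu>Q) * (\<integral>\<^sup>+y. \<Phi> y * ennreal (1 / \<Delta> y) \<partial>\<mu>Q)"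
    by (rule nn_integral_multc) measurable
  also have "(\<integral>\<^sup>+y. \<Phi> y * ennreal (1 / \<Delta> y) \<partial>\<mu>Q) = (\<integral>\<^sup>+x. ennreal (mo x / \<Delta> x * (cmod (\<phi>2 x))\<^sup>2) \<partial>\<mu>Q)"
  proof (rule nn_integral_cong)
    fix y assume y: "y \<in> space \<mu>Q"
    have "0 < \<Delta> y" using Q.modular_function_pos y by (simp add: Q.space_haar)
    then show "\<Phi> y * ennreal (1 / \<Delta> y) = ennreal (mo y / \<Delta> y * (cmod (\<phi>2 y))\<^sup>2)"
      using mo_pos[OF y] by (simp add: \<Phi>_def ennreal_mult[symmetric] mult_ac)
  qed
  finally show ?thesis unfolding C_def .
qed

lemma mult_op: "multiplication_operator \<mu>Q (\<lambda>q. mo q / \<Delta> q)"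
proof
  show "(\<lambda>q. mo q / \<Delta> q) \<in> borel_measurable \<mu>Q"
    using mo_measurable Q.measurable_modular_function by measurable
  show "0 < mo q / \<Delta> q" if "q \<in> space \<mu>Q" for q
    using mo_pos[OF that] Q.modular_function_pos[of q] that by (simp add: Q.space_haar)
qed

lemma mult_op_sqrt: "multiplication_operator \<mu>Q (\<lambda>q. sqrt (mo q / \<Delta> q))"
proof -
  interpret D: multiplication_operator \<mu>Q "\<lambda>q. mo q / \<Delta> q" by (rule mult_op)
  show ?thesis by unfold_locales (use D.m_pos in auto)
qed

lemma coefficient_formula_domain:
  assumes \<phi>1: "\<phi>1 \<in> L2 \<mu>Q"
    and S: "(\<phi>2, \<psi>) \<in> L2_mult_operator \<mu>Q (\<lambda>q. complex_of_real (sqrt (mo q / \<Delta> q)))"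
  shows "(\<integral>\<^sup>+g. ennreal ((cmod (L2_inner \<mu>Q \<phi>1 (\<pi> g \<phi>2)))\<^sup>2) \<partial>\<mu>G) =
    ennreal ((L2_norm \<mu>Q \<phi>1)\<^sup>2 * (L2_norm \<mu>Q \<psi>)\<^sup>2)"
proof -
  interpret D: multiplication_operator \<mu>Q "\<lambda>q. mo q / \<Delta> q" by (rule mult_op)
  interpret S: multiplication_operator \<mu>Q "\<lambda>q. sqrt (mo q / \<Delta> q)" by (rule mult_op_sqrt)
  have \<phi>2: "\<phi>2 \<in> L2 \<mu>Q" and \<psi>: "\<psi> \<in> L2 \<mu>Q"
    and eq: "AE x in \<mu>Q. \<psi> x = of_real (sqrt (mo x / \<Delta> x)) * \<phi>2 x"
    using S by (auto simp: S.D_iff)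
  have "AE x in \<mu>Q. 0 < mo x / \<Delta> x" using D.m_pos by (rule AE_I2)
  with eq have "AE x in \<mu>Q. ennreal (mo x / \<Delta> x * (cmod (\<phi>2 x))\<^sup>2) = ennreal ((cmod (\<psi> x))\<^sup>2)"
  proof eventually_elim
    case (elim x)
    have "(cmod (complex_of_real (sqrt (mo x / \<Delta> x)) * \<phi>2 x))\<^sup>2 = mo x / \<Delta> x * (cmod (\<phi>2 x))\<^sup>2"
      using elim(2) by (simp only: norm_mult power_mult_distrib norm_of_real power2_abs) simp
    then show ?case using elim(1) by simp
  qed
  then have "(\<integral>\<^sup>+x. ennreal (mo x / \<Delta> x * (cmod (\<phi>2 x))\<^sup>2) \<partial>\<mu>Q) = ennreal ((L2_norm \<mu>Q \<psi>)\<^sup>2)"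
    unfolding nn_integral_L2_norm[OF \<psi>, symmetric] by (rule nn_integral_cong_AE)
  then show ?thesis
    unfolding coefficient_formula[OF \<phi>1 \<phi>2] nn_integral_L2_norm[OF \<phi>1]
    by (simp add: ennreal_mult)
qed

text \<open>Outside the domain the second factor of the formula is infinite. The first must be
  positive, since 0 times infinity is 0; hence the condition on \<open>\<phi>1\<close>.\<close>

lemma coefficient_formula_outside:
  assumes \<phi>1: "\<phi>1 \<in> L2 \<mu>Q" "\<not> L2_eq \<mu>Q \<phi>1 (\<lambda>_. 0)" and \<phi>2: "\<phi>2 \<in> L2 \<mu>Q"
    and S: "\<phi>2 \<notin> Domain (L2_mult_operator \<mu>Q (\<lambda>q. complex_of_real (sqrt (mo q / \<Delta> q))))"
  shows "(\<integral>\<^sup>+g. ennreal ((cmod (L2_inner \<mu>Q \<phi>1 (\<pi> g \<phi>2)))\<^sup>2) \<partial>\<mu>G) = \<infinity>"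
proof -
  interpret D: multiplication_operator \<mu>Q "\<lambda>q. mo q / \<Delta> q" by (rule mult_op)
  interpret S: multiplication_operator \<mu>Q "\<lambda>q. sqrt (mo q / \<Delta> q)" by (rule mult_op_sqrt)
  define \<psi> where "\<psi> x = of_real (sqrt (mo x / \<Delta> x)) * \<phi>2 x" for x
  have m: "\<psi> \<in> borel_measurable \<mu>Q"
    unfolding \<psi>_def[abs_def] using S.measurable_m L2_measurable[OF \<phi>2] by measurable
  have "\<psi> \<notin> L2 \<mu>Q"
  proof
    assume "\<psi> \<in> L2 \<mu>Q"
    then have "(\<phi>2, \<psi>) \<in> S.D" using \<phi>2 by (simp add: S.D_iff \<psi>_def)
    then show False using S by blast
  qed
  then have "(\<integral>\<^sup>+x. ennreal ((cmod (\<psi> x))\<^sup>2) \<partial>\<mu>Q) = \<infinity>" by (rule nn_integral_not_L2[OF m])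
  moreover have "(\<integral>\<^sup>+x. ennreal ((cmod (\<psi> x))\<^sup>2) \<partial>\<mu>Q) = (\<integral>\<^sup>+x. ennreal (mo x / \<Delta> x * (cmod (\<phi>2 x))\<^sup>2) \<partial>\<mu>Q)"
  proof (rule nn_integral_cong)
    fix x assume "x \<in> space \<mu>Q"
    then have "0 < mo x / \<Delta> x" by (rule D.m_pos)
    then have "(cmod (\<psi> x))\<^sup>2 = mo x / \<Delta> x * (cmod (\<phi>2 x))\<^sup>2"
      unfolding \<psi>_def by (simp only: norm_mult power_mult_distrib norm_of_real power2_abs) simp
    then show "ennreal ((cmod (\<psi> x))\<^sup>2) = ennreal (mo x / \<Delta> x * (cmod (\<phi>2 x))\<^sup>2)" by simp
  qed
  moreover have "(L2_norm \<mu>Q \<phi>1)\<^sup>2 \<noteq> 0" using L2_norm_eq_0[OF \<phi>1(1)] \<phi>1(2) by simp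
  ultimately show ?thesis
    unfolding coefficient_formula[OF \<phi>1(1) \<phi>2] nn_integral_L2_norm[OF \<phi>1(1)]
    by (simp add: ennreal_mult_top)
qed

text \<open>The square root is multiplication by the root of the weight, and its domain consists of
  the L2 functions whose product with that root is in L2, exactly where the weighted integral in
  \<open>coefficient_formula\<close> is finite.\<close>

theorem duflo_moore:
  "duflo_moore_operator \<mu>G \<mu>Q \<pi> (L2_mult_operator \<mu>Q (\<lambda>q. complex_of_real (mo q / \<Delta> q)))"
proof -
  interpret D: multiplication_operator \<mu>Q "\<lambda>q. mo q / \<Delta> q" by (rule mult_op)
  have "L2_positive_sqrt \<mu>Q D.D (L2_mult_operator \<mu>Q (\<lambda>q. complex_of_real (sqrt (mo q / \<Delta> q))))"
    by (rule L2_mult_operator_sqrt[OF mult_op])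
  then show ?thesis
    unfolding duflo_moore_operator_def
    using D.D_positive D.D_nonsingular coefficient_formula_domain coefficient_formula_outside
    by (intro conjI exI) (assumption | blast)+
qed

section \<open>Square-integrability and irreducibility\<close>

lemma nonzero_L2:
  obtains \<phi> where "\<phi> \<in> L2 \<mu>Q" "\<not> L2_eq \<mu>Q \<phi> (\<lambda>_. 0)"
proof -
  obtain A a where A: "A \<in> sets \<mu>Q" "0 < a" "emeasure \<mu>Q A = ennreal a"
    by (rule Q.finite_positive_set)
  have "(\<lambda>x. indicator A x * 1 :: complex) \<in> L2 \<mu>Q"
    using A by (intro L2_bounded_finite_support(1)[where C = 1]) auto
  moreover have "\<not> L2_eq \<mu>Q (\<lambda>x. indicator A x * 1) (\<lambda>_. 0)"
  proof
    assume "L2_eq \<mu>Q (\<lambda>x. indicator A x * 1) (\<lambda>_. 0)"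
    then have "AE x in \<mu>Q. x \<notin> A"
      unfolding L2_eq_def by eventually_elim (simp add: indicator_def split: if_splits)
    then have "emeasure \<mu>Q A = 0"
      using A(1) by (subst (asm) AE_iff_measurable[OF A(1)]) (auto dest: sets.sets_into_space)
    then show False using A by simp
  qed
  ultimately show thesis by (rule that)
qed

text \<open>A product in \<open>ennreal\<close> vanishes only if a factor does, and the weight
  \<open>mo / \<Delta>\<close> is strictly positive. This is the form in which the coefficient
  formula yields irreducibility.\<close>

lemma coefficient_nonzero:
  assumes \<phi>: "\<phi>1 \<in> L2 \<mu>Q" "\<phi>2 \<in> L2 \<mu>Q"
    and 0: "(\<integral>\<^sup>+g. ennreal ((cmod (L2_inner \<mu>Q \<phi>1 (\<pi> g \<phi>2)))\<^sup>2) \<partial>\<mu>G) = 0"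
  shows "L2_eq \<mu>Q \<phi>1 (\<lambda>_. 0) \<or> L2_eq \<mu>Q \<phi>2 (\<lambda>_. 0)"
proof -
  interpret D: multiplication_operator \<mu>Q "\<lambda>q. mo q / \<Delta> q" by (rule mult_op)
  note [measurable] = L2_measurable[OF \<phi>(1)] L2_measurable[OF \<phi>(2)]
    Q.measurable_modular_function
  from 0 consider "(\<integral>\<^sup>+x. ennreal ((cmod (\<phi>1 x))\<^sup>2) \<partial>\<mu>Q) = 0"
    | "(\<integral>\<^sup>+x. ennreal (mo x / \<Delta> x * (cmod (\<phi>2 x))\<^sup>2) \<partial>\<mu>Q) = 0"
    unfolding coefficient_formula[OF \<phi>] by auto
  then show ?thesis
  proof cases
    case 1
    then have "AE x in \<mu>Q. ennreal ((cmod (\<phi>1 x))\<^sup>2) = 0" by (subst (asm) nn_integral_0_iff_AE) auto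
    then have "AE x in \<mu>Q. \<phi>1 x = 0" by eventually_elim (simp add: ennreal_eq_0_iff)
    then show ?thesis by (simp add: L2_eq_def)
  next
    case 2
    then have "AE x in \<mu>Q. ennreal (mo x / \<Delta> x * (cmod (\<phi>2 x))\<^sup>2) = 0"
      by (subst (asm) nn_integral_0_iff_AE) auto
    moreover have "AE x in \<mu>Q. 0 < mo x / \<Delta> x" using D.m_pos by (rule AE_I2)
    ultimately have "AE x in \<mu>Q. \<phi>2 x = 0"
    proof eventually_elim
      case (elim x)
      then have "mo x / \<Delta> x * (cmod (\<phi>2 x))\<^sup>2 \<le> 0" by (simp only: ennreal_eq_0_iff)
      then have "(cmod (\<phi>2 x))\<^sup>2 \<le> 0" using elim(2) by (simp only: mult_le_0_iff) auto
      then show ?case by simp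
    qed
    then show ?thesis by (simp add: L2_eq_def)
  qed
qed

theorem square_integrable: "square_integrable_rep \<mu>G \<mu>Q \<pi>"
proof -
  interpret D: multiplication_operator \<mu>Q "\<lambda>q. mo q / \<Delta> q" by (rule mult_op)
  interpret S: multiplication_operator \<mu>Q "\<lambda>q. sqrt (mo q / \<Delta> q)" by (rule mult_op_sqrt)
  obtain \<phi> where \<phi>: "\<phi> \<in> L2 \<mu>Q" "\<not> L2_eq \<mu>Q \<phi> (\<lambda>_. 0)" by (rule nonzero_L2)
  have "0 < L2_norm \<mu>Q \<phi>"
    using L2_norm_eq_0[OF \<phi>(1)] \<phi>(2) L2_norm_nonneg[of \<mu>Q \<phi>] by (simp add: less_le)
  \<comment> \<open>The domain of the square root is dense; an approximation closer to
    \<open>\<phi>\<close> than the norm of \<open>\<phi>\<close> cannot be null.\<close>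
  then obtain f where f: "f \<in> Domain S.D" "L2_norm \<mu>Q (\<lambda>x. \<phi> x - f x) < L2_norm \<mu>Q \<phi>"
    using S.D_densely_defined \<phi>(1) unfolding L2_densely_defined_def by blast
  then obtain k where k: "(f, k) \<in> S.D" by blast
  then have fL: "f \<in> L2 \<mu>Q" by (simp add: S.D_iff)
  have "\<not> L2_eq \<mu>Q f (\<lambda>_. 0)"
  proof
    assume "L2_eq \<mu>Q f (\<lambda>_. 0)"
    then have AE: "AE x in \<mu>Q. (cmod (\<phi> x - f x))\<^sup>2 = (cmod (\<phi> x))\<^sup>2"
      unfolding L2_eq_def by eventually_elim simp
    note [measurable] = L2_measurable[OF \<phi>(1)] L2_measurable[OF fL]
    have "L2_norm \<mu>Q (\<lambda>x. \<phi> x - f x) = L2_norm \<mu>Q \<phi>"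
      unfolding L2_norm_def using AE by (intro arg_cong[where f = sqrt] integral_cong_AE) measurable
    then show False using f(2) by simp
  qed
  then show ?thesis
    unfolding square_integrable_rep_def
    using \<phi> fL coefficient_formula_domain[OF \<phi>(1) k]
    by (intro bexI[of _ \<phi>] bexI[of _ f] conjI) simp_all
qed

theorem irreducible: "irreducible_rep G \<mu>Q \<pi>"
  unfolding irreducible_rep_def
proof (intro conjI allI impI)
  show "\<exists>\<phi>\<in>L2 \<mu>Q. \<not> L2_eq \<mu>Q \<phi> (\<lambda>_. 0)" using nonzero_L2 by blast
  fix W assume W: "L2_closed_subspace \<mu>Q W \<and> (\<forall>g\<in>carrier G. \<forall>\<phi>\<in>W. \<pi> g \<phi> \<in> W)"
  show "W = {\<phi> \<in> L2 \<mu>Q. L2_eq \<mu>Q \<phi> (\<lambda>_. 0)} \<or> W = L2 \<mu>Q"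
  proof (rule disjCI)
    assume "W \<noteq> L2 \<mu>Q"
    then obtain h where h: "h \<in> L2 \<mu>Q" "\<not> L2_eq \<mu>Q h (\<lambda>_. 0)"
        "\<And>w. w \<in> W \<Longrightarrow> L2_inner \<mu>Q h w = 0"
      using L2_orthogonal_complement[of \<mu>Q W] W by blast
    have W2: "W \<subseteq> L2 \<mu>Q" and W0: "(\<lambda>_. 0) \<in> W"
      and Wcl: "\<And>f. f \<in> L2 \<mu>Q \<Longrightarrow> (\<forall>\<epsilon>>0. \<exists>g\<in>W. L2_norm \<mu>Q (\<lambda>x. f x - g x) < \<epsilon>) \<Longrightarrow> f \<in> W"
      using W by (auto simp: L2_closed_subspace_def)
    show "W = {\<phi> \<in> L2 \<mu>Q. L2_eq \<mu>Q \<phi> (\<lambda>_. 0)}"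
    proof (intro equalityI subsetI)
      fix \<phi> assume \<phi>: "\<phi> \<in> W"
      then have \<phi>L: "\<phi> \<in> L2 \<mu>Q" using W2 by auto
      have "(\<integral>\<^sup>+g. ennreal ((cmod (L2_inner \<mu>Q h (\<pi> g \<phi>)))\<^sup>2) \<partial>\<mu>G) = (\<integral>\<^sup>+g. 0 \<partial>\<mu>G)"
      proof (rule nn_integral_cong)
        fix g assume "g \<in> space \<mu>G"
        then have "g \<in> carrier G"
          by (simp add: extension_haar_def space_pair_measure Q.space_haar V.space_haar extension_group_def)
        then have "\<pi> g \<phi> \<in> W" using W \<phi> by blast
        then show "ennreal ((cmod (L2_inner \<mu>Q h (\<pi> g \<phi>)))\<^sup>2) = 0" using h(3) by simp
      qed
      then have "L2_eq \<mu>Q \<phi> (\<lambda>_. 0)" using coefficient_nonzero[OF h(1) \<phi>L] h(2) by simp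
      then show "\<phi> \<in> {\<phi> \<in> L2 \<mu>Q. L2_eq \<mu>Q \<phi> (\<lambda>_. 0)}" using \<phi>L by simp
    next
      fix \<phi> assume "\<phi> \<in> {\<phi> \<in> L2 \<mu>Q. L2_eq \<mu>Q \<phi> (\<lambda>_. 0)}"
      then have \<phi>: "\<phi> \<in> L2 \<mu>Q" "L2_norm \<mu>Q \<phi> = 0" by (auto simp: L2_norm_eq_0)
      \<comment> \<open>Closedness of \<open>W\<close> absorbs null functions: they are at distance
        0 from the zero function, which lies in \<open>W\<close>.\<close>
      show "\<phi> \<in> W" by (rule Wcl[OF \<phi>(1)]) (use W0 \<phi>(2) in \<open>auto intro!: bexI[of _ "\<lambda>_. 0"]\<close>)
    qed
  qed
qed

section \<open>Unitarity, the multiplier and the projective relation\<close>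

text \<open>The operator is a left translation followed by multiplication with the unimodular
  function \<open>m\<close>; both preserve inner products.\<close>

lemma representation_unitary:
  assumes q: "q \<in> carrier Q" and v: "v \<in> carrier V"
  shows "L2_unitary \<mu>Q \<mu>Q (\<pi> (q, v))"
proof -
  define m where "m x = cnj (\<eta> x v) * b (inv x) q" for x
  have \<pi>: "\<pi> (q, v) \<phi> = (\<lambda>x. m x * \<phi> (inv q \<otimes> x))" for \<phi>
    by (simp add: L2_representation_def m_def)
  have q': "inv q \<in> carrier Q" using q by simp
  have id: "(\<lambda>x. x) \<in> \<mu>Q \<rightarrow>\<^sub>M \<mu>Q" by (rule measurable_ident_sets[OF refl])
  have [measurable]: "(\<lambda>x. \<eta> x v) \<in> borel_measurable \<mu>Q"
    by (intro measurable_\<eta>_pairing id V.measurable_const_carrier v)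
  have [measurable]: "(\<lambda>x. b (inv x) q) \<in> borel_measurable \<mu>Q"
    by (intro measurable_b Q.measurable_m_inv id Q.measurable_const_carrier q)
  have m [measurable]: "m \<in> borel_measurable \<mu>Q" unfolding m_def[abs_def] by measurable
  have m1: "cmod (m x) = 1" if "x \<in> carrier Q" for x
    using that q v by (simp add: m_def norm_mult \<eta>_norm b_norm)
  then have mc: "m x * cnj (m x) = 1" if "x \<in> carrier Q" for x
    using that by (simp add: complex_norm_square[symmetric])
  have shift: "(\<lambda>x. \<phi> (g \<otimes> x)) \<in> L2 \<mu>Q" if "\<phi> \<in> L2 \<mu>Q" "g \<in> carrier Q" for \<phi> g
    using that measurable_compose[OF Q.measurable_lmult[OF that(2)] L2_measurable[OF that(1)]]
      Q.integrable_translate[OF that(2), of "\<lambda>x. (cmod (\<phi> x))\<^sup>2"] L2_measurable[OF that(1)]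
    by (simp add: L2_def)
  show ?thesis
    unfolding L2_unitary_def
  proof (intro conjI ballI allI impI)
    fix f g a b assume f: "f \<in> L2 \<mu>Q" and g: "g \<in> L2 \<mu>Q"
    note [measurable] = L2_measurable[OF f] L2_measurable[OF g]
    show "\<pi> (q, v) f \<in> L2 \<mu>Q"
      unfolding \<pi> by (rule L2_mult_bounded[OF shift[OF f q'] m, where C = 1]) (simp add: m1 Q.space_haar)
    show "L2_eq \<mu>Q (\<pi> (q, v) f) (\<pi> (q, v) g)" if "L2_eq \<mu>Q f g"
      using Q.AE_translate[OF q' that[unfolded L2_eq_def]] unfolding L2_eq_def \<pi>
      by eventually_elim simp
    show "L2_eq \<mu>Q (\<pi> (q, v) (\<lambda>x. a * f x + b * g x)) (\<lambda>y. a * \<pi> (q, v) f y + b * \<pi> (q, v) g y)"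
      unfolding L2_eq_def \<pi> by (intro AE_I2) (simp add: algebra_simps)
    have "L2_inner \<mu>Q (\<pi> (q, v) f) (\<pi> (q, v) g) =
        (\<integral>x. f (inv q \<otimes> x) * cnj (g (inv q \<otimes> x)) \<partial>\<mu>Q)"
      unfolding L2_inner_def \<pi>
    proof (intro Bochner_Integration.integral_cong refl)
      fix x assume "x \<in> space \<mu>Q"
      then have "m x * cnj (m x) = 1" by (intro mc) (simp add: Q.space_haar)
      then show "m x * f (inv q \<otimes> x) * cnj (m x * g (inv q \<otimes> x)) =
          f (inv q \<otimes> x) * cnj (g (inv q \<otimes> x))"
        by (simp add: mult_ac)
    qed
    also have "\<dots> = L2_inner \<mu>Q f g"
      unfolding L2_inner_def by (intro Q.integral_translate[OF q', of "\<lambda>x. f x * cnj (g x)"]) measurable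
    finally show "L2_inner \<mu>Q (\<pi> (q, v) f) (\<pi> (q, v) g) = L2_inner \<mu>Q f g" .
  next
    fix h assume h: "h \<in> L2 \<mu>Q"
    \<comment> \<open>The preimage of \<open>h\<close> undoes the two operations in reverse order:
      multiplication by the conjugate of \<open>m\<close>, then translation by
      \<open>q\<close>.\<close>
    have "(\<lambda>x. cnj (m x) * h x) \<in> L2 \<mu>Q"
      by (rule L2_mult_bounded[OF h, where C = 1]) (auto simp: m1 Q.space_haar)
    from shift[OF this q]
    have f: "(\<lambda>x. cnj (m (q \<otimes> x)) * h (q \<otimes> x)) \<in> L2 \<mu>Q" .
    have "L2_eq \<mu>Q (\<pi> (q, v) (\<lambda>x. cnj (m (q \<otimes> x)) * h (q \<otimes> x))) h"
      unfolding L2_eq_def \<pi>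
    proof (rule AE_I2)
      fix x assume "x \<in> space \<mu>Q"
      then have x: "x \<in> carrier Q" by (simp add: Q.space_haar)
      then have "q \<otimes> (inv q \<otimes> x) = x" using q by (simp add: Q.m_assoc[symmetric])
      then show "m x * (cnj (m (q \<otimes> (inv q \<otimes> x))) * h (q \<otimes> (inv q \<otimes> x))) = h x"
        using mc[OF x] by (simp add: mult.assoc[symmetric])
    qed
    then show "\<exists>f\<in>L2 \<mu>Q. L2_eq \<mu>Q (\<pi> (q, v) f) h" using f by blast
  qed
qed

text \<open>At a point \<open>x\<close>, the cocycle rule for \<open>\<eta>\<close> at
  \<open>inv q1 \<otimes> x\<close> splits off the character in the multiplier, and
  \<open>\<psi> = \<partial>b\<close> at \<open>(inv x, q1, q2)\<close> trades the two values of
  \<open>b\<close> for \<open>b q1 q2\<close>, the value belonging to the product and the character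
  of \<open>\<beta> q1 q2\<close>.\<close>

lemma representation_mult:
  assumes q: "q1 \<in> carrier Q" "q2 \<in> carrier Q" "x \<in> carrier Q" and v: "v1 \<in> carrier V" "v2 \<in> carrier V"
  shows "\<pi> (q1, v1) (\<pi> (q2, v2) \<phi>) x =
    omega_cocycle Q \<eta> b (q1, v1) (q2, v2) * \<pi> ((q1, v1) \<otimes>\<^bsub>G\<^esub> (q2, v2)) \<phi> x"
proof -
  define x' where "x' = inv x"
  have x': "x' \<in> carrier Q" "inv x' = x" using q by (simp_all add: x'_def)
  have i: "inv (inv q1 \<otimes> x) = x' \<otimes> q1"
    using q by (simp add: x'_def Q.inv_mult_group)
  have i2: "inv q2 \<otimes> (inv q1 \<otimes> x) = inv (q1 \<otimes> q2) \<otimes> x"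
    using q by (simp add: Q.inv_mult_group Q.m_assoc)
  \<comment> \<open>The dual action of \<open>inv q1\<close> evaluates at the action of its inverse,
    so \<open>act q1 v2\<close> appears, as in the product of the extension.\<close>
  have c: "\<eta> (inv q1 \<otimes> x) v2 = \<eta> (inv q1) v2 * \<eta> x (act q1 v2)"
    using \<eta>_cocycle[of "inv q1" x v2] q v by simp
  have p: "\<eta> x (v1 \<otimes>\<^bsub>V\<^esub> act q1 v2 \<otimes>\<^bsub>V\<^esub> \<beta> q1 q2) = \<eta> x v1 * \<eta> x (act q1 v2) * \<eta> x (\<beta> q1 q2)"
    using q v by (simp add: \<eta>_hom act_closed \<beta>_closed)
  have psi: "\<eta> x (\<beta> q1 q2) * (b x' q1 * b (x' \<otimes> q1) q2) = b q1 q2 * b x' (q1 \<otimes> q2)"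
    using \<eta>_\<beta>[OF x'(1) q(1,2)] x'(2) by simp
  have key: "b x' q1 * b (x' \<otimes> q1) q2 = cnj (\<eta> x (\<beta> q1 q2)) * (b q1 q2 * b x' (q1 \<otimes> q2))"
  proof -
    have "\<eta> x (\<beta> q1 q2) * cnj (\<eta> x (\<beta> q1 q2)) = 1" using q by (simp add: \<eta>_cnj_self \<beta>_closed)
    then show ?thesis
      unfolding psi[symmetric] mult.assoc[symmetric] mult.commute[of "cnj (\<eta> x (\<beta> q1 q2))"] by simp
  qed
  have "\<pi> (q1, v1) (\<pi> (q2, v2) \<phi>) x =
      cnj (\<eta> x v1) * cnj (\<eta> (inv q1) v2 * \<eta> x (act q1 v2)) *
      (b x' q1 * b (x' \<otimes> q1) q2) * \<phi> (inv (q1 \<otimes> q2) \<otimes> x)"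
    unfolding L2_representation_def prod.case x'_def[symmetric] i i2 c
    by (simp only: mult_ac complex_cnj_mult)
  also have "\<dots> = omega_cocycle Q \<eta> b (q1, v1) (q2, v2) * \<pi> ((q1, v1) \<otimes>\<^bsub>G\<^esub> (q2, v2)) \<phi> x"
    unfolding L2_representation_def omega_cocycle_def extension_group_def monoid.simps prod.case
      x'_def[symmetric] key p
    by (simp only: mult_ac complex_cnj_mult)
  finally show ?thesis .
qed

text \<open>The computation is that of \<open>representation_mult\<close> with \<open>inv q1\<close>
  in the role of the point \<open>x\<close>.\<close>

lemma omega_identity:
  assumes q: "q1 \<in> carrier Q" "q2 \<in> carrier Q" "q3 \<in> carrier Q"
    and v: "v1 \<in> carrier V" "v2 \<in> carrier V" "v3 \<in> carrier V"
  shows "omega_cocycle Q \<eta> b (q1, v1) (q2, v2) *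
      omega_cocycle Q \<eta> b ((q1, v1) \<otimes>\<^bsub>G\<^esub> (q2, v2)) (q3, v3) =
    omega_cocycle Q \<eta> b (q2, v2) (q3, v3) *
      omega_cocycle Q \<eta> b (q1, v1) ((q2, v2) \<otimes>\<^bsub>G\<^esub> (q3, v3))"
proof -
  define y where "y = inv q1"
  have y: "y \<in> carrier Q" using q by (simp add: y_def)
  \<comment> \<open>Here \<open>inv (q1 \<otimes> q2)\<close> is \<open>inv q2 \<otimes> y\<close>,
    and the cocycle rule splits it with \<open>inv q2\<close> as the left factor.\<close>
  have c: "\<eta> (inv (q1 \<otimes> q2)) v3 = \<eta> (inv q2) v3 * \<eta> y (act q2 v3)"
    using \<eta>_cocycle[of "inv q2" y v3] q v y by (simp add: y_def Q.inv_mult_group)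
  have p: "\<eta> y (v2 \<otimes>\<^bsub>V\<^esub> act q2 v3 \<otimes>\<^bsub>V\<^esub> \<beta> q2 q3) = \<eta> y v2 * \<eta> y (act q2 v3) * \<eta> y (\<beta> q2 q3)"
    using q v y by (simp add: \<eta>_hom act_closed \<beta>_closed)
  have psi: "\<eta> y (\<beta> q2 q3) * (b q1 q2 * b (q1 \<otimes> q2) q3) = b q2 q3 * b q1 (q2 \<otimes> q3)"
    using \<eta>_\<beta>[OF q] by (simp add: y_def)
  have key: "b q1 q2 * b (q1 \<otimes> q2) q3 = cnj (\<eta> y (\<beta> q2 q3)) * (b q2 q3 * b q1 (q2 \<otimes> q3))"
  proof -
    have "\<eta> y (\<beta> q2 q3) * cnj (\<eta> y (\<beta> q2 q3)) = 1" using q y by (simp add: \<eta>_cnj_self \<beta>_closed)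
    then show ?thesis
      unfolding psi[symmetric] mult.assoc[symmetric] mult.commute[of "cnj (\<eta> y (\<beta> q2 q3))"] by simp
  qed
  have "omega_cocycle Q \<eta> b (q1, v1) (q2, v2) *
      omega_cocycle Q \<eta> b ((q1, v1) \<otimes>\<^bsub>G\<^esub> (q2, v2)) (q3, v3) =
      cnj (\<eta> y v2) * cnj (\<eta> (inv q2) v3 * \<eta> y (act q2 v3)) * (b q1 q2 * b (q1 \<otimes> q2) q3)"
    unfolding omega_cocycle_def extension_group_def monoid.simps prod.case y_def[symmetric] c
    by (simp only: mult_ac complex_cnj_mult)
  also have "\<dots> = omega_cocycle Q \<eta> b (q2, v2) (q3, v3) *
      omega_cocycle Q \<eta> b (q1, v1) ((q2, v2) \<otimes>\<^bsub>G\<^esub> (q3, v3))"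
    unfolding omega_cocycle_def extension_group_def monoid.simps prod.case y_def[symmetric] key p
    by (simp only: mult_ac complex_cnj_mult)
  finally show ?thesis .
qed

lemma omega_cocycle_2cocycle:
  assumes TG: "sets (borel_of TG) = sets (\<mu>Q \<Otimes>\<^sub>M \<mu>V)"
  shows "omega_cocycle Q \<eta> b \<in> circle_2cocycles G TG"
proof -
  let ?M = "(\<mu>Q \<Otimes>\<^sub>M \<mu>V) \<Otimes>\<^sub>M (\<mu>Q \<Otimes>\<^sub>M \<mu>V)"
  have 1: "(\<lambda>p. cnj (\<eta> (inv (fst (fst p))) (snd (snd p)))) \<in> borel_measurable ?M"
    by (rule measurable_compose[OF _ borel_measurable_cnj])
      (intro measurable_\<eta>_pairing Q.measurable_m_inv; measurable)
  have 2: "(\<lambda>p. b (fst (fst p)) (fst (snd p))) \<in> borel_measurable ?M"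
    by (intro measurable_b; measurable)
  have "(\<lambda>(g1, g2). omega_cocycle Q \<eta> b g1 g2) \<in> ?M \<rightarrow>\<^sub>M borel_of circle_topology"
    unfolding measurable_circle_topology
  proof
    show "(\<lambda>(g1, g2). omega_cocycle Q \<eta> b g1 g2) \<in> borel_measurable ?M"
      using borel_measurable_times[OF 1 2] by (simp add: omega_cocycle_def case_prod_beta')
    show "\<forall>p\<in>space ?M. cmod (case p of (g1, g2) \<Rightarrow> omega_cocycle Q \<eta> b g1 g2) = 1"
      by (auto simp: space_pair_measure Q.space_haar V.space_haar omega_cocycle_def norm_mult
          \<eta>_norm b_norm)
  qed
  then have "omega_cocycle Q \<eta> b \<in> circle_2cochains TG"
    unfolding borel_2cochains_def
    by (simp add: measurable_cong_sets[OF sets_pair_measure_cong[OF TG TG] refl])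
  moreover have "carrier G = carrier Q \<times> carrier V" by (simp add: extension_group_def)
  ultimately show ?thesis
    using omega_identity by (simp add: borel_2cocycles_def circle_group_def)
qed

theorem projective_unitary:
  assumes TG: "sets (borel_of TG) = sets (\<mu>Q \<Otimes>\<^sub>M \<mu>V)"
  shows "projective_unitary_rep G TG (omega_cocycle Q \<eta> b) \<mu>Q \<pi>"
  unfolding projective_unitary_rep_def
proof (intro conjI ballI)
  have G: "carrier G = carrier Q \<times> carrier V" by (simp add: extension_group_def)
  show "omega_cocycle Q \<eta> b \<in> circle_2cocycles G TG" by (rule omega_cocycle_2cocycle[OF TG])
  show "L2_unitary \<mu>Q \<mu>Q (\<pi> g)" if "g \<in> carrier G" for g
    using that representation_unitary unfolding G by (cases g) auto
  show "(\<lambda>g. L2_inner \<mu>Q \<phi>1 (\<pi> g \<phi>2)) \<in> borel_measurable (borel_of TG)"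
    if "\<phi>1 \<in> L2 \<mu>Q" "\<phi>2 \<in> L2 \<mu>Q" for \<phi>1 \<phi>2
    using measurable_coefficient[OF that] by (simp add: measurable_cong_sets[OF TG refl])
  show "L2_eq \<mu>Q (\<pi> g1 (\<pi> g2 \<phi>)) (\<lambda>x. omega_cocycle Q \<eta> b g1 g2 * \<pi> (g1 \<otimes>\<^bsub>G\<^esub> g2) \<phi> x)"
    if "g1 \<in> carrier G" "g2 \<in> carrier G" for g1 g2 \<phi>
  proof -
    obtain q1 v1 q2 v2 where g: "g1 = (q1, v1)" "g2 = (q2, v2)" by (cases g1, cases g2)
    have "q1 \<in> carrier Q" "q2 \<in> carrier Q" "v1 \<in> carrier V" "v2 \<in> carrier V"
      using that unfolding G g by auto
    then show ?thesis
      unfolding L2_eq_def g by (intro AE_I2 representation_mult) (simp_all add: Q.space_haar)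
  qed
qed

end

theorem proposition2p1:
  fixes Q :: "'q monoid" and TQ :: "'q topology" and \<mu>Q :: "'q measure"
    and V :: "'v monoid" and TV :: "'v topology" and \<mu>V :: "'v measure"
    and \<mu>V' :: "('v \<Rightarrow> complex) measure"
    and act :: "'q \<Rightarrow> 'v \<Rightarrow> 'v"
    and \<eta> :: "'q \<Rightarrow> 'v \<Rightarrow> complex" and \<beta> :: "'q \<Rightarrow> 'q \<Rightarrow> 'v" and b :: "'q \<Rightarrow> 'q \<Rightarrow> complex"
    and TG :: "('q \<times> 'v) topology"
  defines "G \<equiv> extension_group Q V act \<beta>"
    and "\<mu>G \<equiv> extension_haar \<mu>Q \<mu>V act"
    and "\<pi> \<equiv> L2_representation Q \<eta> b"
  assumes Q: "lcsc_group Q TQ"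
    and V: "comm_group V" "lcsc_group V TV"
    and act: "continuous_action Q TQ V TV act"
    and haar_Q: "left_haar_measure Q TQ \<mu>Q"
    and haar_V: "left_haar_measure V TV \<mu>V"
    and haar_dual: "left_haar_measure (dual_group V TV) (dual_topology V TV) \<mu>V'"
    and \<eta>: "\<eta> \<in> continuous_dual_1cocycles Q TQ V TV act"
    and \<beta>: "\<beta> \<in> borel_2cocycles Q TQ V TV act"
    and compatible: "compatible Q TQ \<eta> \<beta>"
    and ess_bij: "essentially_bijective \<mu>Q \<mu>V' \<eta>"
    and normalization_Q: "\<forall>f\<in>borel_measurable \<mu>V'.
        (\<integral>\<^sup>+q. f (\<eta> q) * ennreal (1 / modulus \<mu>V act q) \<partial>\<mu>Q) = (\<integral>\<^sup>+\<xi>. f \<xi> \<partial>\<mu>V')"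
    and normalization_V: "fourier_unitary \<mu>V \<mu>V'"
    and G: "lcsc_group G TG" "sets (borel_of TG) = sets (borel_of TQ \<Otimes>\<^sub>M borel_of TV)"
    and b: "b \<in> circle_2cochains TQ"
    and psi_b: "\<forall>q1\<in>carrier Q. \<forall>q2\<in>carrier Q. \<forall>q3\<in>carrier Q.
        psi_cocycle Q \<eta> \<beta> q1 q2 q3 = coboundary2 Q b q1 q2 q3"
  shows "projective_unitary_rep G TG (omega_cocycle Q \<eta> b) \<mu>Q \<pi> \<and>
    irreducible_rep G \<mu>Q \<pi> \<and>
    square_integrable_rep \<mu>G \<mu>Q \<pi> \<and>
    duflo_moore_operator \<mu>G \<mu>Q \<pi>
           (L2_mult_operator \<mu>Q (\<lambda>q. of_real (modulus \<mu>V act q / modular_function Q \<mu>Q q)))"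
proof -
  have "group Q" "group V" using Q V(2) by (simp_all add: lcsc_group_def)
  then have "cocycle_pair Q TQ \<mu>Q V TV \<mu>V act \<mu>V' \<eta> \<beta> b"
    using Q V(2) act haar_Q haar_V haar_dual \<eta> \<beta> ess_bij normalization_Q normalization_V b psi_b
    by (intro cocycle_pair.intro haar_action.intro haar_group.intro haar_group_axioms.intro
        haar_action_axioms.intro cocycle_pair_axioms.intro)
      (simp_all add: left_haar_measure_def)
  then interpret cocycle_pair Q TQ \<mu>Q V TV \<mu>V act \<mu>V' \<eta> \<beta> b .
  \<comment> \<open>The topology of the extension need not be the product topology; the link to the
    product measure is the equality of the two Borel structures.\<close>
  have "sets (borel_of TG) = sets (\<mu>Q \<Otimes>\<^sub>M \<mu>V)"
    using G(2) sets_pair_measure_cong[OF Q.sets_haar V.sets_haar] by simp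
  then show ?thesis
    unfolding G_def \<mu>G_def \<pi>_def
    by (intro conjI projective_unitary irreducible square_integrable duflo_moore)
qed

end
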